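(* Let $\mathcal{X}$ be a compact Polish space, $\mathcal{Y}=\{y^k\}_{k=1}^{N_{\mathcal{Y}}}$ a finite set, and $\mathcal{Z}=\mathcal{X}\times\mathcal{Y}$. Let $\mathbb{P}_{\mathcal{X}}$ be a probability measure on $\mathcal{X}$, let $\hat{\mathbb{P}}_l=\frac{1}{N_l}\sum_{i=1}^{N_l}\delta_{z_\ell^i}$ be an empirical probability measure on $\mathcal{Z}$ (with $z_\ell^1,\dots,z_\ell^{N_l}\in\mathcal{Z}$), let $[\underline{p}^k,\overline{p}^k]\subseteq[0,1]$ for $k\in\{1,\dots,N_{\mathcal{Y}}\}$ be intervals, and let $\varepsilon\ge 0$. Let $c:\mathcal{Z}\times\mathcal{Z}\to[0,+\infty)$ be a nonnegative transportation cost that is both lower semicontinuous and upper semicontinuous, with $c(z,z')=0\Leftrightarrow z=z'$. Let $\{h_\theta\}_{\theta\in\Theta}$ be a parameterized family of hypotheses and $\ell$ a loss function, and assume that for each $\theta\in\Theta$ the function $(x,y)\mapsto \ell(h_\theta(x),y)$ from $\mathcal{Z}$ to $\mathbb{R}$ is upper semicontinuous. Define $$f(\theta)=\sup_{\mu\in\mathcal{U}\cap\mathcal{B}_\varepsilon(\hat{\mathbb{P}}_l)}\int_{\mathcal{X}\times\mathcal{Y}}\ell(h_\theta(x),y)\,d\mu(x,y)$$ and $$g(\theta)=\inf_{\alpha,\beta,\underline{\lambda},\overline{\lambda}}\ \alpha\varepsilon+\frac{1}{N_l}\sum_{i=1}^{N_l}\beta^i+\sum_{k=1}^{N_{\mathcal{Y}}}\left(\overline{\lambda}^k\overline{p}^k-\underline{\lambda}^k\underline{p}^k\right)+\int_{\mathcal{X}}\max_{\substack{1\le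 k\le N_{\mathcal{Y}}\\ 1\le i\le N_l}}\Big[\ell(h_\theta(x),y^k)-\big(\alpha\, c((x,y^k),z_\ell^i)+\beta^i\big)-(\overline{\lambda}^k-\underline{\lambda}^k)\Big]\,d\mathbb{P}_{\mathcal{X}}(x),$$ where the infimum is over $(\alpha,\beta,\overline{\lambda},\underline{\lambda})\in\mathbb{R}_+\times\mathbb{R}^{N_l}\times\mathbb{R}_+^{N_{\mathcal{Y}}}\times\mathbb{R}_+^{N_{\mathcal{Y}}}$. If $\mathcal{U}\cap\mathcal{B}_\varepsilon(\hat{\mathbb{P}}_l)\neq\emptyset$, then $$f(\theta)=g(\theta)\quad\text{for all }\theta\in\Theta.$$ Furthermore, if $\operatorname{relint}\big(\mathcal{U}\cap\mathcal{B}_\varepsilon(\hat{\mathbb{P}}_l)\big)\neq\emptyset$, then there exists a minimizer $(\alpha_*,\beta_*,\overline{\lambda}_*,\underline{\lambda}_* )\in\mathbb{R}_+\times\mathbb{R}^{N_l}\times\mathbb{R}_+^{N_{\mathcal{Y}}}\times\mathbb{R}_+^{N_{\mathcal{Y}}}$ attaining the infimum defining $g(\theta)$.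
   Context: The labels $y^1,\dots,y^{N_{\mathcal{Y}}}$ are distinct and $\mathcal{Y}$ carries the discrete topology. $\mathbb{R}_+=[0,\infty)$. For a Polish space $\mathcal{S}$, $\mathrm{Borel}(\mathcal{S})$ is its Borel $\sigma$-algebra, $\mathcal{M}_+(\mathcal{S})$ is the set of nonnegative Radon measures on it, and $\mathcal{Q}(\mathcal{S})$ is the set of (Borel) probability measures. A hypothesis is a map $h_\theta:\mathcal{X}\to\mathcal{Q}(\mathcal{Y})$ indexed by $\theta\in\Theta\subseteq\mathbb{R}^q$, and a loss is a function $\ell:\mathcal{Q}(\mathcal{Y})\times\mathcal{Y}\to\mathbb{R}$. Wasserstein distance: for $\mu,\nu\in\mathcal{Q}(\mathcal{Z})$, $$\mathcal{W}_c(\mu,\nu)=\inf_{\pi\in\Pi(\mu,\nu)}\int_{\mathcal{Z}\times\mathcal{Z}}c(z,z')\,d\pi(z,z'),$$ where $\Pi(\mu,\nu)$ is the set of $\pi\in\mathcal{M}_+(\mathcal{Z}\times\mathcal{Z})$ with first marginal $\mu$ and second marginal $\nu$. The Wasserstein ball is $\mathcal{B}_\varepsilon(\hat{\mathbb{P}}_l)=\{\mu\in\mathcal{Q}(\mathcal{Z}):\mathcal{W}_c(\mu,\hat{\mathbb{P}}_l)\le\varepsilon\}$. The set $\mathcal{U}=\mathcal{U}(\mathbb{P}_{\mathcal{X}},\underline{p},\overline{p})$ consists of all $\mu\in\mathcal{M}_+(\mathcal{X}\times\mathcal{Y})$ such that $\mu(A\times\mathcal{Y})=\mathbb{P}_{\mathcal{X}}(A)$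 for all $A\in\mathrm{Borel}(\mathcal{X})$ and $$\sum_{k:\,y^k\in B}\underline{p}^k\ \le\ \mu(\mathcal{X}\times B)\ \le\ \sum_{k:\,y^k\in B}\overline{p}^k\quad\text{for all }B\subseteq\mathcal{Y}.$$ Meaning of $\operatorname{relint}$ here (strict feasibility): $\operatorname{relint}(\mathcal{U}\cap\mathcal{B}_\varepsilon(\hat{\mathbb{P}}_l))$ is the set of $\mu\in\mathcal{U}\cap\mathcal{B}_\varepsilon(\hat{\mathbb{P}}_l)$ for which there is a coupling $\pi\in\Pi(\mu,\hat{\mathbb{P}}_l)$ with $\int c\,d\pi<\varepsilon$, and such that $\underline{p}^k<\mu(\mathcal{X}\times\{y^k\})<\overline{p}^k$ for every $k$ with $\underline{p}^k<\overline{p}^k$.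
   Formalization: Attainment of the infimum is proved under an added assumption, without which it can fail: for each label with upper bound 0, its loss is, for almost every x, at most a constant plus the loss of some label with positive upper bound. It is vacuous if all upper bounds are positive. *)

theory Defs
  imports "HOL-Probability.Probability"
begin

definition lower_semicont :: "('a::topological_space \<Rightarrow> real) \<Rightarrow> bool" where
  "lower_semicont f \<longleftrightarrow> (\<forall>a. open {x. a < f x})"

definition upper_semicont :: "('a::topological_space \<Rightarrow> real) \<Rightarrow> bool" where
  "upper_semicont f \<longleftrightarrow> (\<forall>a. open {x. f x < a})"

definition prob_measures :: "('a::topological_space) measure set" where
  "prob_measures = space (prob_algebra borel)"

text \<open>Nonnegative Radon measures: locally finite Borel measures that are inner regular
  with respect to compact sets.\<close>

definition radon_measures :: "('a::topological_space) measure set" where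
  "radon_measures = {M. sets M = sets borel
     \<and> (\<forall>x. \<exists>U. open U \<and> x \<in> U \<and> emeasure M U < \<infinity>)
     \<and> (\<forall>A\<in>sets borel. emeasure M A = (SUP K\<in>{K. compact K \<and> K \<subseteq> A}. emeasure M K))}"

definition empirical :: "nat \<Rightarrow> (nat \<Rightarrow> 'a::topological_space) \<Rightarrow> 'a measure" where
  "empirical N z = measure_of UNIV (sets borel)
     (\<lambda>A. \<Sum>i=1..N. ennreal (1 / real N) * emeasure (return borel (z i)) A)"

text \<open>The set function handed to \<^const>\<open>measure_of\<close> is a measure, so no default value intervenes.\<close>

lemma emeasure_empirical:
  assumes "A \<in> sets borel"
  shows "emeasure (empirical N z) A =
    (\<Sum>i=1..N. ennreal (1 / real N) * emeasure (return borel (z i)) A)"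
proof -
  let ?f = "\<lambda>A. \<Sum>i=1..N. ennreal (1 / real N) * emeasure (return borel (z i)) A"
  have "countably_additive (sets borel) ?f"
  proof (rule countably_additiveI)
    fix F :: "nat \<Rightarrow> 'a set"
    assume F: "range F \<subseteq> sets borel" "disjoint_family F" "(\<Union>i. F i) \<in> sets borel"
    have "(\<Sum>n. ?f (F n)) =
        (\<Sum>i=1..N. \<Sum>n. ennreal (1 / real N) * emeasure (return borel (z i)) (F n))"
      by (rule suminf_sum) auto
    also have "\<dots> = ?f (\<Union>n. F n)"
      using F by (intro sum.cong refl) (simp add: ennreal_suminf_cmult suminf_emeasure del: emeasure_return)
    finally show "(\<Sum>n. ?f (F n)) = ?f (\<Union>n. F n)" .
  qed
  moreover have "sigma_algebra UNIV (sets (borel :: 'a measure))"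
    using sets.sigma_algebra_axioms[of "borel :: 'a measure"] by simp
  moreover have "positive (sets borel) ?f"
    by (simp add: positive_def)
  ultimately show ?thesis
    unfolding empirical_def using assms by (intro emeasure_measure_of_sigma) auto
qed

definition couplings ::
    "('a::topological_space) measure \<Rightarrow> 'a measure \<Rightarrow> ('a \<times> 'a) measure set" where
  "couplings \<mu> \<nu> = {\<pi> \<in> radon_measures. distr \<pi> borel fst = \<mu> \<and> distr \<pi> borel snd = \<nu>}"

definition transport_cost :: "('a \<times> 'a \<Rightarrow> real) \<Rightarrow> ('a \<times> 'a) measure \<Rightarrow> ennreal" where
  "transport_cost c \<pi> = (\<integral>\<^sup>+ w. ennreal (c w) \<partial>\<pi>)"

definition wasserstein ::
    "('a::topological_space \<times> 'a \<Rightarrow> real) \<Rightarrow> 'a measure \<Rightarrow> 'a measure \<Rightarrow> ennreal" where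
  "wasserstein c \<mu> \<nu> = (INF \<pi>\<in>couplings \<mu> \<nu>. transport_cost c \<pi>)"

definition wasserstein_ball ::
    "('a::topological_space \<times> 'a \<Rightarrow> real) \<Rightarrow> real \<Rightarrow> 'a measure \<Rightarrow> 'a measure set" where
  "wasserstein_ball c \<epsilon> \<nu> = {\<mu> \<in> prob_measures. wasserstein c \<mu> \<nu> \<le> ennreal \<epsilon>}"

text \<open>The labels are \<open>y 1, \<dots>, y NY\<close>; sequences indexed by labels or samples are functions on
  \<^typ>\<open>nat\<close>, of which only the values at \<open>1, \<dots>, NY\<close> (respectively \<open>1, \<dots>, Nl\<close>) are used.\<close>

definition marginal_set ::
    "'x measure \<Rightarrow> nat \<Rightarrow> (nat \<Rightarrow> 'y) \<Rightarrow> (nat \<Rightarrow> real) \<Rightarrow> (nat \<Rightarrow> real)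
     \<Rightarrow> ('x::topological_space \<times> 'y::topological_space) measure set" where
  "marginal_set P NY y plo phi = {\<mu> \<in> radon_measures.
     (\<forall>A\<in>sets borel. emeasure \<mu> (A \<times> UNIV) = emeasure P A) \<and>
     (\<forall>B. ennreal (\<Sum>k\<in>{k\<in>{1..NY}. y k \<in> B}. plo k) \<le> emeasure \<mu> (UNIV \<times> B) \<and>
          emeasure \<mu> (UNIV \<times> B) \<le> ennreal (\<Sum>k\<in>{k\<in>{1..NY}. y k \<in> B}. phi k))}"

definition ambiguity_set ::
    "'x measure \<Rightarrow> nat \<Rightarrow> (nat \<Rightarrow> 'y) \<Rightarrow> (nat \<Rightarrow> real) \<Rightarrow> (nat \<Rightarrow> real)
     \<Rightarrow> (('x \<times> 'y) \<times> ('x \<times> 'y) \<Rightarrow> real) \<Rightarrow> real \<Rightarrow> ('x \<times> 'y) measure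
     \<Rightarrow> ('x::topological_space \<times> 'y::topological_space) measure set" where
  "ambiguity_set P NY y plo phi c \<epsilon> \<nu> =
     marginal_set P NY y plo phi \<inter> wasserstein_ball c \<epsilon> \<nu>"

definition ambiguity_relint ::
    "'x measure \<Rightarrow> nat \<Rightarrow> (nat \<Rightarrow> 'y) \<Rightarrow> (nat \<Rightarrow> real) \<Rightarrow> (nat \<Rightarrow> real)
     \<Rightarrow> (('x \<times> 'y) \<times> ('x \<times> 'y) \<Rightarrow> real) \<Rightarrow> real \<Rightarrow> ('x \<times> 'y) measure
     \<Rightarrow> ('x::topological_space \<times> 'y::topological_space) measure set" where
  "ambiguity_relint P NY y plo phi c \<epsilon> \<nu> = {\<mu> \<in> ambiguity_set P NY y plo phi c \<epsilon> \<nu>.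
     (\<exists>\<pi>\<in>couplings \<mu> \<nu>. transport_cost c \<pi> < ennreal \<epsilon>) \<and>
     (\<forall>k\<in>{1..NY}. plo k < phi k \<longrightarrow>
        ennreal (plo k) < emeasure \<mu> (UNIV \<times> {y k}) \<and>
        emeasure \<mu> (UNIV \<times> {y k}) < ennreal (phi k))}"

text \<open>The integrands below are bounded above but need not be bounded below, so their integrals
  take values in \<open>[-\<infinity>, \<infinity>)\<close>; the Bochner integral would return \<open>0\<close> instead of \<open>-\<infinity>\<close>.
  Since the integral of the positive part is finite, \<open>\<infinity> - \<infinity>\<close> does not occur.\<close>

definition ext_integral :: "'a measure \<Rightarrow> ('a \<Rightarrow> real) \<Rightarrow> ereal" where
  "ext_integral M f =
     enn2ereal (\<integral>\<^sup>+ x. ennreal (f x) \<partial>M) - enn2ereal (\<integral>\<^sup>+ x. ennreal (- f x) \<partial>M)"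

text \<open>\<open>L (x, y)\<close> stands for the loss of a fixed hypothesis at \<open>(x, y)\<close>.\<close>

definition primal_value :: "'z measure set \<Rightarrow> ('z \<Rightarrow> real) \<Rightarrow> ereal" where
  "primal_value S L = (SUP \<mu>\<in>S. ext_integral \<mu> L)"

type_synonym multipliers = "real \<times> (nat \<Rightarrow> real) \<times> (nat \<Rightarrow> real) \<times> (nat \<Rightarrow> real)"

text \<open>The components are \<open>\<alpha>\<close>, \<open>\<beta>\<close>, and the multipliers of the upper and lower label bounds.\<close>

definition dual_feasible :: "nat \<Rightarrow> multipliers set" where
  "dual_feasible NY = {(\<alpha>, \<beta>, lhi, llo). 0 \<le> \<alpha> \<and> (\<forall>k\<in>{1..NY}. 0 \<le> lhi k \<and> 0 \<le> llo k)}"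

definition dual_objective ::
    "'x measure \<Rightarrow> nat \<Rightarrow> (nat \<Rightarrow> 'y) \<Rightarrow> (nat \<Rightarrow> real) \<Rightarrow> (nat \<Rightarrow> real)
     \<Rightarrow> (('x \<times> 'y) \<times> ('x \<times> 'y) \<Rightarrow> real) \<Rightarrow> real \<Rightarrow> nat \<Rightarrow> (nat \<Rightarrow> 'x \<times> 'y)
     \<Rightarrow> ('x \<times> 'y \<Rightarrow> real) \<Rightarrow> multipliers \<Rightarrow> ereal" where
  "dual_objective P NY y plo phi c \<epsilon> Nl z L = (\<lambda>(\<alpha>, \<beta>, lhi, llo).
     ereal (\<alpha> * \<epsilon> + (1 / real Nl) * (\<Sum>i=1..Nl. \<beta> i)
            + (\<Sum>k=1..NY. lhi k * phi k - llo k * plo k))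
     + ext_integral P (\<lambda>x. Max ((\<lambda>(k, i).
         L (x, y k) - (\<alpha> * c ((x, y k), z i) + \<beta> i) - (lhi k - llo k)) ` ({1..NY} \<times> {1..Nl}))))"

definition dual_value ::
    "'x measure \<Rightarrow> nat \<Rightarrow> (nat \<Rightarrow> 'y) \<Rightarrow> (nat \<Rightarrow> real) \<Rightarrow> (nat \<Rightarrow> real)
     \<Rightarrow> (('x \<times> 'y) \<times> ('x \<times> 'y) \<Rightarrow> real) \<Rightarrow> real \<Rightarrow> nat \<Rightarrow> (nat \<Rightarrow> 'x \<times> 'y)
     \<Rightarrow> ('x \<times> 'y \<Rightarrow> real) \<Rightarrow> ereal" where
  "dual_value P NY y plo phi c \<epsilon> Nl z L =
     (INF m\<in>dual_feasible NY. dual_objective P NY y plo phi c \<epsilon> Nl z L m)"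

end

(*
A coupling of mu with the empirical measure disintegrates over P into measurable weights w(k,i)(x)
on the finite set of pairs (label k, sample i). Both problems become linear in these weights, with
finitely many constraints, and the pointwise maximum in the dual is the supremum over all weights.

Duality needs a compactness property of the convex set of weights. Elements of almost minimal L2 norm
in a decreasing sequence of nonempty convex sets are Cauchy by the parallelogram law, so a subsequence
converges almost everywhere. Hence a convex function of the constraint violations attains its minimum,
and the violations at the minimiser are the multipliers (a Farkas lemma). The same property removes the
truncation of the loss from below.

For attainment, mixing a strictly feasible weight with the product of its marginals makes all relevant
weights bounded below. This bounds the recession function of the dual objective from below on normalised
multipliers. Subtracting the largest loss, the dual objective differs from the recession function by a
constant and a small multiple of the norm, so it is coercive.
*)
theory Submission
  imports Defs
begin

section \<open>Weights on finitely many alternatives\<close>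

text \<open>The obstacle to duality is that multipliers must be produced without a minimax theorem.
  Weights are uniformly bounded, so suitable minimising sequences converge almost everywhere and
  dominated convergence carries every bounded constraint to the limit. The loss escapes this because
  it is only bounded above; it is truncated, and Fatou's lemma then works in the one direction that
  is required.

  The obstacle to attainment is degeneracy. The dual objective is constant along some directions: a
  common shift of all \<open>\<beta>\<close>, a common shift of the label multipliers when every
  label bound is tight, a joint increase of both multipliers of a tight label. Minimising sequences
  may escape along them, so multipliers are normalised before coercivity is claimed. Labels with
  upper bound 0 are worse: their multipliers cost nothing and the infimum may drive them to
  infinity. They are dropped from the maximum and restored at the end with a finite multiplier, for
  which a domination condition between the losses is assumed.\<close>

definition weights :: "'a measure \<Rightarrow> 'j set \<Rightarrow> ('j \<Rightarrow> 'a \<Rightarrow> real) set" where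
  "weights M J = {w. (\<forall>j\<in>J. w j \<in> borel_measurable M) \<and>
     (AE x in M. (\<forall>j\<in>J. 0 \<le> w j x) \<and> (\<Sum>j\<in>J. w j x) = 1)}"

definition avg :: "'a measure \<Rightarrow> 'j set \<Rightarrow> ('j \<Rightarrow> 'a \<Rightarrow> real) \<Rightarrow> ('j \<Rightarrow> 'a \<Rightarrow> real) \<Rightarrow> real" where
  "avg M J w a = (\<integral>x. (\<Sum>j\<in>J. w j x * a j x) \<partial>M)"

definition bounded_family :: "'a measure \<Rightarrow> 'j set \<Rightarrow> ('j \<Rightarrow> 'a \<Rightarrow> real) \<Rightarrow> bool" where
  "bounded_family M J a \<longleftrightarrow> (\<forall>j\<in>J. a j \<in> borel_measurable M) \<and>
     (\<exists>C. \<forall>j\<in>J. \<forall>x\<in>space M. \<bar>a j x\<bar> \<le> C)"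

definition mix :: "real \<Rightarrow> ('j \<Rightarrow> 'a \<Rightarrow> real) \<Rightarrow> ('j \<Rightarrow> 'a \<Rightarrow> real) \<Rightarrow> 'j \<Rightarrow> 'a \<Rightarrow> real" where
  "mix t u v = (\<lambda>j x. (1 - t) * u j x + t * v j x)"

lemma weights_measurable:
  "w \<in> weights M J \<Longrightarrow> j \<in> J \<Longrightarrow> w j \<in> borel_measurable M"
  by (auto simp: weights_def)

lemma weights_AE:
  assumes "w \<in> weights M J" "finite J"
  shows "AE x in M. (\<forall>j\<in>J. 0 \<le> w j x \<and> w j x \<le> 1) \<and> (\<Sum>j\<in>J. w j x) = 1"
proof -
  have "AE x in M. (\<forall>j\<in>J. 0 \<le> w j x) \<and> (\<Sum>j\<in>J. w j x) = 1"
    using assms by (auto simp: weights_def)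
  then show ?thesis
  proof eventually_elim
    case (elim x)
    then have "w j x \<le> 1" if "j \<in> J" for j
      using member_le_sum[of j J "\<lambda>j. w j x"] that assms(2) by auto
    with elim show ?case by auto
  qed
qed

lemma weights_AE1:
  assumes "w \<in> weights M J" "finite J" "j \<in> J"
  shows "AE x in M. 0 \<le> w j x \<and> w j x \<le> 1"
  using weights_AE[OF assms(1,2)] by eventually_elim (use assms(3) in auto)

lemma mix_in_weights:
  assumes "u \<in> weights M J" "v \<in> weights M J" "0 \<le> t" "t \<le> 1"
  shows "mix t u v \<in> weights M J"
proof -
  have *: "AE x in M. (\<forall>j\<in>J. 0 \<le> u j x) \<and> (\<Sum>j\<in>J. u j x) = 1"
    "AE x in M. (\<forall>j\<in>J. 0 \<le> v j x) \<and> (\<Sum>j\<in>J. v j x) = 1"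
    using assms by (auto simp: weights_def)
  have "AE x in M. (\<forall>j\<in>J. 0 \<le> mix t u v j x) \<and> (\<Sum>j\<in>J. mix t u v j x) = 1"
    using * by eventually_elim
      (use assms in \<open>auto simp: mix_def sum.distrib sum_distrib_left[symmetric]\<close>)
  moreover have "mix t u v j \<in> borel_measurable M" if "j \<in> J" for j
    using weights_measurable[OF assms(1) that] weights_measurable[OF assms(2) that]
    by (simp add: mix_def)
  ultimately show ?thesis by (auto simp: weights_def)
qed

lemma bounded_familyE:
  assumes "bounded_family M J a"
  obtains C where "0 \<le> C" "\<And>j x. j \<in> J \<Longrightarrow> x \<in> space M \<Longrightarrow> \<bar>a j x\<bar> \<le> C"
proof -
  obtain C where "\<forall>j\<in>J. \<forall>x\<in>space M. \<bar>a j x\<bar> \<le> C"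
    using assms by (auto simp: bounded_family_def)
  then have "\<bar>a j x\<bar> \<le> max C 0" if "j \<in> J" "x \<in> space M" for j x using that by fastforce
  then show ?thesis using that[of "max C 0"] by auto
qed

lemma bounded_family_measurable:
  "bounded_family M J a \<Longrightarrow> j \<in> J \<Longrightarrow> a j \<in> borel_measurable M"
  by (auto simp: bounded_family_def)

text \<open>Each index extracts a further subsequence, and a Cauchy sequence stays Cauchy along it,
  so finitely many extractions leave one subsequence that serves every index.\<close>

lemma Cauchy_AE_subseq_finite:
  fixes s :: "nat \<Rightarrow> 'j \<Rightarrow> 'a \<Rightarrow> real"
  assumes "finite J"
    and "\<And>n j. j \<in> J \<Longrightarrow> integrable M (s n j)"
    and "\<And>j e. j \<in> J \<Longrightarrow> e > 0 \<Longrightarrow>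
           \<exists>N. \<forall>m\<ge>N. \<forall>n\<ge>N. (LINT x|M. norm (s m j x - s n j x)) < e"
  shows "\<exists>r :: nat \<Rightarrow> nat. strict_mono r \<and> (\<forall>j\<in>J. AE x in M. Cauchy (\<lambda>i. s (r i) j x))"
  using assms
proof (induction J rule: finite_induct)
  case empty
  then show ?case by (auto intro!: exI[of _ id] simp: strict_mono_def)
next
  case (insert j J)
  obtain r where r: "strict_mono r" "\<forall>j\<in>J. AE x in M. Cauchy (\<lambda>i. s (r i) j x)"
    using insert by auto
  have "\<exists>N. \<forall>m\<ge>N. \<forall>n\<ge>N. (LINT x|M. norm (s (r m) j x - s (r n) j x)) < e"
    if e: "e > 0" for e
  proof -
    obtain N where "\<forall>m\<ge>N. \<forall>n\<ge>N. (LINT x|M. norm (s m j x - s n j x)) < e"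
      using insert.prems(2)[OF insertI1 e] by blast
    then show ?thesis using seq_suble[OF r(1)] le_trans by blast
  qed
  then obtain r' where r': "strict_mono r'" "AE x in M. Cauchy (\<lambda>i. s (r (r' i)) j x)"
    using cauchy_L1_AE_cauchy_subseq[of M "\<lambda>n. s (r n) j"] insert.prems(1) by blast
  have "AE x in M. Cauchy (\<lambda>i. s (r (r' i)) k x)" if "k \<in> J" for k
    using r(2)[rule_format, OF that]
    by eventually_elim (use Cauchy_subseq_Cauchy[OF _ r'(1)] in \<open>force simp: o_def\<close>)
  then show ?case using r'(2)
    by (intro exI[of _ "r \<circ> r'"] conjI strict_mono_o[OF r(1) r'(1)]) (simp only: o_apply, blast)
qed

context prob_space
begin

lemma integrable_weighted:
  assumes "finite J" "w \<in> weights M J" "bounded_family M J a" "j \<in> J"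
  shows "integrable M (\<lambda>x. w j x * a j x)"
proof -
  obtain C where C: "0 \<le> C" "\<And>j x. j \<in> J \<Longrightarrow> x \<in> space M \<Longrightarrow> \<bar>a j x\<bar> \<le> C"
    using bounded_familyE[OF assms(3)] by blast
  have "AE x in M. norm (w j x * a j x) \<le> C"
    using weights_AE1[OF assms(2,1,4)] AE_space
  proof eventually_elim
    case (elim x)
    then show ?case using C(2)[OF assms(4), of x] mult_mono[of "\<bar>w j x\<bar>" 1 "\<bar>a j x\<bar>" C] 
      by (auto simp: abs_mult)
  qed
  moreover have "(\<lambda>x. w j x * a j x) \<in> borel_measurable M"
    using weights_measurable[OF assms(2,4)] bounded_family_measurable[OF assms(3,4)] by simp
  ultimately show ?thesis by (rule integrable_const_bound)
qed

lemma avg_sum: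
  assumes "finite J" "w \<in> weights M J" "bounded_family M J a"
  shows "avg M J w a = (\<Sum>j\<in>J. \<integral>x. w j x * a j x \<partial>M)"
  unfolding avg_def using integrable_weighted[OF assms] by (intro Bochner_Integration.integral_sum) auto

lemma avg_mix:
  assumes "finite J" "u \<in> weights M J" "v \<in> weights M J" "bounded_family M J a"
    "0 \<le> t" "t \<le> 1"
  shows "avg M J (mix t u v) a = (1 - t) * avg M J u a + t * avg M J v a"
proof -
  have "(\<integral>x. mix t u v j x * a j x \<partial>M) =
     (1 - t) * (\<integral>x. u j x * a j x \<partial>M) + t * (\<integral>x. v j x * a j x \<partial>M)" if "j \<in> J" for j
    unfolding mix_def
    using integrable_weighted[OF assms(1,2,4) that] integrable_weighted[OF assms(1,3,4) that]
    by (simp add: distrib_right mult.assoc)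
  then show ?thesis using assms mix_in_weights[OF assms(2,3,5,6)]
    by (simp add: avg_sum sum.distrib sum_distrib_left)
qed

text \<open>Weights of almost minimal \<open>L\<^sup>2\<close> norm in the sets \<open>K n\<close> form a Cauchy sequence by the
  parallelogram law. This replaces weak compactness.\<close>

lemma weights_nested:
  assumes J: "finite J"
    and ne: "\<And>n. K n \<noteq> {}" and sub: "\<And>n. K n \<subseteq> weights M J"
    and dec: "decseq K"
    and mid: "\<And>n u v. u \<in> K n \<Longrightarrow> v \<in> K n \<Longrightarrow> mix (1/2) u v \<in> K n"
  obtains u w where "\<And>n. u n \<in> K n" "w \<in> weights M J"
    "AE x in M. \<forall>j\<in>J. (\<lambda>n. u n j x) \<longlonglongrightarrow> w j x"
proof -
  \<comment> \<open>The squared L2 norm, finite because weights lie between 0 and 1 almost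
    everywhere.\<close>
  define Q where "Q w = (\<Sum>j\<in>J. \<integral>x. (w j x)\<^sup>2 \<partial>M)" for w :: "'b \<Rightarrow> 'a \<Rightarrow> real"
  have int2: "integrable M (\<lambda>x. w j x * v j x)"
    if "w \<in> weights M J" "v \<in> weights M J" "j \<in> J" for w v j
  proof (rule integrable_const_bound[where B=1])
    show "AE x in M. norm (w j x * v j x) \<le> 1"
      using weights_AE1[OF that(1) J that(3)] weights_AE1[OF that(2) J that(3)]
      by eventually_elim (auto intro: mult_le_one)
    show "(\<lambda>x. w j x * v j x) \<in> borel_measurable M"
      using weights_measurable that by (metis borel_measurable_times)
  qed
  have int1: "integrable M (w j)" if "w \<in> weights M J" "j \<in> J" for w j
  proof (rule integrable_const_bound[where B=1])
    show "AE x in M. norm (w j x) \<le> 1"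
      using weights_AE1[OF that(1) J that(2)] by eventually_elim auto
  qed (use weights_measurable that in metis)
  have Q0: "0 \<le> Q w" for w
    by (auto simp: Q_def intro!: sum_nonneg integral_nonneg_AE)
  have Q1: "Q w \<le> card J" if "w \<in> weights M J" for w
  proof -
    have "(\<integral>x. (w j x)\<^sup>2 \<partial>M) \<le> 1" if "j \<in> J" for j
    proof -
      have "(\<integral>x. w j x * w j x \<partial>M) \<le> (\<integral>x. 1 \<partial>M)"
      proof (rule integral_mono_AE)
        show "AE x in M. w j x * w j x \<le> 1"
          using weights_AE1[OF \<open>w \<in> _\<close> J \<open>j \<in> J\<close>]
          by eventually_elim (auto intro: mult_le_one)
      qed (use int2 \<open>w \<in> _\<close> \<open>j \<in> J\<close> in auto)
      then show ?thesis by (simp add: power2_eq_square prob_space)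
    qed
    then have "Q w \<le> (\<Sum>j\<in>J. 1)" unfolding Q_def by (intro sum_mono)
    then show ?thesis by simp
  qed
  define d where "d n = Inf (Q ` K n)" for n
  have bdd: "bdd_below (Q ` K n)" for n using Q0 by (auto intro!: bdd_belowI[of _ 0])
  have dle: "d n \<le> Q w" if "w \<in> K n" for n w
    unfolding d_def using that bdd by (auto intro!: cInf_lower)
  \<comment> \<open>Shrinking sets have growing infima, bounded by \<open>card J\<close>, so
    \<open>d\<close> converges and the gaps \<open>\<bar>d m - d n\<bar>\<close> in the distance
    bound below vanish.\<close>
  have "incseq d"
    unfolding incseq_def d_def
    by (intro allI impI cInf_superset_mono image_mono decseqD[OF dec] bdd) (simp_all add: ne)
  moreover have "d n \<le> card J" for n
    using ne[of n] dle[of _ n] Q1 sub[of n] by (meson all_not_in_conv order_trans subsetD)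
  ultimately have "convergent d"
    by (metis convergent_def incseq_convergent)
  then have dC: "Cauchy d" by (simp add: Cauchy_convergent_iff)
  have "\<exists>w. w \<in> K n \<and> Q w < d n + 1 / Suc n" for n
  proof -
    have "d n < d n + 1 / Suc n" by simp
    then show ?thesis using ne[of n] cInf_lessD[of "Q ` K n"] unfolding d_def by blast
  qed
  then obtain v where vK: "\<And>n. v n \<in> K n" and vQ: "\<And>n. Q (v n) < d n + 1 / Suc n" by metis
  have vW: "v n \<in> weights M J" for n using vK sub by blast
  define E where "E m n j = (\<integral>x. (v m j x - v n j x)\<^sup>2 \<partial>M)" for m n j
  have intE: "integrable M (\<lambda>x. (v m j x - v n j x)\<^sup>2)" if "j \<in> J" for m n j
  proof -
    have "integrable M (\<lambda>x. v m j x * v m j x + v n j x * v n j x - 2 * (v m j x * v n j x))"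
      using int2[OF vW vW that] by auto
    then show ?thesis by (simp add: power2_eq_square algebra_simps)
  qed
  \<comment> \<open>Parallelogram law, with the sum of two weights written as twice their
    midpoint.\<close>
  have par: "(\<Sum>j\<in>J. E m n j) = 2 * Q (v m) + 2 * Q (v n) - 4 * Q (mix (1/2) (v m) (v n))" for m n
  proof -
    have "E m n j = 2 * (\<integral>x. (v m j x)\<^sup>2 \<partial>M) + 2 * (\<integral>x. (v n j x)\<^sup>2 \<partial>M)
        - 4 * (\<integral>x. (mix (1/2) (v m) (v n) j x)\<^sup>2 \<partial>M)" if "j \<in> J" for j
    proof -
      have mW: "mix (1/2) (v m) (v n) \<in> weights M J"
        by (intro mix_in_weights vW) auto
      have "E m n j = (\<integral>x. 2 * (v m j x * v m j x) + 2 * (v n j x * v n j x)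
        - 4 * (mix (1/2) (v m) (v n) j x * mix (1/2) (v m) (v n) j x) \<partial>M)"
        unfolding E_def mix_def
        by (intro Bochner_Integration.integral_cong) (auto simp: power2_eq_square field_simps)
      also have "\<dots> = 2 * (\<integral>x. v m j x * v m j x \<partial>M) + 2 * (\<integral>x. v n j x * v n j x \<partial>M)
        - 4 * (\<integral>x. mix (1/2) (v m) (v n) j x * mix (1/2) (v m) (v n) j x \<partial>M)"
        using int2[OF vW vW that] int2[OF mW mW that] by simp
      finally show ?thesis by (simp add: power2_eq_square)
    qed
    then show ?thesis by (simp add: Q_def sum.distrib sum_subtractf sum_distrib_left)
  qed
  have Eb: "E m n j \<le> 2 * \<bar>d m - d n\<bar> + 2 / Suc n + 2 / Suc m" if "j \<in> J" for m n j
  proof -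
    have *: "E m n j \<le> 2 * \<bar>d m - d n\<bar> + 2 / Suc n + 2 / Suc m" if "j \<in> J" "n \<le> m" for m n j
    proof -
      have Es: "E m n j \<le> (\<Sum>j\<in>J. E m n j)"
        using J that by (intro member_le_sum) (auto simp: E_def intro!: integral_nonneg_AE)
      \<comment> \<open>Both weights lie in the larger set \<open>K n\<close>, hence so does their
        midpoint, whose norm is therefore at least \<open>d n\<close>. Near-minimality of
        \<open>v m\<close> and \<open>v n\<close> then forces them together.\<close>
      have "mix (1/2) (v m) (v n) \<in> K n"
        using mid vK decseqD[OF dec that(2)] by blast
      then have Qm: "d n \<le> Q (mix (1/2) (v m) (v n))" by (rule dle)
      obtain p q where pq: "p = 1 / real (Suc m)" "q = 1 / real (Suc n)" by simp
      have Qb: "Q (v m) < d m + p" "Q (v n) < d n + q"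
        using vQ by (simp_all add: pq)
      have "E m n j \<le> 2 * \<bar>d m - d n\<bar> + 2 * q + 2 * p"
      proof -
        have lin: "e \<le> 2 * a + 2 * q + 2 * p"
          if "e \<le> s" "s = 2 * x + 2 * y - 4 * z" "d' \<le> z" "x < d'' + p" "y < d' + q" "d'' - d' \<le> a"
          for e s x y z d' d'' a :: real
          using that by linarith
        show ?thesis
          by (rule lin[OF Es par Qm Qb abs_ge_self])
      qed
      then show ?thesis by (simp add: pq)
    qed
    have "E m n j = E n m j" by (simp add: E_def power2_commute)
    then show ?thesis using *[of j n m] *[of j m n] that by (cases "n \<le> m") (auto simp: abs_minus_commute)
  qed
  have "\<exists>N. \<forall>m\<ge>N. \<forall>n\<ge>N. (LINT x|M. norm (v m j x - v n j x)) < e" if "j \<in> J" "e > 0" for j e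
  proof -
    have e2: "0 < e\<^sup>2 / 6" using that by simp
    obtain N1 where N1: "\<And>m n. m \<ge> N1 \<Longrightarrow> n \<ge> N1 \<Longrightarrow> \<bar>d m - d n\<bar> < e\<^sup>2 / 6"
      using CauchyD[OF dC e2] by auto
    obtain N2 where N2: "1 / real (Suc N2) < e\<^sup>2 / 6"
      using e2 nat_approx_posE by blast
    have "(LINT x|M. norm (v m j x - v n j x)) < e"
      if mn: "m \<ge> max N1 N2" "n \<ge> max N1 N2" for m n
    proof -
      have "1 / real (Suc m) \<le> 1 / real (Suc N2)" "1 / real (Suc n) \<le> 1 / real (Suc N2)"
        using mn by (auto intro!: divide_left_mono)
      then have E: "E m n j < e\<^sup>2"
        using Eb[OF \<open>j \<in> J\<close>, of m n] N1[of m n] N2 mn by simp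
      \<comment> \<open>The inequality
        \<open>\<bar>t\<bar> \<le> e / 2 + t\<^sup>2 / (2 * e)\<close> takes the place of
        Cauchy-Schwarz: it turns the L2 bound \<open>E m n j < e\<^sup>2\<close> into the L1 bound
        \<open>e\<close>.\<close>
      have "(LINT x|M. norm (v m j x - v n j x)) \<le> (LINT x|M. e / 2 + (v m j x - v n j x)\<^sup>2 / (2 * e))"
      proof (rule integral_mono)
        fix x
        define t where "t = v m j x - v n j x"
        have "(\<bar>t\<bar> - e)\<^sup>2 = e\<^sup>2 + t\<^sup>2 - \<bar>t\<bar> * (2 * e)" by (simp add: power2_diff)
        then have "\<bar>t\<bar> * (2 * e) \<le> e\<^sup>2 + t\<^sup>2"
          using zero_le_power2[of "\<bar>t\<bar> - e"] by linarith
        then have "\<bar>t\<bar> \<le> (e\<^sup>2 + t\<^sup>2) / (2 * e)"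
          using \<open>e > 0\<close> by (subst pos_le_divide_eq) simp_all
        also have "\<dots> = e / 2 + t\<^sup>2 / (2 * e)"
          using \<open>e > 0\<close> by (simp add: add_divide_distrib power2_eq_square)
        finally show "norm (v m j x - v n j x) \<le> e / 2 + (v m j x - v n j x)\<^sup>2 / (2 * e)"
          unfolding t_def real_norm_def .
      qed (use intE int1 vW \<open>j \<in> J\<close> in auto)
      also have "\<dots> = e / 2 + E m n j / (2 * e)"
        using intE[OF \<open>j \<in> J\<close>, of m n] by (simp add: E_def prob_space)
      also have "\<dots> < e / 2 + e\<^sup>2 / (2 * e)"
        using E \<open>e > 0\<close> by (simp add: divide_strict_right_mono)
      also have "\<dots> = e" using \<open>e > 0\<close> by (simp add: power2_eq_square)
      finally show ?thesis .
    qed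
    then show ?thesis by blast
  qed
  then obtain r where r: "strict_mono r" "\<forall>j\<in>J. AE x in M. Cauchy (\<lambda>i. v (r i) j x)"
    using Cauchy_AE_subseq_finite[OF J, of M v] int1 vW by blast
  \<comment> \<open>Where the sequence fails to converge, \<open>lim\<close> is unspecified; this
    happens only on a null set.\<close>
  define w where "w j x = lim (\<lambda>i. v (r i) j x)" for j x
  have lim: "AE x in M. \<forall>j\<in>J. (\<lambda>n. v (r n) j x) \<longlonglongrightarrow> w j x"
    using r(2) J by (subst AE_finite_all) (auto simp: w_def Cauchy_convergent_iff convergent_LIMSEQ_iff)
  have all: "AE x in M. \<forall>n. (\<forall>j\<in>J. 0 \<le> v (r n) j x) \<and> (\<Sum>j\<in>J. v (r n) j x) = 1"
    using vW unfolding AE_all_countable by (auto simp: weights_def)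
  have "AE x in M. (\<forall>j\<in>J. 0 \<le> w j x) \<and> (\<Sum>j\<in>J. w j x) = 1"
    using lim all
  proof eventually_elim
    case (elim x)
    have "(\<lambda>n. \<Sum>j\<in>J. v (r n) j x) \<longlonglongrightarrow> (\<Sum>j\<in>J. w j x)"
      using elim(1) by (intro tendsto_sum) auto
    then have "(\<lambda>n::nat. 1) \<longlonglongrightarrow> (\<Sum>j\<in>J. w j x)" using elim(2) by simp
    then have "(\<Sum>j\<in>J. w j x) = 1" using LIMSEQ_unique[OF _ tendsto_const] by blast
    moreover have "0 \<le> w j x" if "j \<in> J" for j
      using elim that by (intro LIMSEQ_le_const[of "\<lambda>n. v (r n) j x"]) auto
    ultimately show ?case by auto
  qed
  moreover have "w j \<in> borel_measurable M" if "j \<in> J" for j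
    unfolding w_def using weights_measurable[OF vW that] by (intro borel_measurable_lim_metric) auto
  ultimately have "w \<in> weights M J" by (auto simp: weights_def)
  moreover have "v (r n) \<in> K n" for n using vK decseqD[OF dec seq_suble[OF r(1), of n]] by blast
  ultimately show ?thesis using that[of "\<lambda>n. v (r n)" w] lim by blast
qed

text \<open>Dominated convergence, with the bound of the family as majorant. It makes constraints
  and bounded objectives closed under the limits supplied by \<open>weights_nested\<close>.\<close>

lemma avg_tendsto:
  assumes J: "finite J" and u: "\<And>n. u n \<in> weights M J" and w: "w \<in> weights M J"
    and lim: "AE x in M. \<forall>j\<in>J. (\<lambda>n. u n j x) \<longlonglongrightarrow> w j x" and a: "bounded_family M J a"
  shows "(\<lambda>n. avg M J (u n) a) \<longlonglongrightarrow> avg M J w a"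
proof -
  obtain C where C: "0 \<le> C" "\<And>j x. j \<in> J \<Longrightarrow> x \<in> space M \<Longrightarrow> \<bar>a j x\<bar> \<le> C"
    using bounded_familyE[OF a] by blast
  have "(\<lambda>n. \<integral>x. u n j x * a j x \<partial>M) \<longlonglongrightarrow> (\<integral>x. w j x * a j x \<partial>M)" if j: "j \<in> J" for j
  proof (rule integral_dominated_convergence[where w="\<lambda>_. C"])
    show "(\<lambda>x. w j x * a j x) \<in> borel_measurable M" "\<And>n. (\<lambda>x. u n j x * a j x) \<in> borel_measurable M"
      using weights_measurable[OF w j] weights_measurable[OF u j]
        bounded_family_measurable[OF a j] by auto
    show "AE x in M. (\<lambda>n. u n j x * a j x) \<longlonglongrightarrow> w j x * a j x"
      using lim by eventually_elim (use j in \<open>auto intro!: tendsto_intros\<close>)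
    show "AE x in M. norm (u n j x * a j x) \<le> C" for n
      using weights_AE1[OF u[of n] J j] AE_space
    proof eventually_elim
      case (elim x)
      then show ?case using C(2)[OF j, of x] mult_mono[of "\<bar>u n j x\<bar>" 1 "\<bar>a j x\<bar>" C] 
        by (auto simp: abs_mult)
    qed
  qed simp
  then show ?thesis using avg_sum[OF J u a] avg_sum[OF J w a] by (auto intro!: tendsto_sum)
qed

end

section \<open>Separation and duality for weights\<close>

lemma weights_AE_le:
  assumes "w \<in> weights M J" "finite J" "\<And>j x. j \<in> J \<Longrightarrow> a j x \<le> C"
  shows "AE x in M. (\<Sum>j\<in>J. w j x * a j x) \<le> C"
  using weights_AE[OF assms(1,2)]
proof eventually_elim
  case (elim x)
  have "(\<Sum>j\<in>J. w j x * a j x) \<le> (\<Sum>j\<in>J. w j x * C)"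
    using elim assms(3) by (intro sum_mono mult_left_mono) auto
  also have "\<dots> = C" unfolding sum_distrib_right[symmetric] using elim by simp
  finally show ?case .
qed

lemma weights_nonempty:
  assumes "finite J" "J \<noteq> {}"
  shows "weights M J \<noteq> {}"
proof -
  obtain j0 where "j0 \<in> J" using assms by blast
  then have "(\<lambda>j x. if j = j0 then 1 else 0) \<in> weights M J"
    using assms by (auto simp: weights_def)
  then show ?thesis by blast
qed

context prob_space
begin

text \<open>\<open>\<Phi>\<close> is the squared distance of the vector of averages from the
  feasible orthant. Because its minimum is attained, infeasibility makes that minimum positive. The
  first order condition at the minimiser says that the vector of positive parts, half the gradient,
  separates all weights with this minimum as margin.\<close>

lemma weights_Farkas:
  fixes A :: "'r \<Rightarrow> 'j \<Rightarrow> 'a \<Rightarrow> real"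
  assumes J: "finite J" "J \<noteq> {}" and I: "finite I"
    and A: "\<And>r. r \<in> I \<Longrightarrow> bounded_family M J (A r)"
    and infeasible: "\<not> (\<exists>w\<in>weights M J. \<forall>r\<in>I. avg M J w (A r) \<le> b r)"
  obtains m \<delta> where "\<delta> > 0" "\<And>r. r \<in> I \<Longrightarrow> 0 \<le> m r"
    "\<And>w. w \<in> weights M J \<Longrightarrow> \<delta> \<le> (\<Sum>r\<in>I. m r * (avg M J w (A r) - b r))"
proof -
  define p where "p t = max 0 t" for t :: real
  define F where "F r w = avg M J w (A r) - b r" for r w
  define \<Phi> where "\<Phi> w = (\<Sum>r\<in>I. (p (F r w))\<^sup>2)" for w
  define \<phi> where "\<phi> = Inf (\<Phi> ` weights M J)"
  have \<Phi>0: "0 \<le> \<Phi> w" for w unfolding \<Phi>_def by (intro sum_nonneg) auto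
  have bdd: "bdd_below (\<Phi> ` weights M J)" using \<Phi>0 by (auto intro!: bdd_belowI[of _ 0])
  have \<phi>le: "\<phi> \<le> \<Phi> w" if "w \<in> weights M J" for w
    unfolding \<phi>_def using that bdd by (auto intro!: cInf_lower)
  have Fmix: "F r (mix t u v) = (1 - t) * F r u + t * F r v"
    if "r \<in> I" "u \<in> weights M J" "v \<in> weights M J" "0 \<le> t" "t \<le> 1" for r t u v
    unfolding F_def using avg_mix[OF J(1) that(2,3) A[OF that(1)] that(4,5)] by (simp add: algebra_simps)
  define K where "K n = {w \<in> weights M J. \<Phi> w \<le> \<phi> + 1 / Suc n}" for n :: nat
  obtain u w where u: "\<And>n. u n \<in> K n" and w: "w \<in> weights M J"
    and lim: "AE x in M. \<forall>j\<in>J. (\<lambda>n. u n j x) \<longlonglongrightarrow> w j x"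
  proof (rule weights_nested[OF J(1), of K])
    fix n
    have "\<phi> < \<phi> + 1 / Suc n" by simp
    then obtain w where "w \<in> weights M J" "\<Phi> w < \<phi> + 1 / Suc n"
      using cInf_lessD[of "\<Phi> ` weights M J"] weights_nonempty[OF J, of M] unfolding \<phi>_def
      by blast
    then show "K n \<noteq> {}" by (auto simp: K_def intro!: exI[of _ w])
    show "K n \<subseteq> weights M J" by (auto simp: K_def)
    fix u v assume uv: "u \<in> K n" "v \<in> K n"
    \<comment> \<open>Midpoint convexity of the squared positive part, which closes the sublevel
      sets \<open>K n\<close> under midpoints.\<close>
    have sq: "(p ((1 - 1/2) * x + 1/2 * y))\<^sup>2 \<le> ((p x)\<^sup>2 + (p y)\<^sup>2) / 2" for x y
    proof -
      have "p ((1 - 1/2) * x + 1/2 * y) \<le> (p x + p y) / 2"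
      proof -
        have "t \<le> p t" "0 \<le> p t" for t by (simp_all add: p_def)
        from this[of x] this[of y] show ?thesis
          by (subst p_def, intro max.boundedI) simp_all
      qed
      then have "(p ((1 - 1/2) * x + 1/2 * y))\<^sup>2 \<le> ((p x + p y) / 2)\<^sup>2"
        by (intro power_mono) (auto simp: p_def)
      also have "\<dots> \<le> ((p x)\<^sup>2 + (p y)\<^sup>2) / 2"
        using zero_le_power2[of "p x - p y"] by (simp add: power2_eq_square field_simps)
      finally show ?thesis .
    qed
    have "\<Phi> (mix (1/2) u v) \<le> (\<Sum>r\<in>I. ((p (F r u))\<^sup>2 + (p (F r v))\<^sup>2) / 2)"
      unfolding \<Phi>_def
    proof (rule sum_mono)
      fix r assume r: "r \<in> I"
      show "(p (F r (mix (1/2) u v)))\<^sup>2 \<le> ((p (F r u))\<^sup>2 + (p (F r v))\<^sup>2) / 2"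
        using sq[of "F r u" "F r v"] Fmix[OF r, of u v "1/2"] uv by (simp add: K_def)
    qed
    also have "\<dots> = (\<Phi> u + \<Phi> v) / 2"
      by (simp add: \<Phi>_def sum.distrib flip: sum_divide_distrib)
    finally show "mix (1/2) u v \<in> K n"
      using uv mix_in_weights[of u M J v "1/2"] by (auto simp: K_def)
  next
    show "decseq K" by (auto simp: K_def decseq_def intro!: divide_left_mono elim!: order_trans)
  qed (use that in blast)
  have uW: "u n \<in> weights M J" for n using u by (auto simp: K_def)
  have "(\<lambda>n. \<Phi> (u n)) \<longlonglongrightarrow> \<Phi> w"
    unfolding \<Phi>_def p_def F_def
    by (intro tendsto_sum tendsto_power tendsto_max tendsto_const tendsto_diff
        avg_tendsto[OF J(1) uW w lim A])
  moreover have "(\<lambda>n. \<phi> + 1 / Suc n) \<longlonglongrightarrow> \<phi> + 0"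
    by (intro tendsto_add tendsto_const LIMSEQ_Suc lim_1_over_n)
  ultimately have min: "\<Phi> w \<le> \<phi> + 0"
    using u by (intro LIMSEQ_le) (auto simp: K_def)
  obtain r0 where r0: "r0 \<in> I" "F r0 w > 0"
    using infeasible w by (force simp: F_def not_le)
  have "0 < (p (F r0 w))\<^sup>2" using r0 by (simp add: p_def)
  also have "\<dots> \<le> \<Phi> w" unfolding \<Phi>_def using I r0 by (intro member_le_sum) auto
  finally have pos: "0 < \<Phi> w" .
  have "\<Phi> w \<le> (\<Sum>r\<in>I. p (F r w) * F r v)" if v: "v \<in> weights M J" for v
  proof -
    define d where "d r = F r v - F r w" for r
    define D where "D = (\<Sum>r\<in>I. (d r)\<^sup>2)"
    \<comment> \<open>Moving from \<open>w\<close> towards \<open>v\<close> cannot lower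
      \<open>\<Phi>\<close>, and the change is at most \<open>t\<close> times this expression. Its
      sign survives division by \<open>t\<close> and then the limit at 0.\<close>
    have key: "0 \<le> 2 * (\<Sum>r\<in>I. p (F r w) * d r) + t * D" if t: "0 < t" "t \<le> 1" for t
    proof -
      \<comment> \<open>A quadratic upper bound valid for both signs of \<open>x\<close> stands in
        for the derivative of the squared positive part.\<close>
      have sq: "(p (x + y))\<^sup>2 \<le> (p x)\<^sup>2 + 2 * p x * y + y\<^sup>2" for x y :: real
      proof (cases "x \<ge> 0")
        case True
        then have "(p (x + y))\<^sup>2 \<le> (x + y)\<^sup>2" by (auto simp: p_def max_def)
        then show ?thesis using True by (simp add: p_def power2_eq_square algebra_simps)
      next
        case False
        then have "p (x + y) \<le> \<bar>y\<bar>" by (auto simp: p_def)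
        then have "(p (x + y))\<^sup>2 \<le> \<bar>y\<bar>\<^sup>2" by (intro power_mono) (auto simp: p_def)
        then show ?thesis using False by (simp add: p_def)
      qed
      have "\<Phi> w \<le> \<Phi> (mix t w v)"
        using min \<phi>le[OF mix_in_weights[OF w v, of t]] t by simp
      also have "\<dots> = (\<Sum>r\<in>I. (p (F r w + t * d r))\<^sup>2)"
        unfolding \<Phi>_def
      proof (rule sum.cong[OF refl])
        fix r assume r: "r \<in> I"
        have "F r (mix t w v) = F r w + t * d r"
          using Fmix[OF r w v, of t] t by (simp add: d_def algebra_simps)
        then show "(p (F r (mix t w v)))\<^sup>2 = (p (F r w + t * d r))\<^sup>2" by simp
      qed
      also have "\<dots> \<le> (\<Sum>r\<in>I. (p (F r w))\<^sup>2 + 2 * p (F r w) * (t * d r) + (t * d r)\<^sup>2)"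
        by (intro sum_mono sq)
      also have "\<dots> = \<Phi> w + t * (2 * (\<Sum>r\<in>I. p (F r w) * d r) + t * D)"
        by (simp add: \<Phi>_def D_def sum.distrib sum_distrib_left power2_eq_square algebra_simps)
      finally show ?thesis using t by (simp add: zero_le_mult_iff)
    qed
    have "0 \<le> 2 * (\<Sum>r\<in>I. p (F r w) * d r)"
    proof (rule tendsto_lowerbound[where F="at_right 0"])
      have "((\<lambda>t. 2 * (\<Sum>r\<in>I. p (F r w) * d r) + t * D) \<longlongrightarrow> 2 * (\<Sum>r\<in>I. p (F r w) * d r) + 0 * D) (at_right 0)"
        by (intro tendsto_intros)
      then show "((\<lambda>t. 2 * (\<Sum>r\<in>I. p (F r w) * d r) + t * D) \<longlongrightarrow> 2 * (\<Sum>r\<in>I. p (F r w) * d r)) (at_right 0)"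
        by simp
      show "\<forall>\<^sub>F t in at_right 0. 0 \<le> 2 * (\<Sum>r\<in>I. p (F r w) * d r) + t * D"
        by (rule eventually_at_rightI[of 0 1]) (use key in auto)
    qed simp
    then have "(\<Sum>r\<in>I. p (F r w) * F r w) \<le> (\<Sum>r\<in>I. p (F r w) * F r v)"
      by (simp add: d_def algebra_simps sum_subtractf)
    \<comment> \<open>Satisfied constraints have positive part 0, so the left-hand sum is exactly
      \<open>\<Phi> w\<close>, the margin.\<close>
    moreover have "p (F r w) * F r w = (p (F r w))\<^sup>2" for r
      by (simp add: p_def max_def power2_eq_square)
    ultimately show ?thesis by (simp add: \<Phi>_def)
  qed
  then show ?thesis using pos that[of "\<Phi> w" "\<lambda>r. p (F r w)"] by (auto simp: F_def p_def)
qed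

section \<open>Pointwise maxima and Lagrange multipliers\<close>

lemma Max_measurable_image:
  fixes f :: "'j \<Rightarrow> 'a \<Rightarrow> real"
  assumes "finite J" "\<And>j. j \<in> J \<Longrightarrow> f j \<in> borel_measurable N"
  shows "(\<lambda>x. Max ((\<lambda>j. f j x) ` J)) \<in> borel_measurable N"
  using borel_measurable_Max[of J f N] assms by (simp add: image_image)

lemma bounded_family_Max:
  fixes a :: "'j \<Rightarrow> 'a \<Rightarrow> real"
  assumes "finite J" "J \<noteq> {}" "bounded_family M J a"
  shows "integrable M (\<lambda>x. Max ((\<lambda>j. a j x) ` J))"
proof -
  obtain C where C: "\<And>j x. j \<in> J \<Longrightarrow> x \<in> space M \<Longrightarrow> \<bar>a j x\<bar> \<le> C"
    by (rule bounded_familyE[OF assms(3)]) (rule that)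
  show ?thesis
  proof (rule integrable_const_bound[where B=C])
    show "AE x in M. norm (Max ((\<lambda>j. a j x) ` J)) \<le> C"
    proof (rule AE_I2)
      fix x assume x: "x \<in> space M"
      have "Max ((\<lambda>j. a j x) ` J) \<in> (\<lambda>j. a j x) ` J" using assms by (intro Max_in) auto
      then show "norm (Max ((\<lambda>j. a j x) ` J)) \<le> C" using C x by auto
    qed
    show "(\<lambda>x. Max ((\<lambda>j. a j x) ` J)) \<in> borel_measurable M"
      using assms by (intro Max_measurable_image) (auto simp: bounded_family_def)
  qed
qed

text \<open>A measurable choice of a maximising index: ties are broken by the injective numbering
  \<open>e\<close>, so exactly one index is chosen at each point. The integral of a pointwise
  maximum is thus itself an average under some weights.\<close>

lemma exists_maximising_weights:
  fixes a :: "'j \<Rightarrow> 'a \<Rightarrow> real"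
  assumes J: "finite J" "J \<noteq> {}" and a: "\<And>j. j \<in> J \<Longrightarrow> a j \<in> borel_measurable M"
  obtains w where "w \<in> weights M J"
    "\<And>x. (\<Sum>j\<in>J. w j x * a j x) = Max ((\<lambda>j. a j x) ` J)"
proof -
  obtain e :: "'j \<Rightarrow> nat" where e: "inj_on e J"
    using finite_imp_inj_to_nat_seg[OF J(1)] by blast
  define top where "top j x \<longleftrightarrow> a j x = Max ((\<lambda>j. a j x) ` J)" for j x
  define w where "w j x = (if top j x \<and> (\<forall>i\<in>J. e i < e j \<longrightarrow> \<not> top i x) then 1 else 0 :: real)" for j x
  have ex: "\<exists>j0\<in>J. top j0 x \<and> (\<forall>i\<in>J. w i x = (if i = j0 then 1 else 0))" for x
  proof -
    have "Max ((\<lambda>j. a j x) ` J) \<in> (\<lambda>j. a j x) ` J" using J by (intro Max_in) auto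
    then have "\<exists>j. j \<in> J \<and> top j x" by (auto simp: top_def)
    then obtain j0 where j0: "j0 \<in> J" "top j0 x" "\<And>i. i \<in> J \<Longrightarrow> top i x \<Longrightarrow> e j0 \<le> e i"
      using ex_has_least_nat[of "\<lambda>j. j \<in> J \<and> top j x" _ e] by metis
    have "w i x = (if i = j0 then 1 else 0)" if "i \<in> J" for i
      using j0 that e unfolding w_def by (force simp: inj_on_def not_less dest: le_antisym)
    then show ?thesis using j0 by blast
  qed
  have Mm: "(\<lambda>x. Max ((\<lambda>j. a j x) ` J)) \<in> borel_measurable M"
    by (rule Max_measurable_image[OF J(1) a])
  have topm: "{x \<in> space M. top i x} \<in> sets M" if "i \<in> J" for i
    unfolding top_def using a[OF that] Mm by measurable
  have wm: "w j \<in> borel_measurable M" if "j \<in> J" for j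
  proof -
    have "{x \<in> space M. top j x \<and> (\<forall>i\<in>J. e i < e j \<longrightarrow> \<not> top i x)} =
      {x \<in> space M. top j x} - (\<Union>i\<in>{i \<in> J. e i < e j}. {x \<in> space M. top i x})" by auto
    also have "\<dots> \<in> sets M" using topm that J(1) by (intro sets.Diff sets.finite_UN) auto
    finally show ?thesis unfolding w_def by (intro measurable_If) auto
  qed
  have "(\<forall>j\<in>J. 0 \<le> w j x) \<and> (\<Sum>j\<in>J. w j x) = 1" for x
  proof -
    obtain j0 where "j0 \<in> J" "\<forall>i\<in>J. w i x = (if i = j0 then 1 else 0)" using ex by blast
    then show ?thesis using J(1) by (auto simp: sum.delta)
  qed
  then have "w \<in> weights M J" using wm by (auto simp: weights_def)
  moreover have "(\<Sum>j\<in>J. w j x * a j x) = Max ((\<lambda>j. a j x) ` J)" for x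
  proof -
    obtain j0 where j0: "j0 \<in> J" "top j0 x" "\<forall>i\<in>J. w i x = (if i = j0 then 1 else 0)" using ex by blast
    then have "(\<Sum>j\<in>J. w j x * a j x) = (\<Sum>j\<in>J. if j = j0 then a j x else 0)"
      by (intro sum.cong) auto
    then show ?thesis using j0 J(1) by (simp add: top_def)
  qed
  ultimately show ?thesis using that by blast
qed

lemma bounded_family_sum:
  assumes "finite I" "\<And>r. r \<in> I \<Longrightarrow> bounded_family M J (A r)"
  shows "bounded_family M J (\<lambda>j x. \<Sum>r\<in>I. m r * A r j x)"
proof -
  have "\<forall>r\<in>I. \<exists>C. \<forall>j\<in>J. \<forall>x\<in>space M. \<bar>A r j x\<bar> \<le> C"
    using assms(2) by (auto simp: bounded_family_def)
  then obtain C where C: "\<forall>r\<in>I. \<forall>j\<in>J. \<forall>x\<in>space M. \<bar>A r j x\<bar> \<le> C r" by metis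
  have "\<bar>\<Sum>r\<in>I. m r * A r j x\<bar> \<le> (\<Sum>r\<in>I. \<bar>m r\<bar> * C r)" if "j \<in> J" "x \<in> space M" for j x
    using C that by (intro order_trans[OF sum_abs] sum_mono) (auto simp: abs_mult intro!: mult_left_mono)
  moreover have "(\<lambda>x. \<Sum>r\<in>I. m r * A r j x) \<in> borel_measurable M" if "j \<in> J" for j
    using bounded_family_measurable[OF assms(2) that] by (intro borel_measurable_sum) auto
  ultimately show ?thesis unfolding bounded_family_def by blast
qed

lemma bounded_family_diff:
  assumes "bounded_family M J a" "bounded_family M J b"
  shows "bounded_family M J (\<lambda>j x. a j x - b j x)"
proof -
  obtain C D where "\<And>j x. j \<in> J \<Longrightarrow> x \<in> space M \<Longrightarrow> \<bar>a j x\<bar> \<le> C"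
    "\<And>j x. j \<in> J \<Longrightarrow> x \<in> space M \<Longrightarrow> \<bar>b j x\<bar> \<le> D"
    using bounded_familyE[OF assms(1)] bounded_familyE[OF assms(2)] by metis
  then have "\<bar>a j x - b j x\<bar> \<le> C + D" if "j \<in> J" "x \<in> space M" for j x
    using that by (meson abs_triangle_ineq4 add_mono order_trans)
  then show ?thesis using assms unfolding bounded_family_def by (auto intro!: borel_measurable_diff)
qed

lemma avg_diff:
  assumes "finite J" "w \<in> weights M J" "bounded_family M J a" "bounded_family M J b"
  shows "avg M J w (\<lambda>j x. a j x - b j x) = avg M J w a - avg M J w b"
  using integrable_weighted[OF assms(1,2,3)] integrable_weighted[OF assms(1,2,4)]
  by (simp add: avg_def right_diff_distrib sum_subtractf)

lemma avg_lincomb: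
  assumes "finite J" "w \<in> weights M J" "finite I" "\<And>r. r \<in> I \<Longrightarrow> bounded_family M J (A r)"
  shows "avg M J w (\<lambda>j x. \<Sum>r\<in>I. m r * A r j x) = (\<Sum>r\<in>I. m r * avg M J w (A r))"
proof -
  have int: "integrable M (\<lambda>x. w j x * A r j x)" if "r \<in> I" "j \<in> J" for r j
    using integrable_weighted[OF assms(1,2) assms(4)] that by auto
  have "(\<Sum>j\<in>J. w j x * (\<Sum>r\<in>I. m r * A r j x)) = (\<Sum>r\<in>I. m r * (\<Sum>j\<in>J. w j x * A r j x))" for x
    by (simp add: sum_distrib_left sum.swap[of _ J I] mult.left_commute)
  then show ?thesis using int by (simp add: avg_def)
qed

text \<open>The demand for an objective value of at least \<open>\<gamma>\<close> is one more
  constraint, incompatible with the others by \<open>opt\<close>; dividing the separation by its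
  multiplier gives the dual solution. Feasibility is asked only up to every \<open>\<eta>\<close>,
  which is what a Wasserstein ball defined through an infimum supplies, and it suffices to make that
  multiplier positive.\<close>

lemma weights_duality:
  fixes A :: "'r \<Rightarrow> 'j \<Rightarrow> 'a \<Rightarrow> real"
  assumes J: "finite J" "J \<noteq> {}" and I: "finite I"
    and A: "\<And>r. r \<in> I \<Longrightarrow> bounded_family M J (A r)" and B: "bounded_family M J B"
    and feas: "\<And>\<eta>. \<eta> > 0 \<Longrightarrow> \<exists>w\<in>weights M J. \<forall>r\<in>I. avg M J w (A r) \<le> b r + \<eta>"
    and opt: "\<And>w. w \<in> weights M J \<Longrightarrow> \<forall>r\<in>I. avg M J w (A r) \<le> b r \<Longrightarrow> avg M J w B < \<gamma>"
  obtains m where "\<And>r. r \<in> I \<Longrightarrow> 0 \<le> m r"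
    "(\<Sum>r\<in>I. m r * b r) + (\<integral>x. Max ((\<lambda>j. B j x - (\<Sum>r\<in>I. m r * A r j x)) ` J) \<partial>M) \<le> \<gamma>"
proof -
  \<comment> \<open>\<open>None\<close> stands for the objective constraint, with signs reversed to
    fit the form \<open>\<le>\<close>.\<close>
  define A' where "A' s = (case s of None \<Rightarrow> (\<lambda>j x. 0 - B j x) | Some r \<Rightarrow> A r)" for s
  define b' where "b' s = (case s of None \<Rightarrow> - \<gamma> | Some r \<Rightarrow> b r)" for s
  let ?I = "insert None (Some ` I)"
  have zero: "bounded_family M J (\<lambda>j x. 0)" by (auto simp: bounded_family_def)
  have A': "bounded_family M J (A' s)" if "s \<in> ?I" for s
    using that A bounded_family_diff[OF zero B] by (auto simp: A'_def)
  have avgN: "avg M J w (A' None) = - avg M J w B" if "w \<in> weights M J" for w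
    using avg_diff[OF J(1) that zero B] by (simp add: A'_def) (simp add: avg_def)
  have infeas: "\<not> (\<exists>w\<in>weights M J. \<forall>s\<in>?I. avg M J w (A' s) \<le> b' s)"
  proof safe
    fix w assume w: "w \<in> weights M J" and s: "\<forall>s\<in>?I. avg M J w (A' s) \<le> b' s"
    have "\<forall>r\<in>I. avg M J w (A r) \<le> b r" using s by (auto simp: A'_def b'_def)
    with opt[OF w] have "avg M J w B < \<gamma>" by blast
    moreover have "avg M J w (A' None) \<le> b' None" using s by blast
    ultimately show False using avgN[OF w] by (simp add: b'_def)
  qed
  have finI: "finite ?I" using I by simp
  obtain m' \<delta> where \<delta>: "\<delta> > 0" and m': "\<And>s. s \<in> ?I \<Longrightarrow> 0 \<le> m' s"
    and sep': "\<And>w. w \<in> weights M J \<Longrightarrow> \<delta> \<le> (\<Sum>s\<in>?I. m' s * (avg M J w (A' s) - b' s))"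
    by (rule weights_Farkas[OF J finI A' infeas]) (assumption, rule that)
  define m0 where "m0 = m' None"
  define n where "n r = m' (Some r)" for r
  have n0: "0 \<le> n r" if "r \<in> I" for r using m' that by (simp add: n_def)
  have sep: "\<delta> \<le> m0 * (\<gamma> - avg M J w B) + (\<Sum>r\<in>I. n r * (avg M J w (A r) - b r))"
    if w: "w \<in> weights M J" for w
    using sep'[OF w] I
    by (simp add: sum.reindex A'_def[of "Some _"] b'_def m0_def n_def avgN[OF w])
  have "m0 > 0"
  proof (rule ccontr)
    assume "\<not> 0 < m0"
    moreover have "0 \<le> m0" unfolding m0_def by (rule m') simp
    ultimately have m00: "m0 = 0" by simp
    \<comment> \<open>With multiplier 0 on the objective, the constraints alone would separate with
      margin \<open>\<delta>\<close>. Weights violating each by at most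
      \<open>\<delta> / (2 * N)\<close> contradict this; the summand 1 keeps \<open>N\<close>
      positive.\<close>
    define N where "N = (\<Sum>r\<in>I. n r) + 1"
    have N: "N > 0" using n0 by (auto simp: N_def intro!: add_nonneg_pos sum_nonneg)
    obtain w where w: "w \<in> weights M J" "\<forall>r\<in>I. avg M J w (A r) \<le> b r + \<delta> / (2 * N)"
      using feas[of "\<delta> / (2 * N)"] \<delta> N by auto
    have "\<delta> \<le> (\<Sum>r\<in>I. n r * (avg M J w (A r) - b r))" using sep[OF w(1)] m00 by simp
    also have "\<dots> \<le> (\<Sum>r\<in>I. n r * (\<delta> / (2 * N)))"
      using w n0 by (intro sum_mono mult_left_mono) (auto simp: algebra_simps)
    also have "\<dots> = (N - 1) * (\<delta> / (2 * N))"
      unfolding sum_distrib_right[symmetric] by (simp add: N_def)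
    also have "\<dots> \<le> N * (\<delta> / (2 * N))" using \<delta> N by (intro mult_right_mono) auto
    also have "\<dots> = \<delta> / 2" using N by simp
    finally show False using \<delta> by simp
  qed
  define m where "m r = n r / m0" for r
  define a where "a j x = B j x - (\<Sum>r\<in>I. m r * A r j x)" for j x
  have ba: "bounded_family M J a"
    unfolding a_def by (intro bounded_family_diff B bounded_family_sum I A)
  \<comment> \<open>Weights concentrated where the Lagrangian is largest turn the separation, valid
    for all weights, into a bound on the integral of the maximum.\<close>
  obtain w where w: "w \<in> weights M J" "\<And>x. (\<Sum>j\<in>J. w j x * a j x) = Max ((\<lambda>j. a j x) ` J)"
    using exists_maximising_weights[OF J, of a] bounded_family_measurable[OF ba] by blast
  have "(\<integral>x. Max ((\<lambda>j. a j x) ` J) \<partial>M) = avg M J w a" by (simp add: avg_def w(2))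
  also have "\<dots> = avg M J w B - (\<Sum>r\<in>I. m r * avg M J w (A r))"
    unfolding a_def using avg_diff[OF J(1) w(1) B bounded_family_sum[OF I A, where m=m]] avg_lincomb[OF J(1) w(1) I A, where m=m]
    by simp
  also have "\<dots> \<le> \<gamma> - (\<Sum>r\<in>I. m r * b r)"
  proof -
    have "0 \<le> (m0 * (\<gamma> - avg M J w B) + (\<Sum>r\<in>I. n r * (avg M J w (A r) - b r))) / m0"
      using sep[OF w(1)] \<delta> \<open>m0 > 0\<close> by (intro divide_nonneg_pos) auto
    also have "\<dots> = \<gamma> - avg M J w B + (\<Sum>r\<in>I. m r * (avg M J w (A r) - b r))"
      using \<open>m0 > 0\<close> by (simp add: add_divide_distrib m_def sum_divide_distrib)
    finally show ?thesis by (simp add: right_diff_distrib sum_subtractf)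
  qed
  finally have "(\<Sum>r\<in>I. m r * b r) + (\<integral>x. Max ((\<lambda>j. a j x) ` J) \<partial>M) \<le> \<gamma>" by simp
  moreover have "0 \<le> m r" if "r \<in> I" for r using n0[OF that] \<open>m0 > 0\<close> by (simp add: m_def)
  ultimately show ?thesis using that[of m] by (simp add: a_def)
qed

end

section \<open>Extended integrals of functions bounded above\<close>

lemma ext_integral_mono:
  assumes "AE x in M. f x \<le> g x"
  shows "ext_integral M f \<le> ext_integral M g"
proof -
  have "(\<integral>\<^sup>+x. ennreal (f x) \<partial>M) \<le> (\<integral>\<^sup>+x. ennreal (g x) \<partial>M)"
    by (rule nn_integral_mono_AE) (use assms in eventually_elim, simp add: ennreal_leI)
  moreover have "(\<integral>\<^sup>+x. ennreal (- g x) \<partial>M) \<le> (\<integral>\<^sup>+x. ennreal (- f x) \<partial>M)"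
    by (rule nn_integral_mono_AE) (use assms in eventually_elim, simp add: ennreal_leI)
  ultimately show ?thesis
    unfolding ext_integral_def by (intro ereal_minus_mono) (auto simp: less_eq_ennreal.rep_eq)
qed

lemma ext_integral_cong_AE:
  assumes "AE x in M. f x = g x"
  shows "ext_integral M f = ext_integral M g"
  by (intro antisym ext_integral_mono) (use assms in \<open>eventually_elim, simp\<close>)+

lemma ext_integral_integrable:
  assumes "integrable M f"
  shows "ext_integral M f = ereal (\<integral>x. f x \<partial>M)"
proof -
  have fin: "(\<integral>\<^sup>+x. ennreal (f x) \<partial>M) < \<infinity>" "(\<integral>\<^sup>+x. ennreal (- f x) \<partial>M) < \<infinity>"
    using assms by (auto simp: real_integrable_def less_top)
  have "enn2ereal e = ereal (enn2real e)" if "e < \<infinity>" for e :: ennreal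
    using that by (cases e) (auto simp: enn2ereal_ennreal)
  then show ?thesis using fin by (simp add: ext_integral_def real_lebesgue_integral_def[OF assms])
qed

text \<open>Constant in \<open>x\<close>. With \<open>f\<close> the projection to labels or to
  samples, its average is the mass of one label or one sample.\<close>

definition hits :: "('j \<Rightarrow> 'b) \<Rightarrow> 'b \<Rightarrow> 'j \<Rightarrow> 'a \<Rightarrow> real" where
  "hits f a j x = (if f j = a then 1 else 0)"

lemma hits_bounded: "bounded_family M J (hits f a)"
proof -
  have "hits f a j \<in> borel_measurable M" for j unfolding hits_def[abs_def] by simp
  then show ?thesis unfolding bounded_family_def by (auto simp: hits_def intro!: exI[of _ 1])
qed

lemma sum_ennreal_weights:
  assumes "w \<in> weights M J" "finite J"
  shows "AE x in M. (\<Sum>j\<in>J. ennreal (w j x)) = 1"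
  using weights_AE[OF assms]
proof eventually_elim
  case (elim x)
  then have "(\<Sum>j\<in>J. ennreal (w j x)) = ennreal (\<Sum>j\<in>J. w j x)" by (intro sum_ennreal) auto
  then show ?case using elim by simp
qed

context prob_space
begin

text \<open>Splitting \<open>f\<close> into its parts gives
  \<open>(C - f) + f\<^sup>+ = C + f\<^sup>-\<close>, and the integral of the positive part is at
  most \<open>C\<close>, so it can be cancelled. A single nonnegative integral is easier to push
  forward and to take limits of.\<close>

lemma ext_integral_bounded_above:
  assumes f: "f \<in> borel_measurable M" and C: "AE x in M. f x \<le> C" "0 \<le> C"
  shows "ext_integral M f = ereal C - enn2ereal (\<integral>\<^sup>+x. ennreal (C - f x) \<partial>M)"
proof -
  let ?p = "\<integral>\<^sup>+x. ennreal (f x) \<partial>M" and ?n = "\<integral>\<^sup>+x. ennreal (- f x) \<partial>M"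
    and ?d = "\<integral>\<^sup>+x. ennreal (C - f x) \<partial>M"
  have "?p \<le> (\<integral>\<^sup>+x. ennreal C \<partial>M)"
    by (rule nn_integral_mono_AE) (use C(1) in eventually_elim, simp add: ennreal_leI)
  then have p: "?p \<le> ennreal C" by (simp add: emeasure_space_1)
  have "?d + ?p = (\<integral>\<^sup>+x. ennreal (C - f x) + ennreal (f x) \<partial>M)"
    using f by (intro nn_integral_add[symmetric]) auto
  also have "\<dots> = (\<integral>\<^sup>+x. ennreal C + ennreal (- f x) \<partial>M)"
  proof (rule nn_integral_cong_AE)
    show "AE x in M. ennreal (C - f x) + ennreal (f x) = ennreal C + ennreal (- f x)"
      using C(1)
    proof eventually_elim
      case (elim x)
      then show ?case using C(2)
        by (cases "f x \<ge> 0") (auto simp: ennreal_neg simp flip: ennreal_plus)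
    qed
  qed
  also have "\<dots> = ennreal C + ?n"
    using f by (subst nn_integral_add) (auto simp: emeasure_space_1)
  finally have eq: "?d + ?p = ennreal C + ?n" .
  obtain p where p': "?p = ennreal p" "0 \<le> p"
    using p by (cases ?p) (auto simp: top_unique)
  show ?thesis
  proof (cases ?n)
    case (real n)
    then have "?d + ennreal p = ennreal (C + n)" using eq p' C(2) by simp
    then obtain d where d: "?d = ennreal d" "0 \<le> d" by (cases ?d) auto
    then have "d + p = C + n" using eq p' C(2) real
      by (metis add_nonneg_nonneg ennreal_inj ennreal_plus)
    then show ?thesis using d p' real by (simp add: ext_integral_def enn2ereal_ennreal)
  next
    case top
    then have "?d = \<top>" using eq p' by (cases ?d) (auto simp flip: ennreal_plus)
    then show ?thesis using top p' by (simp add: ext_integral_def enn2ereal_ennreal)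
  qed
qed

text \<open>Additivity that survives the value -\<infinity>: subtracted from their upper bounds,
  both functions become nonnegative, and integrals of nonnegative functions always add.\<close>

lemma ext_integral_add_bounded:
  assumes f: "f \<in> borel_measurable M" and C: "AE x in M. f x \<le> C"
    and h: "h \<in> borel_measurable M" and D: "AE x in M. \<bar>h x\<bar> \<le> D"
  shows "ext_integral M (\<lambda>x. f x + h x) = ext_integral M f + ereal (\<integral>x. h x \<partial>M)"
proof -
  define C' D' where "C' = max 0 C" and "D' = max 0 D"
  have C': "AE x in M. f x \<le> C'" using C by eventually_elim (simp add: C'_def)
  have D': "AE x in M. \<bar>h x\<bar> \<le> D'" using D by eventually_elim (simp add: D'_def)
  have ih: "integrable M h" by (rule integrable_const_bound[of _ D']) (use D' h in auto)
  have "AE x in M. f x + h x \<le> C' + D'" using C' D' by eventually_elim auto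
  then have "ext_integral M (\<lambda>x. f x + h x) =
      ereal (C' + D') - enn2ereal (\<integral>\<^sup>+x. ennreal ((C' + D') - (f x + h x)) \<partial>M)"
    using f h by (intro ext_integral_bounded_above) (auto simp: C'_def D'_def)
  also have "(\<integral>\<^sup>+x. ennreal ((C' + D') - (f x + h x)) \<partial>M) =
     (\<integral>\<^sup>+x. ennreal (C' - f x) + ennreal (D' - h x) \<partial>M)"
  proof (rule nn_integral_cong_AE)
    show "AE x in M. ennreal ((C' + D') - (f x + h x)) = ennreal (C' - f x) + ennreal (D' - h x)"
      using C' D' by eventually_elim (auto simp: algebra_simps simp flip: ennreal_plus)
  qed
  also have "\<dots> = (\<integral>\<^sup>+x. ennreal (C' - f x) \<partial>M) + (\<integral>\<^sup>+x. ennreal (D' - h x) \<partial>M)"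
    using f h by (intro nn_integral_add) auto
  also have "(\<integral>\<^sup>+x. ennreal (D' - h x) \<partial>M) = ennreal (D' - (\<integral>x. h x \<partial>M))"
    using ih D' by (subst nn_integral_eq_integral) (auto simp: prob_space)
  finally have 1: "ext_integral M (\<lambda>x. f x + h x) = ereal (C' + D') -
     enn2ereal ((\<integral>\<^sup>+x. ennreal (C' - f x) \<partial>M) + ennreal (D' - (\<integral>x. h x \<partial>M)))" .
  have "(\<integral>x. h x \<partial>M) \<le> (\<integral>x. D' \<partial>M)"
    using ih D' by (intro integral_mono_AE) auto
  then have "0 \<le> D' - (\<integral>x. h x \<partial>M)" by (simp add: prob_space)
  moreover have 2: "ext_integral M f = ereal C' - enn2ereal (\<integral>\<^sup>+x. ennreal (C' - f x) \<partial>M)"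
    using f C' by (intro ext_integral_bounded_above) (auto simp: C'_def)
  ultimately show ?thesis unfolding 1 2
    by (cases "\<integral>\<^sup>+x. ennreal (C' - f x) \<partial>M")
      (auto simp: enn2ereal_ennreal simp flip: ennreal_plus)
qed

lemma integrable_of_ext_integral:
  assumes f: "f \<in> borel_measurable M" and C: "AE x in M. f x \<le> C" and "ext_integral M f \<noteq> -\<infinity>"
  shows "integrable M f"
proof -
  define C' where "C' = max 0 C"
  have C': "AE x in M. f x \<le> C'" using C by eventually_elim (simp add: C'_def)
  have "ext_integral M f = ereal C' - enn2ereal (\<integral>\<^sup>+x. ennreal (C' - f x) \<partial>M)"
    using f C' by (intro ext_integral_bounded_above) (auto simp: C'_def)
  then have "(\<integral>\<^sup>+x. ennreal (C' - f x) \<partial>M) < \<infinity>"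
    using assms(3) by (cases "\<integral>\<^sup>+x. ennreal (C' - f x) \<partial>M") auto
  then have "integrable M (\<lambda>x. C' - f x)"
    using f C' by (intro integrableI_nonneg) auto
  then have "integrable M (\<lambda>x. C' - (C' - f x))"
    by (rule Bochner_Integration.integrable_diff[OF integrable_const])
  moreover have "(\<lambda>x. C' - (C' - f x)) = f" by auto
  ultimately show ?thesis by (simp only:)
qed

lemma ennreal_avg:
  assumes "finite J" "w \<in> weights M J" "bounded_family M J a"
    "\<And>j x. j \<in> J \<Longrightarrow> x \<in> space M \<Longrightarrow> 0 \<le> a j x"
  shows "ennreal (avg M J w a) = (\<integral>\<^sup>+x. (\<Sum>j\<in>J. ennreal (w j x) * ennreal (a j x)) \<partial>M)"
proof -
  have nn: "AE x in M. \<forall>j\<in>J. 0 \<le> w j x * a j x"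
    using weights_AE[OF assms(2,1)] AE_space by eventually_elim (use assms(4) in auto)
  have "(\<integral>\<^sup>+x. (\<Sum>j\<in>J. ennreal (w j x) * ennreal (a j x)) \<partial>M) =
     (\<integral>\<^sup>+x. ennreal (\<Sum>j\<in>J. w j x * a j x) \<partial>M)"
  proof (rule nn_integral_cong_AE)
    show "AE x in M. (\<Sum>j\<in>J. ennreal (w j x) * ennreal (a j x)) = ennreal (\<Sum>j\<in>J. w j x * a j x)"
      using weights_AE[OF assms(2,1)] AE_space
    proof eventually_elim
      case (elim x)
      then show ?case using assms(4)
        by (subst sum_ennreal[symmetric]) (auto simp: ennreal_mult)
    qed
  qed
  also have "\<dots> = ennreal (avg M J w a)" unfolding avg_def
  proof (rule nn_integral_eq_integral)
    show "integrable M (\<lambda>x. \<Sum>j\<in>J. w j x * a j x)"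
      using integrable_weighted[OF assms(1,2,3)] by auto
    show "AE x in M. 0 \<le> (\<Sum>j\<in>J. w j x * a j x)"
      using nn by eventually_elim (auto intro: sum_nonneg)
  qed
  finally show ?thesis by simp
qed

lemma ennreal_avg_hits:
  assumes J: "finite J" and w: "w \<in> weights M J" and A: "finite A"
  shows "ennreal (\<Sum>a\<in>A. avg M J w (hits f a)) =
    (\<integral>\<^sup>+x. (\<Sum>j\<in>J. ennreal (w j x) * indicator A (f j)) \<partial>M)"
proof -
  define s where "s j x = (\<Sum>a\<in>A. 1 * hits f a j x)" for j and x :: 'a
  have s: "s j x = indicator A (f j)" for j x
    using A by (simp add: s_def hits_def sum.delta' indicator_def)
  have "(\<Sum>a\<in>A. avg M J w (hits f a)) = avg M J w s"
    using avg_lincomb[OF J w A, where A="hits f" and m="\<lambda>_. 1", OF hits_bounded]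
    by (simp add: s_def[abs_def])
  also have "ennreal \<dots> = (\<integral>\<^sup>+x. (\<Sum>j\<in>J. ennreal (w j x) * ennreal (s j x)) \<partial>M)"
  proof (rule ennreal_avg[OF J w])
    show "bounded_family M J s" unfolding s_def[abs_def] by (intro bounded_family_sum A hits_bounded)
  qed (simp add: s)
  finally show ?thesis by (simp add: s ennreal_indicator)
qed

lemma sum_avg_hits:
  assumes J: "finite J" and w: "w \<in> weights M J" and A: "finite A" "\<And>j. j \<in> J \<Longrightarrow> f j \<in> A"
  shows "(\<Sum>a\<in>A. avg M J w (hits f a)) = 1"
proof -
  have "(\<integral>\<^sup>+x. (\<Sum>j\<in>J. ennreal (w j x) * indicator A (f j)) \<partial>M) = (\<integral>\<^sup>+x. 1 \<partial>M)"
    by (rule nn_integral_cong_AE, use sum_ennreal_weights[OF w J] in eventually_elim) (simp add: A(2))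
  then have "ennreal (\<Sum>a\<in>A. avg M J w (hits f a)) = 1"
    using ennreal_avg_hits[OF J w A(1), of f] by (simp add: emeasure_space_1)
  then show ?thesis by simp
qed

end

section \<open>Couplings with a discrete measure as weights\<close>

definition atom :: "(nat \<Rightarrow> 'y) \<Rightarrow> (nat \<Rightarrow> 'z) \<Rightarrow> 'x \<Rightarrow> nat \<times> nat \<Rightarrow> ('x \<times> 'y) \<times> 'z" where
  "atom y z x j = ((x, y (fst j)), z (snd j))"

text \<open>Says that \<open>\<pi>\<close> is the image under \<open>atom\<close> of the measure
  with density \<open>w\<close> over counting measure on \<open>J\<close> times \<open>P\<close>.
  Testing with nonnegative functions lets costs, masses and losses be read off from one
  property.\<close>

definition represents :: "'x measure \<Rightarrow> (nat \<times> nat) set \<Rightarrow> (nat \<Rightarrow> 'y) \<Rightarrow> (nat \<Rightarrow> 'z)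
    \<Rightarrow> (nat \<times> nat \<Rightarrow> 'x \<Rightarrow> real) \<Rightarrow> (('x::topological_space \<times> 'y::topological_space) \<times> 'z::topological_space) measure \<Rightarrow> bool" where
  "represents P J y z w \<pi> \<longleftrightarrow> sets \<pi> = sets borel \<and>
     (\<forall>\<phi>\<in>borel_measurable borel.
        (\<integral>\<^sup>+\<omega>. \<phi> \<omega> \<partial>\<pi>) = (\<integral>\<^sup>+x. (\<Sum>j\<in>J. ennreal (w j x) * \<phi> (atom y z x j)) \<partial>P))"

lemma representsD:
  "represents P J y z w \<pi> \<Longrightarrow> \<phi> \<in> borel_measurable borel \<Longrightarrow>
     (\<integral>\<^sup>+\<omega>. \<phi> \<omega> \<partial>\<pi>) = (\<integral>\<^sup>+x. (\<Sum>j\<in>J. ennreal (w j x) * \<phi> (atom y z x j)) \<partial>P)"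
  by (auto simp: represents_def)

lemma atom_measurable [measurable]:
  "(\<lambda>x :: 'x::topological_space. atom y (z :: nat \<Rightarrow> 'z::topological_space) x j
     :: ('x \<times> 'y::topological_space) \<times> 'z) \<in> borel \<rightarrow>\<^sub>M borel"
  unfolding atom_def by (intro borel_measurable_continuous_onI continuous_intros)

text \<open>Samples may coincide, so the mass counts indices and not points.\<close>

lemma emeasure_empirical_vimage:
  assumes "A \<in> sets borel"
  shows "emeasure (empirical N z) A = of_nat (card {i\<in>{1..N}. z i \<in> A}) * ennreal (1 / real N)"
proof -
  have "emeasure (empirical N z) A = (\<Sum>i=1..N. ennreal (1 / real N) * indicator A (z i))"
    using assms by (simp add: emeasure_empirical)
  also have "\<dots> = (\<Sum>i\<in>{i\<in>{1..N}. z i \<in> A}. ennreal (1 / real N))"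
    by (intro sum.mono_neutral_cong_right) (auto simp: indicator_def)
  finally show ?thesis by simp
qed

lemma distr_eq_emeasure:
  assumes "distr \<pi> borel f = \<mu>" "f \<in> \<pi> \<rightarrow>\<^sub>M borel" "A \<in> sets borel"
  shows "emeasure \<mu> A = emeasure \<pi> (f -` A \<inter> space \<pi>)"
  using assms emeasure_distr by metis

text \<open>On Polish spaces finite Borel measures are inner regular; this supplies Radon membership
  for the couplings built from weights.\<close>

lemma radon_measures_finite:
  fixes M :: "'a::{second_countable_topology, complete_space} measure"
  assumes "sets M = sets borel" "emeasure M (space M) \<noteq> \<infinity>"
  shows "M \<in> radon_measures"
proof -
  have "emeasure M UNIV < \<infinity>"
    using assms sets_eq_imp_space_eq[OF assms(1)] by (simp add: less_top)
  moreover have "emeasure M A = (SUP K\<in>{K. compact K \<and> K \<subseteq> A}. emeasure M K)"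
    if "A \<in> sets borel" for A
  proof -
    have "{K. compact K \<and> K \<subseteq> A} = {K. K \<subseteq> A \<and> compact K}" by auto
    then show ?thesis using inner_regular[OF assms that] by simp
  qed
  ultimately show ?thesis using assms(1) by (auto simp: radon_measures_def intro!: exI[of _ UNIV])
qed

text \<open>Label and sample take finitely many values, so disintegration reduces to Radon-Nikodym:
  the part of \<open>\<pi>\<close> with a given label and sample, pushed to the first coordinate, is
  dominated by \<open>P\<close>.\<close>

lemma coupling_to_weights:
  fixes P :: "'x::polish_space measure" and y :: "nat \<Rightarrow> 'y::polish_space"
    and z :: "nat \<Rightarrow> 'x \<times> 'y"
  assumes P: "P \<in> prob_measures" and y: "bij_betw y {1..NY} UNIV" and Nl: "1 \<le> Nl"
    and \<pi>: "\<pi> \<in> couplings \<mu> (empirical Nl z)"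
    and \<mu>: "\<And>A. A \<in> sets borel \<Longrightarrow> emeasure \<mu> (A \<times> UNIV) = emeasure P A"
  obtains w where "w \<in> weights P ({1..NY} \<times> {1..Nl})"
    "represents P ({1..NY} \<times> {1..Nl}) y z w \<pi>"
    "\<And>i. i \<in> {1..Nl} \<Longrightarrow> (\<integral>\<^sup>+x. (\<Sum>k=1..NY. ennreal (w (k, i) x)) \<partial>P) = ennreal (1 / real Nl)"
proof -
  let ?J = "{1..NY} \<times> {1..Nl}"
  have setsP: "sets P = sets borel" and prP: "prob_space P"
    using P by (auto simp: prob_measures_def space_prob_algebra)
  have spP: "space P = UNIV" using sets_eq_imp_space_eq[OF setsP] by simp
  interpret P: prob_space P by fact
  have set\<pi> [measurable_cong]: "sets \<pi> = sets borel"
    and d1: "distr \<pi> borel fst = \<mu>" and d2: "distr \<pi> borel snd = empirical Nl z"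
    using \<pi> by (auto simp: couplings_def radon_measures_def)
  have sp\<pi>: "space \<pi> = UNIV" using sets_eq_imp_space_eq[OF set\<pi>] by simp
  have [measurable]: "fst \<in> borel \<rightarrow>\<^sub>M (borel :: ('x \<times> 'y) measure)"
    "snd \<in> borel \<rightarrow>\<^sub>M (borel :: ('x \<times> 'y) measure)"
    "fst \<in> borel \<rightarrow>\<^sub>M (borel :: 'x measure)" "snd \<in> borel \<rightarrow>\<^sub>M (borel :: 'y measure)"
    by (auto intro!: borel_measurable_continuous_onI continuous_intros)
  have fst\<pi>: "emeasure \<pi> {\<omega>. fst (fst \<omega>) \<in> A} = emeasure P A" if A: "A \<in> sets borel" for A
  proof -
    have "A \<times> UNIV \<in> sets (borel :: ('x \<times> 'y) measure)" using A by (intro borel_Times) simp_all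
    then have "emeasure \<mu> (A \<times> UNIV) = emeasure \<pi> (fst -` (A \<times> UNIV) \<inter> space \<pi>)"
      by (intro distr_eq_emeasure[OF d1]) auto
    then show ?thesis using \<mu>[OF A] by (simp add: sp\<pi> vimage_def mem_Times_iff)
  qed
  have fstA: "{\<omega> :: ('x \<times> 'y) \<times> ('x \<times> 'y). fst (fst \<omega>) \<in> A} \<in> sets borel"
    if A: "A \<in> sets borel" for A
  proof -
    have "(\<lambda>\<omega> :: ('x \<times> 'y) \<times> ('x \<times> 'y). fst (fst \<omega>)) \<in> borel \<rightarrow>\<^sub>M borel"
      by measurable
    from measurable_sets[OF this A] show ?thesis by (simp add: vimage_def)
  qed
  \<comment> \<open>Multiplicity of a sample point. Coinciding samples share the mass of their point
    equally, so that each index receives \<open>1 / real Nl\<close>.\<close>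
  define m where "m i = card {i'\<in>{1..Nl}. z i' = z i}" for i
  have m: "m i > 0" if "i \<in> {1..Nl}" for i using that by (auto simp: m_def card_gt_0_iff)
  define E where "E j = {\<omega> :: ('x \<times> 'y) \<times> ('x \<times> 'y). snd (fst \<omega>) = y (fst j) \<and> snd \<omega> = z (snd j)}" for j
  have E [measurable]: "E j \<in> sets borel" for j
  proof -
    have "closed (E j)" unfolding E_def
      by (intro closed_Collect_conj closed_Collect_eq continuous_intros)
    then show ?thesis by simp
  qed
  define wt where "wt j \<omega> = ennreal (1 / real (m (snd j))) * indicator (E j) \<omega>" for j \<omega>
  have wt [measurable]: "wt j \<in> borel_measurable borel" for j unfolding wt_def by measurable
  have wt_atom: "wt j \<omega> * \<phi> \<omega> = wt j \<omega> * \<phi> (atom y z (fst (fst \<omega>)) j)" for j \<omega> and \<phi> :: "_ \<Rightarrow> ennreal"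
    by (cases \<omega>) (auto simp: wt_def E_def atom_def indicator_def)
  have sum_k: "(\<Sum>k=1..NY. wt (k, i) \<omega>) = ennreal (1 / real (m i)) * indicator {\<omega>. snd \<omega> = z i} \<omega>" for i \<omega>
  proof -
    obtain k0 where k0: "k0 \<in> {1..NY}" "snd (fst \<omega>) = y k0"
      using bij_betw_imp_surj_on[OF y] by (metis UNIV_I imageE)
    have "wt (k, i) \<omega> = (if k = k0 then ennreal (1 / real (m i)) * indicator {\<omega>. snd \<omega> = z i} \<omega> else 0)"
      if "k \<in> {1..NY}" for k
    proof -
      have "y k0 = y k \<longleftrightarrow> k = k0"
        using inj_on_eq_iff[OF bij_betw_imp_inj_on[OF y] k0(1) that] by auto
      then have "\<omega> \<in> E (k, i) \<longleftrightarrow> k = k0 \<and> snd \<omega> = z i" by (simp add: E_def k0(2))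
      then show ?thesis by (simp add: wt_def indicator_def)
    qed
    then show ?thesis using k0 by (simp add: sum.delta)
  qed
  have sum_wt: "(\<Sum>j\<in>?J. wt j \<omega>) = 1" if \<omega>: "snd \<omega> \<in> z ` {1..Nl}" for \<omega>
  proof -
    obtain i0 where i0: "i0 \<in> {1..Nl}" "snd \<omega> = z i0" using \<omega> by blast
    have "(\<Sum>j\<in>?J. wt j \<omega>) = (\<Sum>i=1..Nl. \<Sum>k=1..NY. wt (k, i) \<omega>)"
      by (subst sum.swap) (simp add: sum.cartesian_product split_def)
    also have "\<dots> = (\<Sum>i=1..Nl. ennreal (1 / real (m i)) * indicator {\<omega>. snd \<omega> = z i} \<omega>)"
      by (simp only: sum_k)
    also have "\<dots> = (\<Sum>i\<in>{i\<in>{1..Nl}. z i = z i0}. ennreal (1 / real (m i0)))"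
      using i0 by (intro sum.mono_neutral_cong_right) (auto simp: indicator_def m_def)
    also have "\<dots> = of_nat (m i0) * ennreal (1 / real (m i0))" by (simp add: m_def)
    also have "\<dots> = 1" using m[OF i0(1)]
      by (simp add: ennreal_of_nat_eq_real_of_nat ennreal_mult[symmetric])
    finally show ?thesis .
  qed
  \<comment> \<open>The functions \<open>wt j\<close> add up to 1 only over the sample points, where
    the second marginal puts all the mass.\<close>
  have AEz: "AE \<omega> in \<pi>. snd \<omega> \<in> z ` {1..Nl}"
  proof -
    have c: "closed (z ` {1..Nl})" by (intro finite_imp_closed) simp
    then have b: "- (z ` {1..Nl}) \<in> sets borel" by auto
    have "emeasure (empirical Nl z) (- (z ` {1..Nl})) = 0"
      using b by (subst emeasure_empirical_vimage) auto
    then have "emeasure \<pi> (snd -` (- (z ` {1..Nl})) \<inter> space \<pi>) = 0"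
      using distr_eq_emeasure[OF d2 _ b] by simp
    moreover have "snd -` (- (z ` {1..Nl})) \<inter> space \<pi> \<in> sets \<pi>"
      by (rule measurable_sets[OF _ b]) measurable
    ultimately show ?thesis
      by (intro AE_I[where N="snd -` (- (z ` {1..Nl})) \<inter> space \<pi>"]) (auto simp: sp\<pi>)
  qed
  \<comment> \<open>The share of \<open>\<pi>\<close> that belongs to index \<open>j\<close>,
    projected to the space of \<open>P\<close>.\<close>
  define N where "N j = distr (density \<pi> (wt j)) borel (\<lambda>\<omega>. fst (fst \<omega>))" for j
  have nnN: "(\<integral>\<^sup>+x. g x \<partial>N j) = (\<integral>\<^sup>+\<omega>. wt j \<omega> * g (fst (fst \<omega>)) \<partial>\<pi>)"
    if [measurable]: "g \<in> borel_measurable borel" for g j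
    unfolding N_def by (simp add: nn_integral_distr nn_integral_density)
  have wt1: "wt j \<omega> \<le> 1" if "j \<in> ?J" for j \<omega>
  proof -
    have "1 / real (m (snd j)) \<le> 1" using m[of "snd j"] that by (auto simp: divide_le_eq_1)
    then show ?thesis by (auto simp: wt_def indicator_def ennreal_le_1)
  qed
  have N_le: "emeasure (N j) A \<le> emeasure P A" if j: "j \<in> ?J" and A: "A \<in> sets borel" for j A
  proof -
    have "emeasure (N j) A = (\<integral>\<^sup>+x. indicator A x \<partial>N j)"
      using A by (simp add: N_def)
    also have "\<dots> = (\<integral>\<^sup>+\<omega>. wt j \<omega> * indicator A (fst (fst \<omega>)) \<partial>\<pi>)"
      using A by (intro nnN) auto
    also have "\<dots> \<le> (\<integral>\<^sup>+\<omega>. indicator {\<omega>. fst (fst \<omega>) \<in> A} \<omega> \<partial>\<pi>)"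
      using wt1[OF j] by (intro nn_integral_mono) (auto simp: indicator_def)
    also have "\<dots> = emeasure \<pi> {\<omega>. fst (fst \<omega>) \<in> A}"
      using fstA[OF A] set\<pi> by (intro nn_integral_indicator) simp
    finally show ?thesis using fst\<pi>[OF A] by simp
  qed
  have "\<exists>f\<in>borel_measurable P. (\<forall>x. 0 \<le> f x) \<and> density P (\<lambda>x. ennreal (f x)) = N j" if j: "j \<in> ?J" for j
  proof -
    have sN: "sets (N j) = sets P" by (simp add: N_def setsP)
    have ac: "absolutely_continuous P (N j)"
      unfolding absolutely_continuous_def
      using N_le[OF j] by (auto simp: null_sets_def setsP sN) (metis le_zero_eq)
    have "finite_measure (N j)"
    proof
      have "space (N j) = UNIV" by (simp add: N_def)
      then show "emeasure (N j) (space (N j)) \<noteq> \<infinity>"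
        using N_le[OF j, of UNIV] P.emeasure_space_1 by (auto simp: spP top_unique)
    qed
    then obtain f where f: "f \<in> borel_measurable P" "AE x in P. RN_deriv P (N j) x = ennreal (f x)" "\<And>x. 0 \<le> f x"
      using P.real_RN_deriv[OF _ ac sN] by blast
    have "density P (\<lambda>x. ennreal (f x)) = density P (RN_deriv P (N j))"
      using f by (intro density_cong) auto
    then show ?thesis using f P.density_RN_deriv[OF ac sN] by auto
  qed
  then obtain w where w: "\<And>j. j \<in> ?J \<Longrightarrow> w j \<in> borel_measurable P" "\<And>j x. j \<in> ?J \<Longrightarrow> 0 \<le> w j x"
    "\<And>j. j \<in> ?J \<Longrightarrow> density P (\<lambda>x. ennreal (w j x)) = N j"
    by metis
  have wm: "(\<lambda>x. ennreal (w j x)) \<in> borel_measurable P" if "j \<in> ?J" for j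
    using w(1)[OF that] by simp
  have nnw: "(\<integral>\<^sup>+\<omega>. wt j \<omega> * g (fst (fst \<omega>)) \<partial>\<pi>) = (\<integral>\<^sup>+x. ennreal (w j x) * g x \<partial>P)"
    if "g \<in> borel_measurable borel" "j \<in> ?J" for g j
    using nnN[OF that(1), of j] nn_integral_density[OF wm[OF that(2)], of g] w(3)[OF that(2)] that(1) setsP
    by (simp cong: measurable_cong_sets)
  have key: "(\<integral>\<^sup>+\<omega>. \<phi> \<omega> \<partial>\<pi>) = (\<integral>\<^sup>+x. (\<Sum>j\<in>?J. ennreal (w j x) * \<phi> (atom y z x j)) \<partial>P)"
    if [measurable]: "\<phi> \<in> borel_measurable borel" for \<phi>
  proof -
    have \<phi>a: "(\<lambda>x. \<phi> (atom y z x j)) \<in> borel_measurable borel" for j by measurable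
    have "(\<integral>\<^sup>+\<omega>. \<phi> \<omega> \<partial>\<pi>) = (\<integral>\<^sup>+\<omega>. (\<Sum>j\<in>?J. wt j \<omega> * \<phi> \<omega>) \<partial>\<pi>)"
    proof (rule nn_integral_cong_AE)
      show "AE \<omega> in \<pi>. \<phi> \<omega> = (\<Sum>j\<in>?J. wt j \<omega> * \<phi> \<omega>)"
        using AEz
      proof eventually_elim
        case (elim \<omega>)
        from sum_wt[OF elim] show ?case unfolding sum_distrib_right[symmetric] by (simp only: mult_1)
      qed
    qed
    also have "\<dots> = (\<integral>\<^sup>+\<omega>. (\<Sum>j\<in>?J. wt j \<omega> * \<phi> (atom y z (fst (fst \<omega>)) j)) \<partial>\<pi>)"
      by (intro nn_integral_cong sum.cong refl wt_atom)
    also have "\<dots> = (\<Sum>j\<in>?J. \<integral>\<^sup>+\<omega>. wt j \<omega> * \<phi> (atom y z (fst (fst \<omega>)) j) \<partial>\<pi>)"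
      by (intro nn_integral_sum) measurable
    also have "\<dots> = (\<Sum>j\<in>?J. \<integral>\<^sup>+x. ennreal (w j x) * \<phi> (atom y z x j) \<partial>P)"
      by (intro sum.cong refl nnw[OF \<phi>a])
    also have "\<dots> = (\<integral>\<^sup>+x. (\<Sum>j\<in>?J. ennreal (w j x) * \<phi> (atom y z x j)) \<partial>P)"
      using wm \<phi>a setsP
      by (intro nn_integral_sum[symmetric] borel_measurable_times_ennreal) (auto cong: measurable_cong_sets)
    finally show ?thesis .
  qed
  \<comment> \<open>The sum of the densities and the constant 1 are both densities of
    \<open>P\<close> with respect to itself, so they agree almost everywhere.\<close>
  have sumw: "AE x in P. (\<Sum>j\<in>?J. ennreal (w j x)) = 1"
  proof (rule P.density_unique)
    have "emeasure (density P (\<lambda>x. \<Sum>j\<in>?J. ennreal (w j x))) A = emeasure P A" if A: "A \<in> sets P" for A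
    proof -
      have Ab: "A \<in> sets borel" using A setsP by simp
      have "emeasure P A = (\<integral>\<^sup>+\<omega>. indicator {\<omega>. fst (fst \<omega>) \<in> A} \<omega> \<partial>\<pi>)"
        using fst\<pi>[OF Ab] fstA[OF Ab] set\<pi> by (subst nn_integral_indicator) auto
      also have "\<dots> = (\<integral>\<^sup>+x. (\<Sum>j\<in>?J. ennreal (w j x) * indicator {\<omega>. fst (fst \<omega>) \<in> A} (atom y z x j)) \<partial>P)"
        using fstA[OF Ab] by (intro key) auto
      also have "\<dots> = (\<integral>\<^sup>+x. (\<Sum>j\<in>?J. ennreal (w j x)) * indicator A x \<partial>P)"
        by (intro nn_integral_cong) (auto simp: atom_def indicator_def)
      finally show ?thesis using A wm by (simp add: emeasure_density)
    qed
    then show "density P (\<lambda>x. \<Sum>j\<in>?J. ennreal (w j x)) = density P (\<lambda>x. 1)"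
      by (intro measure_eqI) (auto simp: emeasure_density)
  qed (use wm in auto)
  have "w \<in> weights P ?J" unfolding weights_def mem_Collect_eq
  proof
    show "AE x in P. (\<forall>j\<in>?J. 0 \<le> w j x) \<and> (\<Sum>j\<in>?J. w j x) = 1"
      using sumw
    proof eventually_elim
      case (elim x)
      have "ennreal (\<Sum>j\<in>?J. w j x) = 1"
        by (rule trans[OF sum_ennreal[OF w(2), symmetric] elim])
      then show ?case using w(2) by simp
    qed
  qed (use w(1) in blast)
  moreover have "represents P ?J y z w \<pi>"
    unfolding represents_def using set\<pi> key by blast
  moreover have "(\<integral>\<^sup>+x. (\<Sum>k=1..NY. ennreal (w (k, i) x)) \<partial>P) = ennreal (1 / real Nl)"
    if i: "i \<in> {1..Nl}" for i
  proof -
    have "(\<integral>\<^sup>+x. (\<Sum>k=1..NY. ennreal (w (k, i) x)) \<partial>P) = (\<Sum>k=1..NY. \<integral>\<^sup>+x. ennreal (w (k, i) x) \<partial>P)"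
      using wm i by (intro nn_integral_sum) auto
    also have "\<dots> = (\<Sum>k=1..NY. \<integral>\<^sup>+\<omega>. wt (k, i) \<omega> \<partial>\<pi>)"
      using nnw[of "\<lambda>_. 1" "(_, i)"] i by (intro sum.cong refl) auto
    also have "\<dots> = (\<integral>\<^sup>+\<omega>. (\<Sum>k=1..NY. wt (k, i) \<omega>) \<partial>\<pi>)"
      by (intro nn_integral_sum[symmetric]) measurable
    also have "\<dots> = (\<integral>\<^sup>+\<omega>. ennreal (1 / real (m i)) * indicator (snd -` {z i} \<inter> space \<pi>) \<omega> \<partial>\<pi>)"
      unfolding sum_k by (intro nn_integral_cong) (auto simp: indicator_def sp\<pi>)
    also have "\<dots> = ennreal (1 / real (m i)) * emeasure \<pi> (snd -` {z i} \<inter> space \<pi>)"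
      by (intro nn_integral_cmult_indicator measurable_sets) measurable
    also have "emeasure \<pi> (snd -` {z i} \<inter> space \<pi>) = emeasure (empirical Nl z) {z i}"
      by (rule distr_eq_emeasure[OF d2, symmetric]) auto
    also have "\<dots> = of_nat (m i) * ennreal (1 / real Nl)"
      by (subst emeasure_empirical_vimage) (auto simp: m_def)
    also have "ennreal (1 / real (m i)) * \<dots> = ennreal (1 / real Nl)"
      using m[OF i] by (simp add: ennreal_of_nat_eq_real_of_nat ennreal_mult[symmetric])
    finally show ?thesis .
  qed
  ultimately show ?thesis using that by blast
qed

section \<open>The ambiguity set in terms of weights\<close>

text \<open>Compactness and semicontinuity are condensed into measurability and the upper bounds
  \<open>Cc\<close> and \<open>CL\<close>; the parameter \<open>\<theta>\<close> is fixed inside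
  \<open>L\<close>.\<close>

locale transport_ambiguity =
  fixes P :: "('x::polish_space) measure" and NY Nl :: nat
    and y :: "nat \<Rightarrow> 'y::{polish_space, discrete_topology}" and z :: "nat \<Rightarrow> 'x \<times> 'y"
    and plo phi :: "nat \<Rightarrow> real" and c :: "('x \<times> 'y) \<times> ('x \<times> 'y) \<Rightarrow> real" and \<epsilon> Cc :: real
    and L :: "'x \<times> 'y \<Rightarrow> real" and CL :: real
  assumes P: "P \<in> prob_measures" and y: "bij_betw y {1..NY} UNIV" and Nl: "1 \<le> Nl"
    and bounds: "\<And>k. k \<in> {1..NY} \<Longrightarrow> 0 \<le> plo k \<and> plo k \<le> phi k"
    and \<epsilon>: "0 \<le> \<epsilon>"
    and c0: "\<And>\<omega>. 0 \<le> c \<omega>" and cC: "\<And>\<omega>. c \<omega> \<le> Cc" and c_meas: "c \<in> borel_measurable borel"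
    and L_meas: "L \<in> borel_measurable borel" and LC: "\<And>\<omega>. L \<omega> \<le> CL"
begin

definition J :: "(nat \<times> nat) set" where "J = {1..NY} \<times> {1..Nl}"
abbreviation "W \<equiv> weights P J"
abbreviation "mean \<equiv> avg P J"
abbreviation "\<nu> \<equiv> empirical Nl z"
abbreviation "S \<equiv> ambiguity_set P NY y plo phi c \<epsilon> \<nu>"

definition cost :: "nat \<times> nat \<Rightarrow> 'x \<Rightarrow> real" where
  "cost j x = c ((x, y (fst j)), z (snd j))"

abbreviation on_label :: "nat \<Rightarrow> nat \<times> nat \<Rightarrow> 'x \<Rightarrow> real" where
  "on_label \<equiv> hits fst"

abbreviation on_sample :: "nat \<Rightarrow> nat \<times> nat \<Rightarrow> 'x \<Rightarrow> real" where
  "on_sample \<equiv> hits snd"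

text \<open>The slack \<open>\<eta>\<close> relaxes only the transport budget: the marginals of a
  coupling are exact, whereas its cost may merely approach the Wasserstein distance.\<close>

definition admissible :: "real \<Rightarrow> (nat \<times> nat \<Rightarrow> 'x \<Rightarrow> real) set" where
  "admissible \<eta> = {w \<in> W. mean w cost \<le> \<epsilon> + \<eta> \<and>
     (\<forall>i\<in>{1..Nl}. mean w (on_sample i) = 1 / real Nl) \<and>
     (\<forall>k\<in>{1..NY}. plo k \<le> mean w (on_label k) \<and> mean w (on_label k) \<le> phi k)}"

definition payoff :: "(nat \<times> nat \<Rightarrow> 'x \<Rightarrow> real) \<Rightarrow> ereal" where
  "payoff w = ext_integral P (\<lambda>x. \<Sum>j\<in>J. w j x * L (x, y (fst j)))"

lemma sets_P: "sets P = sets borel"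
  using P by (auto simp: prob_measures_def space_prob_algebra)

lemma space_P: "space P = UNIV"
  using sets_eq_imp_space_eq[OF sets_P] by simp

sublocale P: prob_space P
  using P by (auto simp: prob_measures_def space_prob_algebra)

lemma measurable_P: "borel_measurable P = borel_measurable borel"
  by (intro measurable_cong_sets sets_P) simp

lemma NY: "1 \<le> NY"
  using bij_betw_imp_surj_on[OF y] by (cases NY) auto

lemma J_fin: "finite J" by (simp add: J_def)

lemma J_ne: "J \<noteq> {}" using NY Nl by (auto simp: J_def not_less)

lemma J_fst: "j \<in> J \<Longrightarrow> fst j \<in> {1..NY}"
  and J_snd: "j \<in> J \<Longrightarrow> snd j \<in> {1..Nl}"
  by (auto simp: J_def)

lemma sum_J: "(\<Sum>j\<in>J. f j) = (\<Sum>k=1..NY. \<Sum>i=1..Nl. f (k, i))"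
  by (simp add: J_def sum.cartesian_product split_def)

lemma atom_cost: "cost j x = c (atom y z x j)"
  by (simp add: cost_def atom_def)

lemma cost_meas: "cost j \<in> borel_measurable P"
proof -
  have "(\<lambda>x. c (atom y z x j)) \<in> borel_measurable borel"
    by (rule measurable_compose[OF atom_measurable c_meas])
  then show ?thesis by (simp add: measurable_P atom_cost[abs_def])
qed

lemma loss_meas: "(\<lambda>x. L (x, y k)) \<in> borel_measurable P"
proof -
  have "(\<lambda>x. (x, y k)) \<in> borel \<rightarrow>\<^sub>M (borel :: ('x \<times> 'y) measure)"
    by (intro borel_measurable_continuous_onI continuous_intros)
  from measurable_compose[OF this L_meas] show ?thesis by (simp add: measurable_P)
qed

lemma cost_bounded: "bounded_family P J cost"
proof -
  have "\<bar>cost j x\<bar> \<le> Cc" for j x using c0 cC by (simp add: cost_def abs_of_nonneg)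
  then show ?thesis unfolding bounded_family_def using cost_meas by blast
qed

lemma transport_cost_represents:
  assumes "w \<in> W" "represents P J y z w \<pi>"
  shows "transport_cost c \<pi> = ennreal (mean w cost)"
proof -
  have "transport_cost c \<pi> = (\<integral>\<^sup>+x. (\<Sum>j\<in>J. ennreal (w j x) * ennreal (cost j x)) \<partial>P)"
    unfolding transport_cost_def atom_cost using c_meas by (intro representsD[OF assms(2)]) simp
  also have "\<dots> = ennreal (mean w cost)"
    by (intro P.ennreal_avg[symmetric] assms(1) cost_bounded J_fin) (simp add: cost_def c0)
  finally show ?thesis .
qed

lemma represents_label:
  assumes w: "w \<in> W" and r: "represents P J y z w \<pi>" and \<mu>: "distr \<pi> borel fst = \<mu>"
  shows "emeasure \<mu> (UNIV \<times> B) = ennreal (\<Sum>k\<in>{k\<in>{1..NY}. y k \<in> B}. mean w (on_label k))"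
proof -
  have s: "sets \<pi> = sets borel" using r by (simp add: represents_def)
  have "open (UNIV \<times> B :: ('x \<times> 'y) set)" by (rule open_Times[OF open_UNIV discrete_topology_class.open_discrete])
  then have B: "UNIV \<times> B \<in> sets (borel :: ('x \<times> 'y) measure)" by simp
  have fm: "fst \<in> (borel :: (('x \<times> 'y) \<times> ('x \<times> 'y)) measure) \<rightarrow>\<^sub>M borel"
    by (intro borel_measurable_continuous_onI continuous_intros)
  then have "fst \<in> \<pi> \<rightarrow>\<^sub>M (borel :: ('x \<times> 'y) measure)" using measurable_cong_sets[OF s refl] by blast
  then have "emeasure \<mu> (UNIV \<times> B) = emeasure \<pi> (fst -` (UNIV \<times> B) \<inter> space \<pi>)"
    by (intro distr_eq_emeasure[OF \<mu>] B)
  also have "\<dots> = (\<integral>\<^sup>+\<omega>. indicator (fst -` (UNIV \<times> B)) \<omega> \<partial>\<pi>)"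
  proof (subst nn_integral_indicator)
    show "fst -` (UNIV \<times> B) \<in> sets \<pi>" using measurable_sets[OF fm B] s by simp
    have "space \<pi> = UNIV" using sets_eq_imp_space_eq[OF s] by simp
    then show "emeasure \<pi> (fst -` (UNIV \<times> B) \<inter> space \<pi>) = emeasure \<pi> (fst -` (UNIV \<times> B))" by simp
  qed
  also have "\<dots> = (\<integral>\<^sup>+x. (\<Sum>j\<in>J. ennreal (w j x) * indicator (fst -` (UNIV \<times> B)) (atom y z x j)) \<partial>P)"
    using measurable_sets[OF fm B] by (intro representsD[OF r]) simp
  also have "\<dots> = (\<integral>\<^sup>+x. (\<Sum>j\<in>J. ennreal (w j x) * indicator {k\<in>{1..NY}. y k \<in> B} (fst j)) \<partial>P)"
    by (intro nn_integral_cong sum.cong refl arg_cong2[where f="times"])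
      (use J_fst in \<open>simp add: atom_def indicator_def\<close>)
  also have "\<dots> = ennreal (\<Sum>k\<in>{k\<in>{1..NY}. y k \<in> B}. mean w (on_label k))"
    by (rule P.ennreal_avg_hits[OF J_fin w, symmetric]) simp
  finally show ?thesis .
qed

text \<open>The loss may have integral -\<infinity>, so the change of variables is carried out for
  the nonnegative function \<open>C - L\<close> and translated back.\<close>

lemma represents_payoff:
  assumes w: "w \<in> W" and r: "represents P J y z w \<pi>" and \<mu>: "distr \<pi> borel fst = \<mu>"
    and pr: "prob_space \<mu>"
  shows "ext_integral \<mu> L = payoff w"
proof -
  interpret \<mu>: prob_space \<mu> by fact
  define C where "C = max 0 CL"
  have LC': "L \<omega> \<le> C" for \<omega> using LC[of \<omega>] by (simp add: C_def)
  have s: "sets \<pi> = sets borel" using r by (simp add: represents_def)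
  have fm: "fst \<in> (borel :: (('x \<times> 'y) \<times> ('x \<times> 'y)) measure) \<rightarrow>\<^sub>M borel"
    by (intro borel_measurable_continuous_onI continuous_intros)
  then have fm\<pi>: "fst \<in> \<pi> \<rightarrow>\<^sub>M (borel :: ('x \<times> 'y) measure)" using measurable_cong_sets[OF s refl] by blast
  have s\<mu>: "sets \<mu> = sets borel" using \<mu> by auto
  have "ext_integral \<mu> L = ereal C - enn2ereal (\<integral>\<^sup>+\<omega>. ennreal (C - L \<omega>) \<partial>\<mu>)"
    using LC' L_meas measurable_cong_sets[OF s\<mu> refl]
    by (intro \<mu>.ext_integral_bounded_above) (auto simp: C_def)
  also have "(\<integral>\<^sup>+\<omega>. ennreal (C - L \<omega>) \<partial>\<mu>) = (\<integral>\<^sup>+\<omega>. ennreal (C - L (fst \<omega>)) \<partial>\<pi>)"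
    unfolding \<mu>[symmetric] using L_meas by (intro nn_integral_distr fm\<pi>) simp
  also have "\<dots> = (\<integral>\<^sup>+x. (\<Sum>j\<in>J. ennreal (w j x) * ennreal (C - L (fst (atom y z x j)))) \<partial>P)"
  proof (rule representsD[OF r])
    show "(\<lambda>\<omega> :: ('x \<times> 'y) \<times> ('x \<times> 'y). ennreal (C - L (fst \<omega>))) \<in> borel_measurable borel"
      by (intro measurable_compose[OF _ measurable_ennreal] borel_measurable_diff
          borel_measurable_const measurable_compose[OF fm L_meas])
  qed
  also have "\<dots> = (\<integral>\<^sup>+x. ennreal (C - (\<Sum>j\<in>J. w j x * L (x, y (fst j)))) \<partial>P)"
  proof (rule nn_integral_cong_AE)
    show "AE x in P. (\<Sum>j\<in>J. ennreal (w j x) * ennreal (C - L (fst (atom y z x j)))) =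
      ennreal (C - (\<Sum>j\<in>J. w j x * L (x, y (fst j))))"
      using weights_AE[OF w J_fin]
    proof eventually_elim
      case (elim x)
      have "(\<Sum>j\<in>J. ennreal (w j x) * ennreal (C - L (fst (atom y z x j)))) =
        (\<Sum>j\<in>J. ennreal (w j x * (C - L (x, y (fst j)))))"
        using elim LC' by (intro sum.cong refl) (simp add: atom_def ennreal_mult)
      also have "\<dots> = ennreal (\<Sum>j\<in>J. w j x * (C - L (x, y (fst j))))"
        using elim LC' by (intro sum_ennreal) simp
      also have "(\<Sum>j\<in>J. w j x * (C - L (x, y (fst j)))) =
        (\<Sum>j\<in>J. w j x) * C - (\<Sum>j\<in>J. w j x * L (x, y (fst j)))"
        by (simp only: right_diff_distrib sum_subtractf sum_distrib_right)
      finally show ?case using elim by simp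
    qed
  qed
  also have "ereal C - enn2ereal \<dots> = payoff w"
    unfolding payoff_def
  proof (rule P.ext_integral_bounded_above[symmetric])
    show "(\<lambda>x. \<Sum>j\<in>J. w j x * L (x, y (fst j))) \<in> borel_measurable P"
      using weights_measurable[OF w] loss_meas by (intro borel_measurable_sum borel_measurable_times) auto
    show "AE x in P. (\<Sum>j\<in>J. w j x * L (x, y (fst j))) \<le> C"
      by (rule weights_AE_le[OF w J_fin LC'])
  qed (simp add: C_def)
  finally show ?thesis .
qed

text \<open>Gathers what the two problems see of a coupling: its cost, its sample and label masses,
  and the payoff of its first marginal.\<close>

lemma coupling_weights:
  assumes \<mu>: "\<mu> \<in> marginal_set P NY y plo phi" and \<pi>: "\<pi> \<in> couplings \<mu> \<nu>"
  obtains w where "w \<in> W" "transport_cost c \<pi> = ennreal (mean w cost)"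
    "\<And>i. i \<in> {1..Nl} \<Longrightarrow> mean w (on_sample i) = 1 / real Nl"
    "\<And>k. k \<in> {1..NY} \<Longrightarrow> emeasure \<mu> (UNIV \<times> {y k}) = ennreal (mean w (on_label k))"
    "\<And>k. k \<in> {1..NY} \<Longrightarrow> plo k \<le> mean w (on_label k) \<and> mean w (on_label k) \<le> phi k"
    "ext_integral \<mu> L = payoff w"
proof -
  have marg: "emeasure \<mu> (A \<times> UNIV) = emeasure P A" if "A \<in> sets borel" for A
    using \<mu> that by (auto simp: marginal_set_def)
  obtain w where w: "w \<in> W" and r: "represents P J y z w \<pi>"
    and s: "\<And>i. i \<in> {1..Nl} \<Longrightarrow> (\<integral>\<^sup>+x. (\<Sum>k=1..NY. ennreal (w (k, i) x)) \<partial>P) = ennreal (1 / real Nl)"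
    using coupling_to_weights[OF P y Nl \<pi> marg] unfolding J_def by blast
  have d: "distr \<pi> borel fst = \<mu>" using \<pi> by (simp add: couplings_def)
  have nonneg: "0 \<le> mean w (on_label k)" for k
    unfolding avg_def
    by (rule integral_nonneg_AE, use weights_AE[OF w J_fin] in eventually_elim)
      (auto simp: hits_def intro!: sum_nonneg)
  have sample: "mean w (on_sample i) = 1 / real Nl" if i: "i \<in> {1..Nl}" for i
  proof -
    have "ennreal (mean w (on_sample i)) = (\<integral>\<^sup>+x. (\<Sum>j\<in>J. ennreal (w j x) * ennreal (on_sample i j x)) \<partial>P)"
      by (intro P.ennreal_avg w hits_bounded J_fin) (simp add: hits_def)
    also have "\<dots> = (\<integral>\<^sup>+x. (\<Sum>k=1..NY. ennreal (w (k, i) x)) \<partial>P)"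
    proof (intro nn_integral_cong)
      fix x
      have "(\<Sum>j\<in>J. ennreal (w j x) * ennreal (on_sample i j x)) =
        (\<Sum>k=1..NY. \<Sum>i'=1..Nl. if i' = i then ennreal (w (k, i') x) else 0)"
        by (simp only: sum_J) (intro sum.cong refl, simp add: hits_def)
      also have "\<dots> = (\<Sum>k=1..NY. ennreal (w (k, i) x))"
        using i by (intro sum.cong refl) simp
      finally show "(\<Sum>j\<in>J. ennreal (w j x) * ennreal (on_sample i j x)) = (\<Sum>k=1..NY. ennreal (w (k, i) x))" .
    qed
    also have "\<dots> = ennreal (1 / real Nl)" by (rule s[OF i])
    finally have "ennreal (mean w (on_sample i)) = ennreal (1 / real Nl)" .
    \<comment> \<open>\<open>ennreal\<close> collapses negative numbers to 0, so equality of the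
      reals uses that this value is positive.\<close>
    moreover have "1 / real Nl > 0" using Nl by simp
    ultimately show ?thesis by (metis ennreal_eq_0_iff ennreal_inj less_le not_le nle_le)
  qed
  have label: "emeasure \<mu> (UNIV \<times> {y k}) = ennreal (mean w (on_label k))" and
    Bk: "{k'\<in>{1..NY}. y k' \<in> {y k}} = {k}" if k: "k \<in> {1..NY}" for k
  proof -
    show *: "{k'\<in>{1..NY}. y k' \<in> {y k}} = {k}"
      using k inj_on_eq_iff[OF bij_betw_imp_inj_on[OF y]] by blast
    show "emeasure \<mu> (UNIV \<times> {y k}) = ennreal (mean w (on_label k))"
      using represents_label[OF w r d, of "{y k}"] unfolding * by simp
  qed
  have bnd: "plo k \<le> mean w (on_label k) \<and> mean w (on_label k) \<le> phi k" if k: "k \<in> {1..NY}" for k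
  proof -
    have "ennreal (\<Sum>k\<in>{k'\<in>{1..NY}. y k' \<in> {y k}}. plo k) \<le> emeasure \<mu> (UNIV \<times> {y k}) \<and>
      emeasure \<mu> (UNIV \<times> {y k}) \<le> ennreal (\<Sum>k\<in>{k'\<in>{1..NY}. y k' \<in> {y k}}. phi k)"
      using \<mu> unfolding marginal_set_def by blast
    then show ?thesis unfolding Bk[OF k] label[OF k] using nonneg[of k] bounds[OF k]
      by (simp add: ennreal_le_iff)
  qed
  have "prob_space \<mu>"
  proof
    have "sets \<mu> = sets borel" using d by auto
    then have "space \<mu> = UNIV \<times> UNIV" using sets_eq_imp_space_eq[of \<mu> borel] by simp
    then show "emeasure \<mu> (space \<mu>) = 1"
      using marg[of UNIV] P.emeasure_space_1 by (simp add: space_P)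
  qed
  then show ?thesis
    using that[OF w transport_cost_represents[OF w r] sample label bnd represents_payoff[OF w r d]] by blast
qed

text \<open>The infimum defining the distance is not known to be attained, so a coupling of cost
  below \<open>\<epsilon> + \<eta>\<close> is taken instead of an optimal one.\<close>

lemma admissible_of_ambiguity:
  assumes \<mu>: "\<mu> \<in> S" and \<eta>: "0 < \<eta>"
  obtains w where "w \<in> admissible \<eta>" "ext_integral \<mu> L = payoff w"
proof -
  have m: "\<mu> \<in> marginal_set P NY y plo phi" and "wasserstein c \<mu> \<nu> \<le> ennreal \<epsilon>"
    using \<mu> by (auto simp: ambiguity_set_def wasserstein_ball_def)
  moreover have "ennreal \<epsilon> < ennreal (\<epsilon> + \<eta>)" using \<epsilon> \<eta> by (simp add: ennreal_less_iff)
  ultimately have "(INF \<pi>\<in>couplings \<mu> \<nu>. transport_cost c \<pi>) < ennreal (\<epsilon> + \<eta>)"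
    by (simp add: wasserstein_def)
  then obtain \<pi> where \<pi>: "\<pi> \<in> couplings \<mu> \<nu>" "transport_cost c \<pi> < ennreal (\<epsilon> + \<eta>)"
    by (auto simp: INF_less_iff)
  obtain w where w: "w \<in> W" "transport_cost c \<pi> = ennreal (mean w cost)"
    "\<And>i. i \<in> {1..Nl} \<Longrightarrow> mean w (on_sample i) = 1 / real Nl"
    "\<And>k. k \<in> {1..NY} \<Longrightarrow> plo k \<le> mean w (on_label k) \<and> mean w (on_label k) \<le> phi k"
    "ext_integral \<mu> L = payoff w"
    by (rule coupling_weights[OF m \<pi>(1)]) (rule that)
  have "mean w cost \<le> \<epsilon> + \<eta>"
  proof (rule ccontr)
    assume "\<not> mean w cost \<le> \<epsilon> + \<eta>"
    then have "ennreal (\<epsilon> + \<eta>) \<le> transport_cost c \<pi>" unfolding w(2) by (intro ennreal_leI) simp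
    with \<pi>(2) show False by simp
  qed
  then have "w \<in> admissible \<eta>" unfolding admissible_def using w(1,3,4) by blast
  then show ?thesis using w(5) by (rule that)
qed

text \<open>Inverse construction to \<open>coupling_to_weights\<close>: the mass
  \<open>w j x\<close> is placed at \<open>atom y z x j\<close>. That the weights add up to 1 gives
  the marginal \<open>P\<close>, and the prescribed sample masses give the empirical
  marginal.\<close>

lemma exists_coupling_of_weights:
  assumes w: "w \<in> W"
    and s: "\<And>i. i \<in> {1..Nl} \<Longrightarrow> mean w (on_sample i) = 1 / real Nl"
  obtains \<pi> where "\<pi> \<in> couplings (distr \<pi> borel fst) \<nu>" "represents P J y z w \<pi>"
    "\<And>A. A \<in> sets borel \<Longrightarrow> emeasure (distr \<pi> borel fst) (A \<times> UNIV) = emeasure P A"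
    "distr \<pi> borel fst \<in> radon_measures" "distr \<pi> borel fst \<in> prob_measures"
proof -
  let ?Q = "count_space J \<Otimes>\<^sub>M P"
  have cJ: "countable J" using J_fin by (rule countable_finite)
  define d where "d = (\<lambda>(j, x). ennreal (w j x))"
  define T :: "(nat \<times> nat) \<times> 'x \<Rightarrow> ('x \<times> 'y) \<times> ('x \<times> 'y)" where "T = (\<lambda>(j, x). atom y z x j)"
  define \<pi> where "\<pi> = distr (density ?Q d) borel T"
  have atomP: "(\<lambda>x. atom y z x j) \<in> P \<rightarrow>\<^sub>M borel" for j
    using atom_measurable[of y z j] measurable_cong_sets[OF sets_P refl] by blast
  have dm: "d \<in> borel_measurable ?Q" unfolding d_def
    using weights_measurable[OF w] by (intro measurable_pair_measure_countable1 cJ) simp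
  have Tm: "T \<in> ?Q \<rightarrow>\<^sub>M borel" unfolding T_def
    using atomP by (intro measurable_pair_measure_countable1 cJ) simp
  have rep: "represents P J y z w \<pi>" unfolding represents_def
  proof (intro conjI ballI)
    fix \<phi> :: "('x \<times> 'y) \<times> ('x \<times> 'y) \<Rightarrow> ennreal" assume \<phi>: "\<phi> \<in> borel_measurable borel"
    have \<phi>T: "(\<lambda>q. \<phi> (T q)) \<in> borel_measurable ?Q" by (rule measurable_compose[OF Tm \<phi>])
    have "(\<integral>\<^sup>+\<omega>. \<phi> \<omega> \<partial>\<pi>) = (\<integral>\<^sup>+q. d q * \<phi> (T q) \<partial>?Q)"
      unfolding \<pi>_def using Tm dm \<phi> \<phi>T by (simp add: nn_integral_distr nn_integral_density)
    also have "\<dots> = (\<integral>\<^sup>+j. (\<integral>\<^sup>+x. d (j, x) * \<phi> (T (j, x)) \<partial>P) \<partial>count_space J)"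
      using dm \<phi>T by (intro P.nn_integral_fst[symmetric]) simp
    also have "\<dots> = (\<Sum>j\<in>J. \<integral>\<^sup>+x. ennreal (w j x) * \<phi> (atom y z x j) \<partial>P)"
      by (simp add: nn_integral_count_space_finite[OF J_fin] d_def T_def)
    also have "\<dots> = (\<integral>\<^sup>+x. (\<Sum>j\<in>J. ennreal (w j x) * \<phi> (atom y z x j)) \<partial>P)"
      using weights_measurable[OF w] measurable_compose[OF atomP \<phi>]
      by (intro nn_integral_sum[symmetric]) simp
    finally show "(\<integral>\<^sup>+\<omega>. \<phi> \<omega> \<partial>\<pi>) = (\<integral>\<^sup>+x. (\<Sum>j\<in>J. ennreal (w j x) * \<phi> (atom y z x j)) \<partial>P)" .
  qed (simp add: \<pi>_def)
  have s\<pi>: "sets \<pi> = sets borel" by (simp add: \<pi>_def)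
  have sp\<pi>: "space \<pi> = UNIV" using sets_eq_imp_space_eq[OF s\<pi>] by simp
  note sumw = sum_ennreal_weights[OF w J_fin]
  have em: "emeasure \<pi> B = (\<integral>\<^sup>+x. (\<Sum>j\<in>J. ennreal (w j x) * indicator B (atom y z x j)) \<partial>P)"
    if "B \<in> sets borel" for B
    using representsD[OF rep, of "indicator B"] that s\<pi> by simp
  have fm: "fst \<in> (borel :: (('x \<times> 'y) \<times> ('x \<times> 'y)) measure) \<rightarrow>\<^sub>M borel"
    and sm: "snd \<in> (borel :: (('x \<times> 'y) \<times> ('x \<times> 'y)) measure) \<rightarrow>\<^sub>M borel"
    by (intro borel_measurable_continuous_onI continuous_intros)+
  then have fm\<pi>: "fst \<in> \<pi> \<rightarrow>\<^sub>M (borel :: ('x \<times> 'y) measure)"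
    and sm\<pi>: "snd \<in> \<pi> \<rightarrow>\<^sub>M (borel :: ('x \<times> 'y) measure)"
    by (simp_all add: measurable_cong_sets[OF s\<pi> refl])
  have "(\<integral>\<^sup>+x. (\<Sum>j\<in>J. ennreal (w j x) * indicator UNIV (atom y z x j)) \<partial>P) = (\<integral>\<^sup>+x. 1 \<partial>P)"
    by (rule nn_integral_cong_AE, use sumw in eventually_elim) simp
  then have em1: "emeasure \<pi> (space \<pi>) = 1"
    using em[of UNIV] P.emeasure_space_1 by (simp add: sp\<pi>)
  have radon: "\<pi> \<in> radon_measures" by (rule radon_measures_finite[OF s\<pi>]) (simp add: em1)
  let ?\<mu> = "distr \<pi> borel fst"
  have p\<mu>: "prob_space ?\<mu>"
    by (rule prob_space.prob_space_distr[OF prob_spaceI[OF em1] fm\<pi>])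
  have "?\<mu> \<in> prob_measures" using p\<mu> by (simp add: prob_measures_def space_prob_algebra)
  moreover have "?\<mu> \<in> radon_measures"
    using prob_space.emeasure_space_1[OF p\<mu>] by (intro radon_measures_finite) simp_all
  moreover have "emeasure ?\<mu> (A \<times> UNIV) = emeasure P A" if A: "A \<in> sets borel" for A
  proof -
    have AU: "A \<times> UNIV \<in> sets (borel :: ('x \<times> 'y) measure)" using A by (intro borel_Times) simp_all
    have "emeasure ?\<mu> (A \<times> UNIV) = emeasure \<pi> (fst -` (A \<times> UNIV))"
      using AU fm\<pi> by (subst emeasure_distr) (auto simp: sp\<pi>)
    also have "\<dots> = (\<integral>\<^sup>+x. (\<Sum>j\<in>J. ennreal (w j x) * indicator (fst -` (A \<times> UNIV)) (atom y z x j)) \<partial>P)"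
      using measurable_sets[OF fm AU] by (intro em) simp
    also have "\<dots> = (\<integral>\<^sup>+x. indicator A x \<partial>P)"
    proof (rule nn_integral_cong_AE)
      show "AE x in P. (\<Sum>j\<in>J. ennreal (w j x) * indicator (fst -` (A \<times> UNIV)) (atom y z x j)) = indicator A x"
        using sumw
      proof eventually_elim
        case (elim x)
        have "(\<Sum>j\<in>J. ennreal (w j x) * indicator (fst -` (A \<times> UNIV)) (atom y z x j)) =
          (\<Sum>j\<in>J. ennreal (w j x)) * indicator A x"
          by (subst sum_distrib_right) (intro sum.cong refl, simp add: atom_def indicator_def)
        then show ?case using elim by simp
      qed
    qed
    also have "\<dots> = emeasure P A" using A by (simp add: sets_P)
    finally show ?thesis .
  qed
  moreover have "distr \<pi> borel snd = \<nu>"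
  proof (rule measure_eqI)
    show "sets (distr \<pi> borel snd) = sets \<nu>"
      by (simp add: empirical_def sets.sigma_sets_eq[of borel, simplified])
    fix A assume "A \<in> sets (distr \<pi> borel snd)"
    then have A: "A \<in> sets borel" by simp
    have "emeasure (distr \<pi> borel snd) A = emeasure \<pi> (snd -` A)"
      using A sm\<pi> by (subst emeasure_distr) (auto simp: sp\<pi>)
    also have "\<dots> = (\<integral>\<^sup>+x. (\<Sum>j\<in>J. ennreal (w j x) * indicator (snd -` A) (atom y z x j)) \<partial>P)"
      using measurable_sets[OF sm A] by (intro em) simp
    also have "\<dots> = (\<integral>\<^sup>+x. (\<Sum>j\<in>J. ennreal (w j x) * indicator {i\<in>{1..Nl}. z i \<in> A} (snd j)) \<partial>P)"
      by (intro nn_integral_cong sum.cong refl arg_cong2[where f="times"])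
        (use J_snd in \<open>simp add: atom_def indicator_def\<close>)
    also have "\<dots> = ennreal (\<Sum>i\<in>{i\<in>{1..Nl}. z i \<in> A}. mean w (on_sample i))"
      by (rule P.ennreal_avg_hits[OF J_fin w, symmetric]) simp
    also have "(\<Sum>i\<in>{i\<in>{1..Nl}. z i \<in> A}. mean w (on_sample i))
        = real (card {i\<in>{1..Nl}. z i \<in> A}) * (1 / real Nl)"
      using s by simp
    also have "ennreal \<dots> = of_nat (card {i\<in>{1..Nl}. z i \<in> A}) * ennreal (1 / real Nl)"
      by (subst ennreal_mult) (simp_all add: ennreal_of_nat_eq_real_of_nat)
    also have "\<dots> = emeasure \<nu> A" by (rule emeasure_empirical_vimage[OF A, symmetric])
    finally show "emeasure (distr \<pi> borel snd) A = emeasure \<nu> A" .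
  qed
  ultimately show ?thesis using that[of \<pi>] radon rep by (simp add: couplings_def)
qed

lemma ambiguity_of_admissible:
  assumes "w \<in> admissible 0"
  obtains \<mu> where "\<mu> \<in> S" "ext_integral \<mu> L = payoff w"
proof -
  have w: "w \<in> W" and cw: "mean w cost \<le> \<epsilon>"
    and sw: "\<And>i. i \<in> {1..Nl} \<Longrightarrow> mean w (on_sample i) = 1 / real Nl"
    and lw: "\<And>k. k \<in> {1..NY} \<Longrightarrow> plo k \<le> mean w (on_label k) \<and> mean w (on_label k) \<le> phi k"
    using assms by (auto simp: admissible_def)
  obtain \<pi> where \<pi>: "\<pi> \<in> couplings (distr \<pi> borel fst) \<nu>" and r: "represents P J y z w \<pi>"
    and marg: "\<And>A. A \<in> sets borel \<Longrightarrow> emeasure (distr \<pi> borel fst) (A \<times> UNIV) = emeasure P A"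
    and rad: "distr \<pi> borel fst \<in> radon_measures" and pr: "distr \<pi> borel fst \<in> prob_measures"
    using exists_coupling_of_weights[OF w sw] by blast
  let ?\<mu> = "distr \<pi> borel fst"
  have "wasserstein c ?\<mu> \<nu> \<le> transport_cost c \<pi>"
    unfolding wasserstein_def by (intro INF_lower \<pi>)
  also have "\<dots> \<le> ennreal \<epsilon>"
    unfolding transport_cost_represents[OF w r] using cw by (rule ennreal_leI)
  finally have "?\<mu> \<in> wasserstein_ball c \<epsilon> \<nu>" using pr by (simp add: wasserstein_ball_def)
  moreover have "?\<mu> \<in> marginal_set P NY y plo phi"
    unfolding marginal_set_def mem_Collect_eq represents_label[OF w r refl]
    using rad marg lw by (auto intro!: ennreal_leI sum_mono)
  moreover have "prob_space ?\<mu>" using pr by (simp add: prob_measures_def space_prob_algebra)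
  ultimately show ?thesis
    using that[of ?\<mu>] represents_payoff[OF w r refl] by (simp add: ambiguity_set_def)
qed

end

section \<open>Strong duality\<close>

text \<open>Sample masses are constrained from above only. Equality is recovered from the total
  mass, and the separation argument may then treat all constraints as inequalities with nonnegative
  multipliers, although the dual admits every real \<open>\<beta>\<close>.\<close>

datatype constraint = Cost | Sample nat | Upper nat | Lower nat

context prob_space
begin

lemma avg_mono:
  assumes "finite J" "w \<in> weights M J" "bounded_family M J a" "bounded_family M J b"
    "\<And>j x. j \<in> J \<Longrightarrow> x \<in> space M \<Longrightarrow> a j x \<le> b j x"
  shows "avg M J w a \<le> avg M J w b"
  unfolding avg_def
proof (rule integral_mono_AE)
  show "AE x in M. (\<Sum>j\<in>J. w j x * a j x) \<le> (\<Sum>j\<in>J. w j x * b j x)"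
    using weights_AE[OF assms(2,1)] AE_space
    by eventually_elim (use assms(5) in \<open>auto intro!: sum_mono mult_left_mono\<close>)
qed (use integrable_weighted[OF assms(1,2)] assms(3,4) in auto)

end

context transport_ambiguity
begin

definition constraints :: "constraint set" where
  "constraints = insert Cost (Sample ` {1..Nl} \<union> Upper ` {1..NY} \<union> Lower ` {1..NY})"

fun lhs :: "constraint \<Rightarrow> nat \<times> nat \<Rightarrow> 'x \<Rightarrow> real" where
  "lhs Cost = cost"
| "lhs (Sample i) = on_sample i"
| "lhs (Upper k) = on_label k"
| "lhs (Lower k) = (\<lambda>j x. 0 - on_label k j x)"

fun rhs :: "constraint \<Rightarrow> real" where
  "rhs Cost = \<epsilon>"
| "rhs (Sample i) = 1 / real Nl"
| "rhs (Upper k) = phi k"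
| "rhs (Lower k) = - plo k"

definition penalty :: "(constraint \<Rightarrow> real) \<Rightarrow> nat \<times> nat \<Rightarrow> 'x \<Rightarrow> real" where
  "penalty m j x = (\<Sum>r\<in>constraints. m r * lhs r j x)"

definition lin :: "(constraint \<Rightarrow> real) \<Rightarrow> real" where
  "lin m = (\<Sum>r\<in>constraints. m r * rhs r)"

definition loss :: "nat \<times> nat \<Rightarrow> 'x \<Rightarrow> real" where
  "loss j x = L (x, y (fst j))"

definition envelope :: "(constraint \<Rightarrow> real) \<Rightarrow> 'x \<Rightarrow> real" where
  "envelope m x = Max ((\<lambda>j. loss j x - penalty m j x) ` J)"

lemma constraints_fin: "finite constraints" by (simp add: constraints_def)

lemma sum_constraints:
  "(\<Sum>r\<in>constraints. f r) =
    f Cost + (\<Sum>i=1..Nl. f (Sample i)) + (\<Sum>k=1..NY. f (Upper k)) + (\<Sum>k=1..NY. f (Lower k))"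
proof -
  have "(\<Sum>r\<in>constraints. f r) = f Cost + (\<Sum>r\<in>Sample ` {1..Nl} \<union> Upper ` {1..NY} \<union> Lower ` {1..NY}. f r)"
    unfolding constraints_def by (subst sum.insert) auto
  also have "(\<Sum>r\<in>Sample ` {1..Nl} \<union> Upper ` {1..NY} \<union> Lower ` {1..NY}. f r) =
    (\<Sum>r\<in>Sample ` {1..Nl} \<union> Upper ` {1..NY}. f r) + (\<Sum>r\<in>Lower ` {1..NY}. f r)"
    by (rule sum.union_disjoint) auto
  also have "(\<Sum>r\<in>Sample ` {1..Nl} \<union> Upper ` {1..NY}. f r) =
    (\<Sum>r\<in>Sample ` {1..Nl}. f r) + (\<Sum>r\<in>Upper ` {1..NY}. f r)"
    by (rule sum.union_disjoint) auto
  finally show ?thesis by (simp add: sum.reindex inj_on_def add.assoc)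
qed

lemma lhs_bounded: "bounded_family P J (lhs r)"
proof (cases r)
  case (Lower k)
  have "bounded_family P J (\<lambda>j x. 0 - on_label k j x)"
    by (intro P.bounded_family_diff hits_bounded) (auto simp: bounded_family_def)
  then show ?thesis using Lower by simp
qed (auto intro: cost_bounded hits_bounded)

lemma penalty_bounded: "bounded_family P J (penalty m)"
  unfolding penalty_def[abs_def] by (intro P.bounded_family_sum constraints_fin lhs_bounded)

lemma avg_penalty:
  "w \<in> W \<Longrightarrow> mean w (penalty m) = (\<Sum>r\<in>constraints. m r * mean w (lhs r))"
  unfolding penalty_def[abs_def] by (intro P.avg_lincomb J_fin constraints_fin lhs_bounded)

lemma avg_lower:
  assumes "w \<in> W"
  shows "mean w (lhs (Lower k)) = - mean w (on_label k)"
proof -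
  have z: "bounded_family P J (\<lambda>j x. 0)" by (auto simp: bounded_family_def)
  have "mean w (\<lambda>j x. 0 - on_label k j x) = mean w (\<lambda>j x. 0) - mean w (on_label k)"
    by (rule P.avg_diff[OF J_fin assms z hits_bounded])
  moreover have "mean w (\<lambda>j x. 0) = 0" by (simp add: avg_def)
  ultimately show ?thesis by simp
qed

lemma penalty_eq:
  assumes "j \<in> J"
  shows "penalty m j x = m Cost * cost j x + m (Sample (snd j)) + (m (Upper (fst j)) - m (Lower (fst j)))"
proof -
  have "(\<Sum>i=1..Nl. m (Sample i) * on_sample i j x) = (\<Sum>i=1..Nl. if snd j = i then m (Sample i) else 0)"
    by (intro sum.cong refl) (simp add: hits_def)
  moreover have "\<dots> = m (Sample (snd j))" using J_snd[OF assms] by (subst sum.delta') auto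
  moreover have "(\<Sum>k=1..NY. f k * on_label k j x) = f (fst j)" for f :: "nat \<Rightarrow> real"
  proof -
    have "(\<Sum>k=1..NY. f k * on_label k j x) = (\<Sum>k=1..NY. if fst j = k then f k else 0)"
      by (intro sum.cong refl) (simp add: hits_def)
    also have "\<dots> = f (fst j)" using J_fst[OF assms] by (subst sum.delta') auto
    finally show ?thesis .
  qed
  ultimately show ?thesis by (simp add: penalty_def sum_constraints sum_negf)
qed

lemma dual_objective_eq:
  "dual_objective P NY y plo phi c \<epsilon> Nl z L (m Cost, \<lambda>i. m (Sample i), \<lambda>k. m (Upper k), \<lambda>k. m (Lower k)) =
    ereal (lin m) + ext_integral P (envelope m)"
proof -
  have "Max ((\<lambda>(k, i). L (x, y k) - (m Cost * c ((x, y k), z i) + m (Sample i)) - (m (Upper k) - m (Lower k)))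
      ` ({1..NY} \<times> {1..Nl})) = envelope m x" for x
    unfolding envelope_def J_def[symmetric]
    by (intro arg_cong[where f=Max] image_cong refl) (auto simp: penalty_eq loss_def cost_def)
  moreover have "m Cost * \<epsilon> + (1 / real Nl) * (\<Sum>i=1..Nl. m (Sample i))
      + (\<Sum>k=1..NY. m (Upper k) * phi k - m (Lower k) * plo k) = lin m"
    by (simp add: lin_def sum_constraints sum_subtractf sum_negf sum_divide_distrib)
  ultimately show ?thesis by (simp only: dual_objective_def prod.case)
qed

lemma constraint_cases:
  assumes "r \<in> constraints"
  obtains "r = Cost" | i where "i \<in> {1..Nl}" "r = Sample i"
    | k where "k \<in> {1..NY}" "r = Upper k" | k where "k \<in> {1..NY}" "r = Lower k"
  using assms by (auto simp: constraints_def)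

lemma admissible_avg:
  assumes "w \<in> admissible \<eta>" "0 \<le> \<eta>" "r \<in> constraints"
  shows "mean w (lhs r) \<le> rhs r + \<eta>"
  using assms(3)
proof (cases rule: constraint_cases)
  case (4 k)
  have w: "w \<in> W" and "plo k \<le> mean w (on_label k)"
    using assms(1) 4(1) by (auto simp: admissible_def)
  then have "- mean w (on_label k) \<le> - plo k + \<eta>" using assms(2) by linarith
  then show ?thesis unfolding 4(2) avg_lower[OF w] by simp
qed (use assms(1,2) in \<open>auto simp: admissible_def add_increasing2\<close>)

text \<open>The sample masses add up to one, so the inequalities for them are equalities.\<close>

lemma admissible_of_avg:
  assumes w: "w \<in> W" and le: "\<And>r. r \<in> constraints \<Longrightarrow> mean w (lhs r) \<le> rhs r"
  shows "w \<in> admissible 0"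
proof -
  have le': "mean w (on_sample i) \<le> 1 / real Nl" if "i \<in> {1..Nl}" for i
    using le[of "Sample i"] that by (simp add: constraints_def)
  have "(\<Sum>i=1..Nl. mean w (on_sample i)) = 1"
    by (rule P.sum_avg_hits[OF J_fin w _ J_snd]) auto
  then have sum1: "(\<Sum>i=1..Nl. 1 / real Nl - mean w (on_sample i)) = 0"
    using Nl by (simp add: sum_subtractf)
  have "mean w (on_sample i) = 1 / real Nl" if "i \<in> {1..Nl}" for i
    using sum_nonneg_eq_0_iff[of "{1..Nl}" "\<lambda>i. 1 / real Nl - mean w (on_sample i)"] sum1 le' that
    by simp
  moreover have "mean w cost \<le> \<epsilon>" using le[of Cost] by (simp add: constraints_def)
  moreover have "plo k \<le> mean w (on_label k)" if "k \<in> {1..NY}" for k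
    using le[of "Lower k"] avg_lower[OF w, of k] that by (simp add: constraints_def)
  moreover have "mean w (on_label k) \<le> phi k" if "k \<in> {1..NY}" for k
    using le[of "Upper k"] that by (simp add: constraints_def)
  ultimately show ?thesis using w by (simp add: admissible_def)
qed

section \<open>Weak duality\<close>

lemma loss_measurable: "loss j \<in> borel_measurable P"
  unfolding loss_def[abs_def] by (rule loss_meas)

lemma loss_le: "loss j x \<le> CL" by (simp add: loss_def LC)

lemma loss_penalty_measurable: "j \<in> J \<Longrightarrow> (\<lambda>x. loss j x - penalty m j x) \<in> borel_measurable P"
  by (intro borel_measurable_diff loss_measurable bounded_family_measurable[OF penalty_bounded])

lemma envelope_measurable: "envelope m \<in> borel_measurable P"
  unfolding envelope_def[abs_def] by (rule P.Max_measurable_image[OF J_fin loss_penalty_measurable])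

lemma envelope_ge: "j \<in> J \<Longrightarrow> loss j x - penalty m j x \<le> envelope m x"
  unfolding envelope_def using J_fin by (intro Max_ge) auto

lemma envelope_le:
  obtains C where "\<And>x. envelope m x \<le> C"
proof -
  obtain C where C: "\<And>j x. j \<in> J \<Longrightarrow> x \<in> space P \<Longrightarrow> \<bar>penalty m j x\<bar> \<le> C"
    using bounded_familyE[OF penalty_bounded] by metis
  have "envelope m x \<le> CL + C" for x
    unfolding envelope_def
  proof (rule Max.boundedI)
    fix a assume "a \<in> (\<lambda>j. loss j x - penalty m j x) ` J"
    then obtain j where "j \<in> J" "a = loss j x - penalty m j x" by auto
    then show "a \<le> CL + C" using loss_le[of j x] C[of j x] by (simp add: space_P abs_le_iff)
  qed (use J_fin J_ne in auto)
  then show ?thesis by (rule that)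
qed

text \<open>A weighted mean is pointwise at most the maximum. The penalty is moved to the side of
  the envelope, where it is bounded and therefore additive even if the envelope has integral
  -\<infinity>.\<close>

lemma payoff_le:
  assumes w: "w \<in> W"
  shows "payoff w \<le> ext_integral P (envelope m) + ereal (mean w (penalty m))"
proof -
  define h where "h x = (\<Sum>j\<in>J. w j x * penalty m j x)" for x
  obtain C where C: "0 \<le> C" "\<And>j x. j \<in> J \<Longrightarrow> x \<in> space P \<Longrightarrow> \<bar>penalty m j x\<bar> \<le> C"
    using bounded_familyE[OF penalty_bounded] by metis
  obtain D where D: "\<And>x. envelope m x \<le> D" using envelope_le by blast
  have "AE x in P. (\<Sum>j\<in>J. w j x * L (x, y (fst j))) \<le> envelope m x + h x"
    using weights_AE[OF w J_fin]
  proof eventually_elim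
    case (elim x)
    have "(\<Sum>j\<in>J. w j x * L (x, y (fst j))) \<le> (\<Sum>j\<in>J. w j x * (envelope m x + penalty m j x))"
      using elim envelope_ge[of _ x m] by (intro sum_mono mult_left_mono) (auto simp: loss_def diff_le_eq)
    also have "\<dots> = (\<Sum>j\<in>J. w j x) * envelope m x + h x"
      by (simp add: h_def distrib_left sum.distrib sum_distrib_right)
    finally show ?case using elim by simp
  qed
  then have "payoff w \<le> ext_integral P (\<lambda>x. envelope m x + h x)"
    unfolding payoff_def by (rule ext_integral_mono)
  also have "\<dots> = ext_integral P (envelope m) + ereal (\<integral>x. h x \<partial>P)"
  proof (rule P.ext_integral_add_bounded[OF envelope_measurable, where C=D])
    show "h \<in> borel_measurable P" unfolding h_def[abs_def]
      using weights_measurable[OF w] bounded_family_measurable[OF penalty_bounded]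
      by (intro borel_measurable_sum borel_measurable_times) auto
    show "AE x in P. \<bar>h x\<bar> \<le> C"
      using weights_AE[OF w J_fin]
    proof eventually_elim
      case (elim x)
      have "\<bar>h x\<bar> \<le> (\<Sum>j\<in>J. w j x * C)"
        unfolding h_def using elim C(2)[of _ x]
        by (intro order_trans[OF sum_abs] sum_mono) (auto simp: abs_mult space_P intro!: mult_left_mono)
      also have "\<dots> = C" unfolding sum_distrib_right[symmetric] using elim by simp
      finally show ?case .
    qed
  qed (use D in simp)
  finally show ?thesis by (simp add: avg_def h_def)
qed

text \<open>A coupling for the ball may overspend by \<open>\<eta>\<close>; priced by the cost
  multiplier this is an arbitrarily small error.\<close>

lemma weak_duality:
  assumes \<mu>: "\<mu> \<in> S" and m: "0 \<le> m Cost" "\<And>k. k \<in> {1..NY} \<Longrightarrow> 0 \<le> m (Upper k) \<and> 0 \<le> m (Lower k)"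
  shows "ext_integral \<mu> L \<le> ereal (lin m) + ext_integral P (envelope m)"
proof (rule ereal_le_epsilon2)
  fix e :: real assume e: "0 < e"
  \<comment> \<open>The overspending is then worth at most \<open>e\<close>; the summand 1 covers a
    vanishing cost multiplier.\<close>
  define \<eta> where "\<eta> = e / (m Cost + 1)"
  have \<eta>: "0 < \<eta>" "m Cost * \<eta> \<le> e" using e m(1) by (auto simp: \<eta>_def field_simps)
  obtain w where w: "w \<in> admissible \<eta>" "ext_integral \<mu> L = payoff w"
    using admissible_of_ambiguity[OF \<mu> \<eta>(1)] by blast
  have wW: "w \<in> W" using w(1) by (simp add: admissible_def)
  have "(\<Sum>r\<in>constraints. m r * mean w (lhs r)) \<le>
     (\<Sum>r\<in>constraints. m r * rhs r + (if r = Cost then m Cost * \<eta> else 0))"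
  proof (rule sum_mono)
    fix r assume "r \<in> constraints"
    then show "m r * mean w (lhs r) \<le> m r * rhs r + (if r = Cost then m Cost * \<eta> else 0)"
    proof (cases rule: constraint_cases)
      case 1
      have "m Cost * mean w cost \<le> m Cost * (\<epsilon> + \<eta>)"
        using w(1) m(1) by (intro mult_left_mono) (auto simp: admissible_def)
      then show ?thesis using 1 by (simp add: distrib_left)
    next
      \<comment> \<open>The sample masses are exact, so the sign of the multiplier is free.\<close>
      case (2 i)
      then show ?thesis using w(1) by (simp add: admissible_def)
    next
      case (3 k)
      then show ?thesis using w(1) m(2)[of k] by (simp add: admissible_def mult_left_mono)
    next
      case (4 k)
      have "m (Lower k) * plo k \<le> m (Lower k) * mean w (on_label k)"
        using w(1) m(2)[of k] 4 by (intro mult_left_mono) (auto simp: admissible_def)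
      then show ?thesis using 4(2) avg_lower[OF wW, of k] by simp
    qed
  qed
  also have "\<dots> = lin m + m Cost * \<eta>"
    by (simp add: lin_def sum.distrib constraints_fin) (simp add: constraints_def)
  also have "\<dots> \<le> lin m + e" using \<eta>(2) by simp
  finally have le: "mean w (penalty m) \<le> lin m + e"
    by (simp add: avg_penalty[OF wW])
  have "ext_integral \<mu> L \<le> ext_integral P (envelope m) + ereal (mean w (penalty m))"
    unfolding w(2) by (rule payoff_le[OF wW])
  also have "\<dots> \<le> ext_integral P (envelope m) + ereal (lin m + e)"
    using le by (intro add_left_mono) simp
  also have "\<dots> = ereal (lin m) + ext_integral P (envelope m) + ereal e"
    by (cases "ext_integral P (envelope m)") auto
  finally show "ext_integral \<mu> L \<le> ereal (lin m) + ext_integral P (envelope m) + ereal e" .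
qed

text \<open>The separation argument requires a bounded objective, while the loss is bounded only
  from above.\<close>

definition truncated_loss :: "nat \<Rightarrow> nat \<times> nat \<Rightarrow> 'x \<Rightarrow> real" where
  "truncated_loss n j x = max (loss j x) (- real n)"

lemma truncated_loss_bounded: "bounded_family P J (truncated_loss n)"
proof -
  have "truncated_loss n j \<in> borel_measurable P" for j
    unfolding truncated_loss_def[abs_def] using loss_measurable[of j] by simp
  moreover have "\<bar>truncated_loss n j x\<bar> \<le> real n + \<bar>CL\<bar>" for j x
    using loss_le[of j x] by (auto simp: truncated_loss_def max_def)
  ultimately show ?thesis unfolding bounded_family_def by blast
qed

text \<open>Fatou's lemma for the nonnegative functions \<open>C - g n\<close>: their integrals are
  at most \<open>C - \<gamma>\<close> for every level, and so is that of their limit.\<close>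

lemma payoff_ge:
  assumes w: "w \<in> W" and ge: "\<And>n. \<gamma> \<le> mean w (truncated_loss n)"
  shows "ereal \<gamma> \<le> payoff w"
proof -
  define C where "C = max 0 CL"
  have C: "loss j x \<le> C" for j x using loss_le[of j x] by (simp add: C_def)
  have tC: "truncated_loss n j x \<le> C" for n j x
    using C[of j x] by (simp add: truncated_loss_def) (simp add: C_def)
  define f where "f x = (\<Sum>j\<in>J. w j x * loss j x)" for x
  define g where "g n x = (\<Sum>j\<in>J. w j x * truncated_loss n j x)" for n x
  have gm: "g n \<in> borel_measurable P" and fm: "f \<in> borel_measurable P" for n
    using weights_measurable[OF w] bounded_family_measurable[OF truncated_loss_bounded] loss_measurable
    unfolding f_def[abs_def] g_def[abs_def]
    by (intro borel_measurable_sum borel_measurable_times; simp)+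
  have gC: "AE x in P. g n x \<le> C" and fC: "AE x in P. f x \<le> C" for n
  proof -
    show "AE x in P. g n x \<le> C" unfolding g_def
      by (rule weights_AE_le[OF w J_fin tC])
    show "AE x in P. f x \<le> C" unfolding f_def
      by (rule weights_AE_le[OF w J_fin C])
  qed
  have int_g: "(\<integral>\<^sup>+x. ennreal (C - g n x) \<partial>P) \<le> ennreal (C - \<gamma>)" for n
  proof -
    have ig: "integrable P (g n)" unfolding g_def[abs_def]
      using P.integrable_weighted[OF J_fin w truncated_loss_bounded] by auto
    have "(\<integral>\<^sup>+x. ennreal (C - g n x) \<partial>P) = ennreal (\<integral>x. C - g n x \<partial>P)"
      using ig gC by (intro nn_integral_eq_integral) auto
    also have "(\<integral>x. C - g n x \<partial>P) = C - (\<integral>x. g n x \<partial>P)"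
      using ig by (simp add: P.prob_space)
    also have "(\<integral>x. g n x \<partial>P) = mean w (truncated_loss n)"
      by (simp add: avg_def g_def)
    also have "ennreal (C - mean w (truncated_loss n)) \<le> ennreal (C - \<gamma>)" using ge by (intro ennreal_leI) simp
    finally show ?thesis .
  qed
  \<comment> \<open>At each point the truncation is inactive from some level on, because
    \<open>J\<close> is finite, so the sequence is eventually constant.\<close>
  have lim: "(\<lambda>n. ennreal (C - g n x)) \<longlonglongrightarrow> ennreal (C - f x)" for x
  proof (rule tendsto_eventually)
    obtain N :: nat where N: "Max ((\<lambda>j. - loss j x) ` J) \<le> real N" using real_arch_simple by blast
    have "g n x = f x" if "n \<ge> N" for n
    proof -
      have "truncated_loss n j x = loss j x" if "j \<in> J" for j
      proof -
        have "- loss j x \<le> Max ((\<lambda>j. - loss j x) ` J)" using J_fin that by (intro Max_ge) auto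
        then show ?thesis using N \<open>n \<ge> N\<close> by (simp add: truncated_loss_def)
      qed
      then show ?thesis by (simp add: f_def g_def)
    qed
    then show "\<forall>\<^sub>F n in sequentially. ennreal (C - g n x) = ennreal (C - f x)"
      by (intro eventually_sequentiallyI[of N]) simp
  qed
  have "(\<integral>\<^sup>+x. ennreal (C - f x) \<partial>P) = (\<integral>\<^sup>+x. liminf (\<lambda>n. ennreal (C - g n x)) \<partial>P)"
    using lim_imp_Liminf[OF sequentially_bot lim] by simp
  also have "\<dots> \<le> liminf (\<lambda>n. \<integral>\<^sup>+x. ennreal (C - g n x) \<partial>P)"
    using gm by (intro nn_integral_liminf) simp
  also have "\<dots> \<le> limsup (\<lambda>n. \<integral>\<^sup>+x. ennreal (C - g n x) \<partial>P)"
    by (rule Liminf_le_Limsup) simp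
  also have "\<dots> \<le> ennreal (C - \<gamma>)" using int_g by (intro Limsup_bounded) simp
  finally have le: "(\<integral>\<^sup>+x. ennreal (C - f x) \<partial>P) \<le> ennreal (C - \<gamma>)" .
  \<comment> \<open>Required for leaving \<open>ennreal\<close>, which would turn a negative
    \<open>C - \<gamma>\<close> into 0.\<close>
  have "\<gamma> \<le> C"
  proof -
    have "\<gamma> \<le> mean w (truncated_loss 0)" by (rule ge)
    also have "\<dots> = (\<integral>x. g 0 x \<partial>P)" by (simp add: avg_def g_def)
    also have "\<dots> \<le> (\<integral>x. C \<partial>P)"
    proof (rule integral_mono_AE[OF _ _ gC])
      show "integrable P (g 0)" unfolding g_def[abs_def]
        using P.integrable_weighted[OF J_fin w truncated_loss_bounded] by auto
    qed simp
    finally show ?thesis by (simp add: P.prob_space)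
  qed
  have "payoff w = ext_integral P f" by (simp add: payoff_def f_def[abs_def] loss_def)
  also have "\<dots> = ereal C - enn2ereal (\<integral>\<^sup>+x. ennreal (C - f x) \<partial>P)"
    using fC by (intro P.ext_integral_bounded_above fm) (auto simp: C_def)
  also have "\<dots> \<ge> ereal C - enn2ereal (ennreal (C - \<gamma>))"
    using le by (intro ereal_minus_mono) (auto simp: less_eq_ennreal.rep_eq)
  finally show ?thesis using \<open>\<gamma> \<le> C\<close> by (simp add: enn2ereal_ennreal)
qed

text \<open>If no level worked, the feasible weights with truncated payoff at least
  \<open>\<gamma>\<close> would form a decreasing sequence of nonempty convex sets. A limit of their
  elements is exactly feasible and has untruncated payoff at least \<open>\<gamma>\<close>, above
  the primal value.\<close>

lemma exists_truncation:
  assumes "primal_value S L < ereal \<gamma>"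
  shows "\<exists>n. \<forall>w\<in>W. (\<forall>r\<in>constraints. mean w (lhs r) \<le> rhs r) \<longrightarrow>
    mean w (truncated_loss n) < \<gamma>"
proof -
  define K where "K n = {w \<in> W. (\<forall>r\<in>constraints. mean w (lhs r) \<le> rhs r) \<and>
    \<gamma> \<le> mean w (truncated_loss n)}" for n
  have mono: "mean w (truncated_loss n) \<le> mean w (truncated_loss m)"
    if "w \<in> W" "m \<le> n" for w m n
    using that(2) by (intro P.avg_mono J_fin that(1) truncated_loss_bounded) (simp add: truncated_loss_def)
  have "\<exists>n. K n = {}"
  proof (rule ccontr)
    assume "\<nexists>n. K n = {}"
    then have ne: "K n \<noteq> {}" for n by simp
    have sub: "K n \<subseteq> W" for n by (auto simp: K_def)
    have dec: "decseq K"
      using mono unfolding decseq_def K_def by (blast intro: order_trans)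
    have mid: "mix (1/2) u v \<in> K n" if "u \<in> K n" "v \<in> K n" for n u v
    proof -
      have uv: "u \<in> W" "v \<in> W" using that sub by auto
      have am: "mean (mix (1/2) u v) a = (mean u a + mean v a) / 2" if "bounded_family P J a" for a
        using P.avg_mix[OF J_fin uv that, of "1/2"] by simp
      have "mean (mix (1/2) u v) (lhs r) \<le> rhs r" if r: "r \<in> constraints" for r
      proof -
        have "mean u (lhs r) \<le> rhs r" "mean v (lhs r) \<le> rhs r"
          using \<open>u \<in> K n\<close> \<open>v \<in> K n\<close> r by (auto simp: K_def)
        then show ?thesis unfolding am[OF lhs_bounded] by simp
      qed
      moreover have "\<gamma> \<le> mean (mix (1/2) u v) (truncated_loss n)"
      proof -
        have "\<gamma> \<le> mean u (truncated_loss n)" "\<gamma> \<le> mean v (truncated_loss n)"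
          using \<open>u \<in> K n\<close> \<open>v \<in> K n\<close> by (auto simp: K_def)
        then show ?thesis unfolding am[OF truncated_loss_bounded] by simp
      qed
      ultimately show ?thesis using mix_in_weights[OF uv, of "1/2"] by (simp add: K_def)
    qed
    obtain u w where u: "\<And>n. u n \<in> K n" and w: "w \<in> W"
      and lim: "AE x in P. \<forall>j\<in>J. (\<lambda>n. u n j x) \<longlonglongrightarrow> w j x"
      by (rule P.weights_nested[OF J_fin ne sub dec mid]) (assumption, assumption, rule that)
    have uW: "u n \<in> W" for n using u sub by blast
    have "mean w (lhs r) \<le> rhs r" if r: "r \<in> constraints" for r
    proof (rule LIMSEQ_le_const2[OF P.avg_tendsto[OF J_fin uW w lim lhs_bounded]])
      show "\<exists>N. \<forall>n\<ge>N. mean (u n) (lhs r) \<le> rhs r" using u r by (auto simp: K_def)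
    qed
    then have adm: "w \<in> admissible 0" by (intro admissible_of_avg w)
    have "\<gamma> \<le> mean w (truncated_loss m)" for m
    proof (rule LIMSEQ_le_const[OF P.avg_tendsto[OF J_fin uW w lim truncated_loss_bounded]])
      \<comment> \<open>For a fixed level \<open>m\<close>, later weights satisfy the stronger bound
        at level \<open>n\<close>, since cutting lower gives smaller losses.\<close>
      have "\<gamma> \<le> mean (u n) (truncated_loss m)" if "n \<ge> m" for n
        using u[of n] mono[OF uW that, of n] by (simp add: K_def)
      then show "\<exists>N. \<forall>n\<ge>N. \<gamma> \<le> mean (u n) (truncated_loss m)" by blast
    qed
    then have "ereal \<gamma> \<le> payoff w" by (rule payoff_ge[OF w])
    moreover obtain \<mu> where "\<mu> \<in> S" "ext_integral \<mu> L = payoff w"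
      using ambiguity_of_admissible[OF adm] by blast
    ultimately have "ereal \<gamma> \<le> primal_value S L" unfolding primal_value_def
      by (metis SUP_upper order_trans)
    then show False using assms by simp
  qed
  then obtain n where "K n = {}" by blast
  then show ?thesis unfolding K_def by (intro exI[of _ n]) (blast intro: leI)
qed

text \<open>The primal value may be -\<infinity>, so the hard inequality is tested against every
  real \<open>\<gamma>\<close> above it. The extra \<open>e\<close> supplies the strict inequality
  that truncation and separation ask for.\<close>

theorem strong_duality:
  assumes "S \<noteq> {}"
  shows "primal_value S L = dual_value P NY y plo phi c \<epsilon> Nl z L"
proof (rule antisym)
  show "primal_value S L \<le> dual_value P NY y plo phi c \<epsilon> Nl z L"
    unfolding primal_value_def dual_value_def
  proof (intro SUP_least INF_greatest)
    fix \<mu> and q :: multipliers assume \<mu>: "\<mu> \<in> S" and q: "q \<in> dual_feasible NY"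
    obtain \<alpha> \<beta> lhi llo where q': "q = (\<alpha>, \<beta>, lhi, llo)" by (cases q)
    define m where "m r = (case r of Cost \<Rightarrow> \<alpha> | Sample i \<Rightarrow> \<beta> i | Upper k \<Rightarrow> lhi k | Lower k \<Rightarrow> llo k)" for r
    have "ext_integral \<mu> L \<le> ereal (lin m) + ext_integral P (envelope m)"
      using q by (intro weak_duality[OF \<mu>]) (auto simp: q' m_def dual_feasible_def)
    also have "\<dots> = dual_objective P NY y plo phi c \<epsilon> Nl z L q"
      using dual_objective_eq[of m] by (simp add: m_def q')
    finally show "ext_integral \<mu> L \<le> dual_objective P NY y plo phi c \<epsilon> Nl z L q" .
  qed
  show "dual_value P NY y plo phi c \<epsilon> Nl z L \<le> primal_value S L"
  proof (rule ereal_le_real)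
    fix \<gamma> assume "primal_value S L \<le> ereal \<gamma>"
    show "dual_value P NY y plo phi c \<epsilon> Nl z L \<le> ereal \<gamma>"
    proof (rule ereal_le_epsilon2)
      fix e :: real assume "0 < e"
      then have "primal_value S L < ereal (\<gamma> + e)"
        using \<open>primal_value S L \<le> ereal \<gamma>\<close> by (metis ereal_less_eq(3) less_add_same_cancel1 less_ereal.simps(1) order_le_less_trans)
      then obtain n where n: "\<And>w. w \<in> W \<Longrightarrow>
          \<forall>r\<in>constraints. mean w (lhs r) \<le> rhs r \<Longrightarrow> mean w (truncated_loss n) < \<gamma> + e"
        using exists_truncation by blast
      \<comment> \<open>A member of the ambiguity set yields feasible weights only up to an
        arbitrarily small excess cost.\<close>
      have feas: "\<exists>w\<in>W. \<forall>r\<in>constraints. mean w (lhs r) \<le> rhs r + \<eta>" if \<eta>: "0 < \<eta>" for \<eta>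
      proof -
        obtain \<mu> where "\<mu> \<in> S" using assms by blast
        then obtain w where w: "w \<in> admissible \<eta>" using admissible_of_ambiguity[OF _ \<eta>] by metis
        then have "w \<in> W" by (simp add: admissible_def)
        then show ?thesis using admissible_avg[OF w less_imp_le[OF \<eta>]] by blast
      qed
      obtain m where m: "\<And>r. r \<in> constraints \<Longrightarrow> 0 \<le> m r"
        and le: "(\<Sum>r\<in>constraints. m r * rhs r) +
          (\<integral>x. Max ((\<lambda>j. truncated_loss n j x - (\<Sum>r\<in>constraints. m r * lhs r j x)) ` J) \<partial>P) \<le> \<gamma> + e"
        by (rule P.weights_duality[OF J_fin J_ne constraints_fin lhs_bounded truncated_loss_bounded feas n])
          (assumption, assumption, assumption, rule that)
      define G where "G x = Max ((\<lambda>j. truncated_loss n j x - penalty m j x) ` J)" for x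
      have iG: "integrable P G" unfolding G_def[abs_def]
        by (intro P.bounded_family_Max J_fin J_ne P.bounded_family_diff truncated_loss_bounded penalty_bounded)
      \<comment> \<open>Truncation raises the loss, so multipliers found for the truncated loss do
        at least as well for the original one.\<close>
      have "envelope m x \<le> G x" for x
        unfolding envelope_def G_def
      proof (rule Max.boundedI)
        fix a assume "a \<in> (\<lambda>j. loss j x - penalty m j x) ` J"
        then obtain j where j: "j \<in> J" "a = loss j x - penalty m j x" by auto
        then have "a \<le> truncated_loss n j x - penalty m j x" by (simp add: truncated_loss_def)
        also have "\<dots> \<le> Max ((\<lambda>j. truncated_loss n j x - penalty m j x) ` J)"
          using j J_fin by (intro Max_ge) auto
        finally show "a \<le> Max ((\<lambda>j. truncated_loss n j x - penalty m j x) ` J)" .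
      qed (use J_fin J_ne in auto)
      then have "ext_integral P (envelope m) \<le> ext_integral P G" by (intro ext_integral_mono) simp
      also have "\<dots> = ereal (\<integral>x. G x \<partial>P)" by (rule ext_integral_integrable[OF iG])
      finally have G: "ext_integral P (envelope m) \<le> ereal (\<integral>x. G x \<partial>P)" .
      have "(m Cost, \<lambda>i. m (Sample i), \<lambda>k. m (Upper k), \<lambda>k. m (Lower k)) \<in> dual_feasible NY"
        using m by (auto simp: dual_feasible_def constraints_def)
      then have "dual_value P NY y plo phi c \<epsilon> Nl z L \<le>
          ereal (lin m) + ext_integral P (envelope m)"
        unfolding dual_value_def dual_objective_eq[symmetric] by (rule INF_lower)
      also have "\<dots> \<le> ereal (lin m) + ereal (\<integral>x. G x \<partial>P)"
        using G by (rule add_left_mono)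
      also have "\<dots> \<le> ereal \<gamma> + ereal e" using le by (simp add: G_def[abs_def] penalty_def lin_def)
      finally show "dual_value P NY y plo phi c \<epsilon> Nl z L \<le> ereal \<gamma> + ereal e" .
    qed
  qed
qed

end

section \<open>Attainment of the dual value\<close>

lemma abs_Max_diff_le:
  fixes f g :: "'a \<Rightarrow> real"
  assumes "finite A" "A \<noteq> {}" "\<And>a. a \<in> A \<Longrightarrow> \<bar>f a - g a\<bar> \<le> e"
  shows "\<bar>Max (f ` A) - Max (g ` A)\<bar> \<le> e"
proof -
  have *: "Max (f ` A) \<le> Max (g ` A) + e" if "\<And>a. a \<in> A \<Longrightarrow> \<bar>f a - g a\<bar> \<le> e" for f g :: "'a \<Rightarrow> real"
  proof (rule Max.boundedI)
    fix b assume "b \<in> f ` A"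
    then obtain a where a: "a \<in> A" "b = f a" by auto
    have "g a \<le> Max (g ` A)" using assms(1) a by (intro Max_ge) auto
    then show "b \<le> Max (g ` A) + e" using that[OF a(1)] a(2) by simp
  qed (use assms in auto)
  show ?thesis using *[of f g] *[of g f] assms(3) by (auto simp: abs_minus_commute abs_le_iff)
qed

text \<open>\<open>w0\<close> is the weight form of a strictly feasible coupling. A label with
  \<open>phi k = 0\<close> carries no mass and its upper multiplier costs nothing;
  \<open>dominated\<close> ensures that a finite multiplier can remove it from the maximum.\<close>

locale strictly_feasible = transport_ambiguity +
  fixes w0 :: "nat \<times> nat \<Rightarrow> 'a \<Rightarrow> real"
  assumes w0: "w0 \<in> W" "mean w0 cost < \<epsilon>"
    "\<And>i. i \<in> {1..Nl} \<Longrightarrow> mean w0 (on_sample i) = 1 / real Nl"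
    and label_bounds: "\<And>k. k \<in> {1..NY} \<Longrightarrow> plo k \<le> mean w0 (on_label k) \<and> mean w0 (on_label k) \<le> phi k"
    and label_strict: "\<And>k. k \<in> {1..NY} \<Longrightarrow> plo k < phi k \<Longrightarrow>
      plo k < mean w0 (on_label k) \<and> mean w0 (on_label k) < phi k"
    and dominated: "\<And>k. k \<in> {1..NY} \<Longrightarrow> phi k = 0 \<Longrightarrow>
      \<exists>C. AE x in P. \<exists>j\<in>{1..NY}. 0 < phi j \<and> L (x, y k) \<le> L (x, y j) + C"
begin

text \<open>Labels that may carry mass; the others have mass and both bounds 0.\<close>

definition K :: "nat set" where "K = {k\<in>{1..NY}. 0 < phi k}"

definition JK :: "(nat \<times> nat) set" where "JK = K \<times> {1..Nl}"

definition q :: "nat \<Rightarrow> real" where "q k = mean w0 (on_label k)"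

definition top_loss :: "'a \<Rightarrow> real" where
  "top_loss x = Max ((\<lambda>j. loss j x) ` JK)"

text \<open>The envelope over the labels that may carry mass. Minimisation is done for it, and
  \<open>envelope_eq_reduced\<close> brings the remaining labels back.\<close>

definition reduced :: "(constraint \<Rightarrow> real) \<Rightarrow> 'a \<Rightarrow> real" where
  "reduced m x = Max ((\<lambda>j. loss j x - penalty m j x) ` JK)"

text \<open>The pointwise limit of \<open>reduced\<close> at \<open>t\<close> times
  \<open>m\<close>, divided by \<open>t\<close>, as \<open>t\<close> grows: the loss drops out and
  the growth in the direction \<open>m\<close> remains.\<close>

definition recession :: "(constraint \<Rightarrow> real) \<Rightarrow> 'a \<Rightarrow> real" where
  "recession m x = Max ((\<lambda>j. 0 - penalty m j x) ` JK)"

definition nonneg_mult :: "(constraint \<Rightarrow> real) \<Rightarrow> bool" where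
  "nonneg_mult m \<longleftrightarrow> 0 \<le> m Cost \<and> (\<forall>k\<in>{1..NY}. 0 \<le> m (Upper k) \<and> 0 \<le> m (Lower k))"

lemma q_nonneg: "k \<in> {1..NY} \<Longrightarrow> 0 \<le> q k"
  using label_bounds[of k] bounds[of k] by (simp add: q_def)

lemma q_pos:
  assumes "k \<in> K"
  shows "0 < q k"
proof -
  have k: "k \<in> {1..NY}" "0 < phi k" using assms by (auto simp: K_def)
  show ?thesis
  proof (cases "plo k < phi k")
    case True
    then show ?thesis using label_strict[OF k(1)] bounds[OF k(1)] by (simp add: q_def)
  next
    case False
    then show ?thesis using label_bounds[OF k(1)] k(2) by (simp add: q_def)
  qed
qed

lemma not_K: "k \<in> {1..NY} \<Longrightarrow> k \<notin> K \<Longrightarrow> phi k = 0 \<and> plo k = 0 \<and> q k = 0"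
  using bounds[of k] label_bounds[of k] by (auto simp: K_def q_def)

lemma sum_q: "(\<Sum>k=1..NY. q k) = 1"
  unfolding q_def by (rule P.sum_avg_hits[OF J_fin w0(1) _ J_fst]) auto

lemma K_ne: "K \<noteq> {}"
proof
  assume "K = {}"
  then have "(\<Sum>k=1..NY. q k) = (\<Sum>k=1..NY. 0)" using not_K by (intro sum.cong refl) blast
  then show False using sum_q by simp
qed

lemma K_sub: "K \<subseteq> {1..NY}" by (auto simp: K_def)

lemma K_fin: "finite K" using K_sub finite_subset by blast

lemma JK_fin: "finite JK" using K_fin by (simp add: JK_def)

lemma JK_ne: "JK \<noteq> {}" using K_ne Nl by (auto simp: JK_def)

lemma JK_sub: "JK \<subseteq> J" using K_sub by (auto simp: JK_def J_def)

lemma Cc_nonneg: "0 \<le> Cc" using c0 cC order_trans by blast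

text \<open>Mixing in the product weights makes all weights on \<open>JK\<close> positive without changing the marginals.\<close>

lemma interior_weights:
  obtains w \<delta> where "w \<in> W" "\<delta> > 0"
    "\<And>j. j \<in> JK \<Longrightarrow> AE x in P. \<delta> \<le> w j x" "\<And>j. j \<in> J - JK \<Longrightarrow> AE x in P. w j x = 0"
    "mean w cost < \<epsilon>" "\<And>i. i \<in> {1..Nl} \<Longrightarrow> mean w (on_sample i) = 1 / real Nl"
    "\<And>k. k \<in> {1..NY} \<Longrightarrow> mean w (on_label k) = q k"
proof -
  define v :: "nat \<times> nat \<Rightarrow> 'a \<Rightarrow> real" where "v j x = q (fst j) / real Nl" for j x
  have Nl0: "real Nl > 0" using Nl by simp
  have v0: "0 \<le> v j x" if "j \<in> J" for j x
    using q_nonneg[OF J_fst[OF that]] by (simp add: v_def)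
  have v1: "(\<Sum>j\<in>J. v j x) = 1" for x
    using Nl0 sum_q by (simp add: sum_J v_def)
  have v: "v \<in> W"
  proof -
    have "v j \<in> borel_measurable P" for j unfolding v_def[abs_def] by simp
    then show ?thesis using v0 v1 by (simp add: weights_def)
  qed
  have v_sample: "mean v (on_sample i) = 1 / real Nl" if i: "i \<in> {1..Nl}" for i
  proof -
    have "(\<Sum>j\<in>J. v j x * on_sample i j x) = 1 / real Nl" for x
    proof -
      have "(\<Sum>j\<in>J. v j x * on_sample i j x) = (\<Sum>k=1..NY. \<Sum>i'=1..Nl. if i' = i then q k / real Nl else 0)"
        unfolding sum_J by (intro sum.cong refl) (simp add: v_def hits_def)
      also have "\<dots> = (\<Sum>k=1..NY. q k / real Nl)" using i by simp
      also have "\<dots> = 1 / real Nl" using sum_q by (simp flip: sum_divide_distrib)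
      finally show ?thesis .
    qed
    then show ?thesis by (simp add: avg_def P.prob_space)
  qed
  have v_label: "mean v (on_label k) = q k" if k: "k \<in> {1..NY}" for k
  proof -
    have "(\<Sum>j\<in>J. v j x * on_label k j x) = q k" for x
    proof -
      have "(\<Sum>j\<in>J. v j x * on_label k j x) = (\<Sum>k'=1..NY. if k' = k then q k' else 0)"
        unfolding sum_J using Nl0 by (intro sum.cong refl) (simp add: v_def hits_def)
      also have "\<dots> = q k" using k by simp
      finally show ?thesis .
    qed
    then show ?thesis by (simp add: avg_def P.prob_space)
  qed
  have avgC: "mean u cost \<le> Cc" if u: "u \<in> W" for u
  proof -
    have b: "bounded_family P J (\<lambda>j x. Cc)" by (auto simp: bounded_family_def)
    have "mean u cost \<le> mean u (\<lambda>j x. Cc)"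
      by (intro P.avg_mono J_fin u cost_bounded b) (simp add: cost_def cC)
    also have "\<dots> = (\<integral>x. Cc \<partial>P)" unfolding avg_def
    proof (rule integral_cong_AE)
      show "(\<lambda>x. \<Sum>j\<in>J. u j x * Cc) \<in> borel_measurable P"
        using weights_measurable[OF u] by (intro borel_measurable_sum borel_measurable_times) auto
      show "AE x in P. (\<Sum>j\<in>J. u j x * Cc) = Cc"
        using weights_AE[OF u J_fin] by eventually_elim (simp flip: sum_distrib_right)
    qed simp
    finally show ?thesis by (simp add: P.prob_space)
  qed
  define s where "s = \<epsilon> - mean w0 cost"
  have s: "s > 0" using w0(2) by (simp add: s_def)
  have avg0: "0 \<le> mean w0 cost" unfolding avg_def
    by (rule integral_nonneg_AE, use weights_AE[OF w0(1) J_fin] in eventually_elim)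
      (auto simp: cost_def c0 intro!: sum_nonneg)
  \<comment> \<open>Small enough that the product weights, of cost at most \<open>Cc\<close>, use no
    more than half of the slack \<open>s\<close>; the summand 1 covers
    \<open>Cc = 0\<close>.\<close>
  define t where "t = min 1 (s / (2 * (Cc + 1)))"
  have t: "0 < t" "t \<le> 1" using s Cc_nonneg by (auto simp: t_def)
  have "t * Cc \<le> s / (2 * (Cc + 1)) * (Cc + 1)"
    using Cc_nonneg s by (intro mult_mono) (auto simp: t_def)
  also have "\<dots> = s / 2" using Cc_nonneg by (simp add: field_simps)
  finally have tC: "t * Cc < s" using s by simp
  define w where "w = mix t w0 v"
  have w: "w \<in> W"
    unfolding w_def using t by (intro mix_in_weights w0(1) v) auto
  have am: "mean w a = (1 - t) * mean w0 a + t * mean v a" if "bounded_family P J a" for a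
    unfolding w_def using t by (intro P.avg_mix J_fin w0(1) v that) auto
  have "mean w cost = mean w0 cost + t * (mean v cost - mean w0 cost)"
    unfolding am[OF cost_bounded] by (simp add: algebra_simps)
  also have "\<dots> \<le> mean w0 cost + t * Cc"
    using avgC[OF v] avg0 t by (intro add_left_mono mult_left_mono) auto
  also have "\<dots> < \<epsilon>" using tC by (simp add: s_def)
  finally have cw: "mean w cost < \<epsilon>" .
  have sw: "mean w (on_sample i) = 1 / real Nl" if "i \<in> {1..Nl}" for i
    unfolding am[OF hits_bounded] w0(3)[OF that] v_sample[OF that] distrib_right[symmetric] by simp
  have lw: "mean w (on_label k) = q k" if "k \<in> {1..NY}" for k
    unfolding am[OF hits_bounded] v_label[OF that] q_def[symmetric] distrib_right[symmetric] by simp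
  \<comment> \<open>\<open>t\<close> times the least value of the product weights on
    \<open>JK\<close>, which do not depend on \<open>x\<close>.\<close>
  define \<delta> where "\<delta> = t * Min (q ` K) / real Nl"
  have "Min (q ` K) \<in> q ` K" using K_fin K_ne by (intro Min_in) auto
  then have minq: "Min (q ` K) > 0" using q_pos by auto
  then have \<delta>: "\<delta> > 0" using t Nl0 by (simp add: \<delta>_def)
  have "AE x in P. \<delta> \<le> w j x" if j: "j \<in> JK" for j
  proof -
    have jJ: "j \<in> J" and jK: "fst j \<in> K" using j JK_sub by (auto simp: JK_def)
    have "Min (q ` K) \<le> q (fst j)" using K_fin jK by (intro Min_le) auto
    then have dv: "\<delta> \<le> t * v j x" for x
      using t Nl0 by (simp add: \<delta>_def v_def divide_right_mono mult_left_mono)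
    show ?thesis using weights_AE1[OF w0(1) J_fin jJ]
    proof eventually_elim
      case (elim x)
      have "0 \<le> (1 - t) * w0 j x" using elim t by simp
      then show ?case using dv[of x] unfolding w_def mix_def by linarith
    qed
  qed
  moreover have "AE x in P. w j x = 0" if j: "j \<in> J - JK" for j
  proof -
    have jJ: "j \<in> J" and k: "fst j \<in> {1..NY}" "fst j \<notin> K"
      using j J_fst[of j] J_snd[of j] by (auto simp: JK_def mem_Times_iff)
    have q0: "q (fst j) = 0" using not_K[OF k] by blast
    have int: "integrable P (w0 j)"
    proof -
      have "bounded_family P J (\<lambda>j x. 1)" by (auto simp: bounded_family_def)
      from P.integrable_weighted[OF J_fin w0(1) this jJ] show ?thesis by simp
    qed
    \<comment> \<open>The label of \<open>j\<close> has mass 0, so these nonnegative weights have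
      integral 0 and vanish almost everywhere.\<close>
    have "(\<integral>x. w0 j x \<partial>P) \<le> mean w0 (on_label (fst j))" unfolding avg_def
    proof (rule integral_mono_AE[OF int])
      show "integrable P (\<lambda>x. \<Sum>i\<in>J. w0 i x * on_label (fst j) i x)"
        by (intro Bochner_Integration.integrable_sum P.integrable_weighted[OF J_fin w0(1) hits_bounded])
      show "AE x in P. w0 j x \<le> (\<Sum>i\<in>J. w0 i x * on_label (fst j) i x)"
        using weights_AE[OF w0(1) J_fin]
      proof eventually_elim
        case (elim x)
        have "w0 j x * on_label (fst j) j x \<le> (\<Sum>i\<in>J. w0 i x * on_label (fst j) i x)"
          using elim J_fin jJ by (intro member_le_sum) (auto simp: hits_def)
        then show ?case by (simp add: hits_def)
      qed
    qed
    then have "(\<integral>x. w0 j x \<partial>P) \<le> 0" using q0 by (simp add: q_def)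
    moreover have nn: "AE x in P. 0 \<le> w0 j x"
      using weights_AE1[OF w0(1) J_fin jJ] by eventually_elim simp
    ultimately have "(\<integral>x. w0 j x \<partial>P) = 0" using integral_nonneg_AE[OF nn] by simp
    then have "AE x in P. w0 j x = 0" using integral_nonneg_eq_0_iff_AE[OF int nn] by simp
    then show ?thesis by eventually_elim (simp add: w_def mix_def v_def q0)
  qed
  ultimately show ?thesis using that[OF w \<delta> _ _ cw sw lw] by blast
qed

text \<open>One bound for all left-hand sides: \<open>Cc\<close> for the cost and 1 for the
  indicators. It becomes the Lipschitz constant in the multipliers.\<close>

definition Cl :: real where "Cl = max Cc 1"

lemma Cl: "0 < Cl" "1 \<le> Cl" "Cc \<le> Cl" by (auto simp: Cl_def)

lemma lhs_le: "\<bar>lhs r j x\<bar> \<le> Cl"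
proof (cases r)
  case Cost
  then show ?thesis using c0 cC Cl by (simp add: cost_def) (meson order_trans)
qed (use Cl in \<open>auto simp: hits_def\<close>)

lemma penalty_diff_le:
  "\<bar>penalty m j x - penalty m' j x\<bar> \<le> Cl * (\<Sum>r\<in>constraints. \<bar>m r - m' r\<bar>)"
proof -
  have "penalty m j x - penalty m' j x = (\<Sum>r\<in>constraints. (m r - m' r) * lhs r j x)"
    by (simp add: penalty_def left_diff_distrib sum_subtractf)
  also have "\<bar>\<dots>\<bar> \<le> (\<Sum>r\<in>constraints. \<bar>(m r - m' r) * lhs r j x\<bar>)" by (rule sum_abs)
  also have "\<dots> \<le> (\<Sum>r\<in>constraints. \<bar>m r - m' r\<bar> * Cl)"
    unfolding abs_mult by (intro sum_mono mult_left_mono lhs_le) simp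
  finally show ?thesis by (simp add: sum_distrib_left mult.commute)
qed

lemma penalty_le: "\<bar>penalty m j x\<bar> \<le> Cl * (\<Sum>r\<in>constraints. \<bar>m r\<bar>)"
  using penalty_diff_le[of m j x "\<lambda>_. 0"] by (simp add: penalty_def)

lemma reduced_measurable: "reduced m \<in> borel_measurable P"
  unfolding reduced_def[abs_def] using loss_penalty_measurable JK_sub
  by (intro P.Max_measurable_image[OF JK_fin]) auto

lemma top_loss_measurable: "top_loss \<in> borel_measurable P"
  unfolding top_loss_def[abs_def] using loss_measurable by (intro P.Max_measurable_image[OF JK_fin])

lemma top_loss_le: "top_loss x \<le> CL"
  unfolding top_loss_def using JK_fin JK_ne loss_le by (intro Max.boundedI) auto

lemma reduced_diff_le:
  "\<bar>reduced m x - reduced m' x\<bar> \<le> Cl * (\<Sum>r\<in>constraints. \<bar>m r - m' r\<bar>)"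
  unfolding reduced_def
proof (rule abs_Max_diff_le[OF JK_fin JK_ne])
  fix j
  show "\<bar>loss j x - penalty m j x - (loss j x - penalty m' j x)\<bar> \<le> Cl * (\<Sum>r\<in>constraints. \<bar>m r - m' r\<bar>)"
    using penalty_diff_le[of m' j x m] by (simp add: abs_minus_commute)
qed

text \<open>Comparison with zero multipliers. The difference is bounded, hence integrable, even
  where the losses are not bounded below.\<close>

lemma reduced_top: "\<bar>reduced m x - top_loss x\<bar> \<le> Cl * (\<Sum>r\<in>constraints. \<bar>m r\<bar>)"
proof -
  have "reduced (\<lambda>_. 0) x = top_loss x" by (simp add: reduced_def top_loss_def penalty_def)
  then show ?thesis using reduced_diff_le[of m x "\<lambda>_. 0"] by simp
qed

lemma recession_le: "\<bar>recession m x\<bar> \<le> Cl * (\<Sum>r\<in>constraints. \<bar>m r\<bar>)"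
proof -
  have "recession m x \<in> (\<lambda>j. 0 - penalty m j x) ` JK"
    unfolding recession_def using JK_fin JK_ne by (intro Max_in) auto
  then show ?thesis using penalty_le[of m _ x] by auto
qed

lemma recession_ge: "j \<in> JK \<Longrightarrow> - penalty m j x \<le> recession m x"
proof -
  assume "j \<in> JK"
  then have "0 - penalty m j x \<le> recession m x"
    unfolding recession_def using JK_fin by (intro Max_ge) auto
  then show ?thesis by simp
qed

lemma recession_measurable: "recession m \<in> borel_measurable P"
  unfolding recession_def[abs_def] using JK_sub bounded_family_measurable[OF penalty_bounded]
  by (intro P.Max_measurable_image[OF JK_fin] borel_measurable_diff) auto

lemma recession_integrable: "integrable P (recession m)"
  by (rule P.integrable_const_bound[of _ "Cl * (\<Sum>r\<in>constraints. \<bar>m r\<bar>)"])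
    (use recession_le recession_measurable in auto)

lemma penalty_integrable: "j \<in> J \<Longrightarrow> integrable P (penalty m j)"
  by (rule P.integrable_const_bound[of _ "Cl * (\<Sum>r\<in>constraints. \<bar>m r\<bar>)"])
    (use penalty_le bounded_family_measurable[OF penalty_bounded] in auto)

text \<open>On \<open>JK\<close> the gaps \<open>recession m x + penalty m j x\<close> are
  nonnegative, and off \<open>JK\<close> the weights vanish. Averaged by \<open>w\<close>, the gaps
  give the recession function plus the mean penalty; keeping only the gap of \<open>j0\<close>, of
  weight at least \<open>\<delta>\<close>, leaves the slacks and the spread of the penalties, which
  control the multipliers.\<close>

lemma recession_lower_bound:
  assumes w: "w \<in> W" and \<delta>: "\<delta> > 0" "\<And>j. j \<in> JK \<Longrightarrow> AE x in P. \<delta> \<le> w j x"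
    and zero: "\<And>j. j \<in> J - JK \<Longrightarrow> AE x in P. w j x = 0" and j0: "j0 \<in> JK"
  shows "(\<Sum>r\<in>constraints. m r * (rhs r - mean w (lhs r))) + \<delta> * (\<integral>x. recession m x + penalty m j0 x \<partial>P)
    \<le> lin m + (\<integral>x. recession m x \<partial>P)"
proof -
  have j0J: "j0 \<in> J" using j0 JK_sub by auto
  have iw: "integrable P (\<lambda>x. \<Sum>j\<in>J. w j x * penalty m j x)"
    using P.integrable_weighted[OF J_fin w penalty_bounded] by auto
  have ir: "integrable P (\<lambda>x. \<delta> * (recession m x + penalty m j0 x))"
    using recession_integrable penalty_integrable[OF j0J] by auto
  have "AE x in P. \<forall>j\<in>J - JK. w j x = 0" using zero J_fin by (subst AE_finite_all) auto
  then have "AE x in P. \<delta> * (recession m x + penalty m j0 x) \<le> recession m x + (\<Sum>j\<in>J. w j x * penalty m j x)"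
    using weights_AE[OF w J_fin] \<delta>(2)[OF j0]
  proof eventually_elim
    case (elim x)
    have nn: "0 \<le> w j x * (recession m x + penalty m j x)" if "j \<in> J" for j
    proof (cases "j \<in> JK")
      case True
      then show ?thesis using elim(2) that recession_ge[OF True, of m x] by (intro mult_nonneg_nonneg) auto
    qed (use elim(1) that in simp)
    have "\<delta> * (recession m x + penalty m j0 x) \<le> w j0 x * (recession m x + penalty m j0 x)"
      using elim(3) recession_ge[OF j0, of m x] by (intro mult_right_mono) auto
    also have "\<dots> \<le> (\<Sum>j\<in>J. w j x * (recession m x + penalty m j x))"
      using J_fin j0J nn by (intro member_le_sum) auto
    also have "\<dots> = (\<Sum>j\<in>J. w j x) * recession m x + (\<Sum>j\<in>J. w j x * penalty m j x)"
      by (simp only: distrib_left sum.distrib sum_distrib_right)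
    finally show ?case using elim(2) by simp
  qed
  then have "(\<integral>x. \<delta> * (recession m x + penalty m j0 x) \<partial>P) \<le>
      (\<integral>x. recession m x + (\<Sum>j\<in>J. w j x * penalty m j x) \<partial>P)"
    by (intro integral_mono_AE ir Bochner_Integration.integrable_add recession_integrable iw)
  also have "\<dots> = (\<integral>x. recession m x \<partial>P) + mean w (penalty m)"
    using recession_integrable iw by (simp add: avg_def)
  finally show ?thesis
    by (simp add: avg_penalty[OF w] lin_def right_diff_distrib sum_subtractf)
qed

end

section \<open>Normalised multipliers and coercivity\<close>

context strictly_feasible
begin

text \<open>The difference \<open>reduced m - top_loss\<close> is bounded, so this is Lipschitz in
  \<open>m\<close>. It is the reduced objective only for integrable \<open>top_loss\<close>;
  otherwise the integral of \<open>top_loss\<close> takes its default value 0.\<close>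

definition dual_fun :: "(constraint \<Rightarrow> real) \<Rightarrow> real" where
  "dual_fun m = lin m + (\<integral>x. top_loss x \<partial>P) + (\<integral>x. reduced m x - top_loss x \<partial>P)"

lemma reduced_top_integrable: "integrable P (\<lambda>x. reduced m x - top_loss x)"
  by (rule P.integrable_const_bound[of _ "Cl * (\<Sum>r\<in>constraints. \<bar>m r\<bar>)"])
    (use reduced_top reduced_measurable top_loss_measurable in auto)

lemma ext_integral_reduced:
  assumes "integrable P top_loss"
  shows "ereal (lin m) + ext_integral P (reduced m) = ereal (dual_fun m)"
proof -
  have i: "integrable P (\<lambda>x. (reduced m x - top_loss x) + top_loss x)"
    using reduced_top_integrable assms by (rule Bochner_Integration.integrable_add)
  then have "integrable P (reduced m)" by simp
  moreover have "(\<integral>x. reduced m x \<partial>P) = (\<integral>x. (reduced m x - top_loss x) + top_loss x \<partial>P)" by simp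
  moreover have "\<dots> = (\<integral>x. reduced m x - top_loss x \<partial>P) + (\<integral>x. top_loss x \<partial>P)"
    using reduced_top_integrable assms by (rule Bochner_Integration.integral_add)
  ultimately show ?thesis by (simp add: ext_integral_integrable dual_fun_def)
qed

lemma reduced_shift:
  assumes "\<And>j x. j \<in> JK \<Longrightarrow> penalty m' j x = penalty m j x - \<sigma>"
  shows "reduced m' x = reduced m x + \<sigma>"
proof -
  have "reduced m' x = Max ((\<lambda>j. (loss j x - penalty m j x) + \<sigma>) ` JK)"
    unfolding reduced_def using assms by (intro arg_cong[where f=Max] image_cong) auto
  also have "\<dots> = reduced m x + \<sigma>"
    unfolding reduced_def by (rule Max_add_commute[OF JK_fin JK_ne])
  finally show ?thesis .
qed

text \<open>Lowering the penalties by a constant raises the integral by that constant, since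
  \<open>P\<close> has mass 1, and the drop in \<open>lin\<close> makes up for it.\<close>

lemma dual_fun_shift:
  assumes "\<And>j x. j \<in> JK \<Longrightarrow> penalty m' j x = penalty m j x - \<sigma>" "lin m' \<le> lin m - \<sigma>"
  shows "dual_fun m' \<le> dual_fun m"
proof -
  have "(\<integral>x. reduced m' x - top_loss x \<partial>P) = (\<integral>x. (reduced m x - top_loss x) + \<sigma> \<partial>P)"
    by (simp add: reduced_shift[OF assms(1)] algebra_simps)
  also have "\<dots> = (\<integral>x. reduced m x - top_loss x \<partial>P) + \<sigma>"
    using reduced_top_integrable by (simp add: P.prob_space)
  finally show ?thesis using assms(2) by (simp add: dual_fun_def)
qed

lemma lin_eq:
  "lin m = m Cost * \<epsilon> + (\<Sum>i=1..Nl. m (Sample i)) / real Nl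
     + (\<Sum>k=1..NY. m (Upper k) * phi k - m (Lower k) * plo k)"
  by (simp add: lin_def sum_constraints sum_subtractf sum_negf sum_divide_distrib)

text \<open>A label in \<open>K\<close> whose bounds leave room, if there is one. If there is none, the label
  multipliers are only determined up to a common constant.\<close>

definition k0 :: nat where
  "k0 = (if \<exists>k\<in>K. plo k < phi k then SOME k. k \<in> K \<and> plo k < phi k else SOME k. k \<in> K)"

lemma k0: "k0 \<in> K" "k \<in> K \<Longrightarrow> plo k < phi k \<Longrightarrow> plo k0 < phi k0"
proof -
  show "k0 \<in> K"
  proof (cases "\<exists>k\<in>K. plo k < phi k")
    case True
    then show ?thesis unfolding k0_def using someI_ex[of "\<lambda>k. k \<in> K \<and> plo k < phi k"] by auto
  next
    case False
    then show ?thesis unfolding k0_def using someI_ex[of "\<lambda>k. k \<in> K"] K_ne by auto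
  qed
  assume "k \<in> K" "plo k < phi k"
  then show "plo k0 < phi k0"
    unfolding k0_def using someI_ex[of "\<lambda>k. k \<in> K \<and> plo k < phi k"] by auto
qed

text \<open>Removes the directions without growth: a common shift of the sample multipliers, a
  common shift of the label multipliers when all bounds in \<open>K\<close> are tight, the common
  part of the two multipliers of a label, and all coordinates that \<open>reduced\<close> does not
  see.\<close>

definition normalised :: "(constraint \<Rightarrow> real) \<Rightarrow> bool" where
  "normalised m \<longleftrightarrow> nonneg_mult m \<and> m (Sample 1) = 0 \<and> (\<forall>r. r \<notin> constraints \<longrightarrow> m r = 0) \<and>
     (\<forall>k. k \<notin> K \<longrightarrow> m (Upper k) = 0 \<and> m (Lower k) = 0) \<and>
     (\<forall>k. m (Upper k) = 0 \<or> m (Lower k) = 0) \<and>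
     (plo k0 < phi k0 \<or> m (Upper k0) = 0 \<and> m (Lower k0) = 0)"

lemma exists_normalised:
  assumes m: "nonneg_mult m"
  obtains m' where "normalised m'" "dual_fun m' \<le> dual_fun m"
proof -
  \<comment> \<open>If every bound in \<open>K\<close> is tight, the label multipliers are measured
    relative to those of \<open>k0\<close>; otherwise slack at \<open>k0\<close> will bound them and
    no shift is made.\<close>
  define s where "s = (if plo k0 < phi k0 then 0 else m (Upper k0) - m (Lower k0))"
  define \<sigma> where "\<sigma> = m (Sample 1) + s"
  define l where "l k = m (Upper k) - m (Lower k) - s" for k
  define m' where "m' r = (case r of Cost \<Rightarrow> m Cost
     | Sample i \<Rightarrow> if i \<in> {1..Nl} then m (Sample i) - m (Sample 1) else 0
     | Upper k \<Rightarrow> if k \<in> K then max 0 (l k) else 0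
     | Lower k \<Rightarrow> if k \<in> K then max 0 (- l k) else 0)" for r
  have "nonneg_mult m'" using m by (auto simp: nonneg_mult_def m'_def)
  moreover have "m' r = 0" if "r \<notin> constraints" for r
    using that K_sub by (cases r) (auto simp: m'_def constraints_def)
  moreover have "m' (Upper k) = 0 \<or> m' (Lower k) = 0" for k by (auto simp: m'_def)
  moreover have "plo k0 < phi k0 \<or> m' (Upper k0) = 0 \<and> m' (Lower k0) = 0"
    by (simp add: m'_def l_def s_def)
  ultimately have norm: "normalised m'" by (simp add: normalised_def) (simp add: m'_def)
  have pen: "penalty m' j x = penalty m j x - \<sigma>" if j: "j \<in> JK" for j x
  proof -
    have "j \<in> J" "fst j \<in> K" "snd j \<in> {1..Nl}" using j JK_sub by (auto simp: JK_def)
    moreover have "max 0 a - max 0 (- a) = a" for a :: real by simp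
    ultimately show ?thesis by (simp add: penalty_eq m'_def \<sigma>_def l_def)
  qed
  have lin: "lin m' \<le> lin m - \<sigma>"
  proof -
    have Nl0: "real Nl > 0" using Nl by simp
    have a: "(\<Sum>i=1..Nl. m' (Sample i)) / real Nl = (\<Sum>i=1..Nl. m (Sample i)) / real Nl - m (Sample 1)"
      using Nl0 by (simp add: m'_def sum_subtractf diff_divide_distrib)
    have s0: "s * (\<Sum>k=1..NY. q k) = s" unfolding sum_q by simp
    have term_le: "m' (Upper k) * phi k - m' (Lower k) * plo k \<le> m (Upper k) * phi k - m (Lower k) * plo k - s * q k"
      if k: "k \<in> {1..NY}" for k
    proof (cases "k \<in> K")
      case False
      then show ?thesis using not_K[OF k False] by simp
    next
      case True
      have u: "0 \<le> m (Upper k)" "0 \<le> m (Lower k)" using m k by (auto simp: nonneg_mult_def)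
      have pp: "plo k \<le> phi k" using bounds[OF k] by simp
      show ?thesis
      proof (cases "plo k0 < phi k0")
        case strict: True
        \<comment> \<open>The common part of the two multipliers cancels in the penalty, and
          removing it saves \<open>r * (phi k - plo k)\<close>.\<close>
        define r where "r = min (m (Upper k)) (m (Lower k))"
        have m'_eq: "m' (Upper k) = m (Upper k) - r" "m' (Lower k) = m (Lower k) - r"
          using True strict by (auto simp: m'_def l_def s_def r_def min_def max_def)
        have "0 \<le> r * (phi k - plo k)" using u pp by (simp add: r_def)
        moreover have "(m (Upper k) - r) * phi k - (m (Lower k) - r) * plo k =
          m (Upper k) * phi k - m (Lower k) * plo k - r * (phi k - plo k)" by (simp add: algebra_simps)
        moreover have "s * q k = 0" using strict by (simp add: s_def)
        ultimately show ?thesis unfolding m'_eq by linarith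
      next
        case False
        \<comment> \<open>All bounds in \<open>K\<close> are tight here, so \<open>phi k\<close> is
          the mass \<open>q k\<close>. These masses add up to 1, and the shift by \<open>s\<close>
          changes \<open>lin\<close> by exactly \<open>s\<close>.\<close>
        then have eq: "plo k = phi k" using k0(2)[OF True] pp by force
        then have "q k = phi k" using label_bounds[OF k] by (simp add: q_def)
        moreover have "m' (Upper k) * phi k - m' (Lower k) * plo k = l k * phi k"
          using True eq by (simp add: m'_def max_def)
        ultimately show ?thesis using eq by (simp add: l_def algebra_simps)
      qed
    qed
    have "(\<Sum>k=1..NY. m' (Upper k) * phi k - m' (Lower k) * plo k) \<le>
       (\<Sum>k=1..NY. m (Upper k) * phi k - m (Lower k) * plo k - s * q k)" by (rule sum_mono, rule term_le)
    also have "\<dots> = (\<Sum>k=1..NY. m (Upper k) * phi k - m (Lower k) * plo k) - s"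
      using s0 by (simp add: sum_subtractf sum_distrib_left)
    finally show ?thesis unfolding lin_eq a \<sigma>_def by (simp add: m'_def)
  qed
  have "dual_fun m' \<le> dual_fun m" by (rule dual_fun_shift[OF pen lin])
  with norm show ?thesis by (rule that)
qed

text \<open>The recession value controls slack times multiplier and, up to \<open>\<delta>\<close>,
  the mean spread of penalties over \<open>JK\<close>. Slack bounds the cost multiplier and, where
  there is room, those of \<open>k0\<close>; the spread bounds all differences, and normalisation
  turns differences into values.\<close>

lemma recession_coercive:
  obtains T where "0 < T" "\<And>m r. normalised m \<Longrightarrow> r \<in> constraints \<Longrightarrow>
    \<bar>m r\<bar> \<le> T * (lin m + (\<integral>x. recession m x \<partial>P))"
proof -
  obtain w \<delta> where w: "w \<in> W" and \<delta>: "\<delta> > 0"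
    "\<And>j. j \<in> JK \<Longrightarrow> AE x in P. \<delta> \<le> w j x" and zero: "\<And>j. j \<in> J - JK \<Longrightarrow> AE x in P. w j x = 0"
    and cw: "mean w cost < \<epsilon>" and sw: "\<And>i. i \<in> {1..Nl} \<Longrightarrow> mean w (on_sample i) = 1 / real Nl"
    and lw: "\<And>k. k \<in> {1..NY} \<Longrightarrow> mean w (on_label k) = q k"
    by (rule interior_weights) (rule that)
  define slack where "slack r = rhs r - mean w (lhs r)" for r
  have sCost: "slack Cost > 0" using cw by (simp add: slack_def)
  have sSample: "slack (Sample i) = 0" if "i \<in> {1..Nl}" for i
    using sw[OF that] by (simp add: slack_def)
  have sUpper: "slack (Upper k) = phi k - q k" and sLower: "slack (Lower k) = q k - plo k"
    if "k \<in> {1..NY}" for k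
    using lw[OF that] avg_lower[OF w, of k] by (simp_all add: slack_def)
  have slack0: "0 \<le> slack r" if "r \<in> constraints" for r
    using that
  proof (cases rule: constraint_cases)
    case (3 k) then show ?thesis using sUpper label_bounds by (simp add: q_def)
  next
    case (4 k) then show ?thesis using sLower label_bounds by (simp add: q_def)
  qed (use sCost sSample in auto)
  \<comment> \<open>Constraints without slack contribute nothing, because division by 0 gives
    0.\<close>
  define T0 where "T0 = (\<Sum>r\<in>constraints. 1 / slack r)"
  have T0: "0 \<le> T0" unfolding T0_def by (intro sum_nonneg) (simp add: slack0)
  \<comment> \<open>The summands answer for the multipliers of \<open>k0\<close> and of the cost,
    for the spread of penalties, and for the variation of the cost within that spread.\<close>
  define T where "T = T0 + 1 / \<delta> + T0 * Cc"
  have "0 < 1 / \<delta>" "0 \<le> T0 * Cc" using T0 \<delta>(1) Cc_nonneg by simp_all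
  then have T: "0 < T" "T0 \<le> T" using T0 unfolding T_def by linarith+
  show ?thesis
  proof (rule that[OF T(1)])
    fix m r assume m: "normalised m" and r: "r \<in> constraints"
    define D where "D = lin m + (\<integral>x. recession m x \<partial>P)"
    have mn: "0 \<le> m Cost" "\<And>k. k \<in> {1..NY} \<Longrightarrow> 0 \<le> m (Upper k) \<and> 0 \<le> m (Lower k)"
      using m by (auto simp: normalised_def nonneg_mult_def)
    have ms0: "0 \<le> m r * slack r" if "r \<in> constraints" for r
      using that
    proof (cases rule: constraint_cases)
      case (2 i) then show ?thesis using sSample by simp
    qed (use mn slack0[OF that] in \<open>auto intro!: mult_nonneg_nonneg\<close>)
    have low: "(\<Sum>r\<in>constraints. m r * slack r) + \<delta> * (\<integral>x. recession m x + penalty m j x \<partial>P) \<le> D"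
      if "j \<in> JK" for j
      unfolding slack_def D_def by (rule recession_lower_bound[OF w \<delta> zero that])
    have int0: "0 \<le> (\<integral>x. recession m x + penalty m j x \<partial>P)" if "j \<in> JK" for j
    proof (rule integral_nonneg_AE, rule AE_I2)
      show "0 \<le> recession m x + penalty m j x" for x
        using recession_ge[OF that, of m x] by linarith
    qed
    have sum0: "0 \<le> (\<Sum>r\<in>constraints. m r * slack r)" by (intro sum_nonneg ms0)
    obtain j0 where j0: "j0 \<in> JK" using JK_ne by blast
    have sumD: "(\<Sum>r\<in>constraints. m r * slack r) \<le> D"
      using low[OF j0] mult_nonneg_nonneg[OF less_imp_le[OF \<delta>(1)] int0[OF j0]] by linarith
    then have D0: "0 \<le> D" using sum0 by linarith
    have strict: "m r \<le> T0 * D" if r: "r \<in> constraints" and s: "slack r > 0" for r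
    proof -
      have "m r * slack r \<le> (\<Sum>r\<in>constraints. m r * slack r)"
        using constraints_fin r ms0 by (intro member_le_sum) auto
      then have "m r \<le> (1 / slack r) * D" using sumD s by (simp add: pos_le_divide_eq)
      also have "1 / slack r \<le> T0" unfolding T0_def
        using constraints_fin r slack0 by (intro member_le_sum) auto
      then have "(1 / slack r) * D \<le> T0 * D" using D0 by (rule mult_right_mono)
      finally show ?thesis .
    qed
    have cost: "m Cost \<le> T0 * D" by (rule strict) (simp_all add: sCost constraints_def)
    \<comment> \<open>\<open>recession m\<close> dominates \<open>- penalty m i\<close>, so the
      spread between \<open>j\<close> and \<open>i\<close> is at most the gap of
      \<open>j\<close>.\<close>
    have diff: "(\<integral>x. penalty m j x - penalty m i x \<partial>P) \<le> D / \<delta>" if "j \<in> JK" "i \<in> JK" for i j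
    proof -
      have "(\<integral>x. penalty m j x - penalty m i x \<partial>P) \<le> (\<integral>x. recession m x + penalty m j x \<partial>P)"
        using that JK_sub recession_ge[OF that(2), of m]
        by (intro integral_mono Bochner_Integration.integrable_diff Bochner_Integration.integrable_add
            penalty_integrable recession_integrable) (auto simp: minus_le_iff diff_conv_add_uminus simp del: add_uminus_conv_diff)
      moreover have "\<delta> * (\<integral>x. recession m x + penalty m j x \<partial>P) \<le> D"
        using low[OF that(1)] sum0 by linarith
      then have "(\<integral>x. recession m x + penalty m j x \<partial>P) \<le> D / \<delta>"
        using \<delta>(1) by (simp add: pos_le_divide_eq mult.commute)
      ultimately show ?thesis by (rule order_trans)
    qed
    have bound: "a \<le> D / \<delta> + T0 * D * Cc"
      if ji: "j \<in> JK" "i \<in> JK" and pen: "\<And>x. penalty m j x - penalty m i x = m Cost * (cost j x - cost i x) + a"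
      for a i j
    proof -
      \<comment> \<open>The cost is the only part of the spread that depends on \<open>x\<close>; it
        lies between 0 and \<open>Cc\<close> and is subtracted at its worst.\<close>
      have "a - m Cost * Cc \<le> penalty m j x - penalty m i x" for x
      proof -
        have "0 \<le> cost j x" "cost i x \<le> Cc" by (simp_all add: cost_def c0 cC)
        then have "- Cc \<le> cost j x - cost i x" by linarith
        then have "m Cost * (- Cc) \<le> m Cost * (cost j x - cost i x)"
          using mn(1) by (rule mult_left_mono)
        then show ?thesis unfolding pen by simp
      qed
      then have "(\<integral>x. a - m Cost * Cc \<partial>P) \<le> (\<integral>x. penalty m j x - penalty m i x \<partial>P)"
        using ji JK_sub by (intro integral_mono Bochner_Integration.integrable_diff penalty_integrable) auto
      then have "a \<le> D / \<delta> + m Cost * Cc" using diff[OF ji] by (simp add: P.prob_space)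
      also have "m Cost * Cc \<le> T0 * D * Cc" using cost Cc_nonneg by (rule mult_right_mono)
      finally show ?thesis by simp
    qed
    have TD: "D / \<delta> + T0 * D * Cc \<le> T * D" "D / \<delta> + T0 * D * Cc + T0 * D \<le> T * D" "T0 * D \<le> T * D"
    proof -
      have "T * D = T0 * D + 1 / \<delta> * D + T0 * Cc * D" by (simp only: T_def distrib_right)
      moreover have "1 / \<delta> * D = D / \<delta>" by simp
      moreover have "T0 * Cc * D = T0 * D * Cc" by (simp only: mult.assoc mult.commute[of Cc D])
      moreover have "0 \<le> T0 * D" "0 \<le> D / \<delta>" "0 \<le> T0 * D * Cc" using D0 T0 \<delta>(1) Cc_nonneg by simp_all
      ultimately show "D / \<delta> + T0 * D * Cc \<le> T * D" "D / \<delta> + T0 * D * Cc + T0 * D \<le> T * D" "T0 * D \<le> T * D"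
        by linarith+
    qed
    have bound': "(m (Sample (snd j)) - m (Sample (snd i)))
        + ((m (Upper (fst j)) - m (Lower (fst j))) - (m (Upper (fst i)) - m (Lower (fst i)))) \<le> D / \<delta> + T0 * D * Cc"
      if ji: "j \<in> JK" "i \<in> JK" for i j
    proof (rule bound[OF ji])
      have "j \<in> J" "i \<in> J" using ji JK_sub by auto
      then show "penalty m j x - penalty m i x = m Cost * (cost j x - cost i x) +
        ((m (Sample (snd j)) - m (Sample (snd i)))
        + ((m (Upper (fst j)) - m (Lower (fst j))) - (m (Upper (fst i)) - m (Lower (fst i)))))" for x
        by (simp add: penalty_eq algebra_simps)
    qed
    \<comment> \<open>Label \<open>k\<close> is compared with \<open>k0\<close> at a common sample;
      \<open>k0\<close> itself is bounded by its slack or pinned to 0.\<close>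
    have lam: "\<bar>m (Upper k) - m (Lower k)\<bar> \<le> T * D" if k: "k \<in> K" for k
    proof -
      have kk: "k \<in> {1..NY}" "k0 \<in> {1..NY}" using k k0(1) K_sub by auto
      have JKk: "(k, 1) \<in> JK" "(k0, 1) \<in> JK" using k k0(1) Nl by (auto simp: JK_def)
      have "(m (Upper k) - m (Lower k)) - (m (Upper k0) - m (Lower k0)) \<le> D / \<delta> + T0 * D * Cc"
        using bound'[OF JKk] by simp
      moreover have "(m (Upper k0) - m (Lower k0)) - (m (Upper k) - m (Lower k)) \<le> D / \<delta> + T0 * D * Cc"
        using bound'[OF JKk(2,1)] by simp
      moreover have "\<bar>m (Upper k0) - m (Lower k0)\<bar> \<le> T0 * D"
      proof (cases "plo k0 < phi k0")
        case True
        then have "slack (Upper k0) > 0" "slack (Lower k0) > 0"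
          using label_strict[OF kk(2)] kk by (auto simp: sUpper sLower q_def)
        then have "m (Upper k0) \<le> T0 * D" "m (Lower k0) \<le> T0 * D"
          using kk by (auto intro!: strict simp: constraints_def)
        then show ?thesis using mn(2)[OF kk(2)] by (simp add: abs_le_iff)
      next
        case False
        then show ?thesis using m T0 D0 by (simp add: normalised_def)
      qed
      ultimately show ?thesis using TD(2) by linarith
    qed
    have TD0: "0 \<le> T * D" using T D0 by simp
    have "\<bar>m r\<bar> \<le> T * D" using r
    proof (cases rule: constraint_cases)
      case 1
      then show ?thesis using cost mn(1) TD(3) by simp
    next
      case (2 i)
      have JKi: "(k0, i) \<in> JK" "(k0, 1) \<in> JK" using k0(1) 2 Nl by (auto simp: JK_def)
      have "m (Sample i) - m (Sample 1) \<le> D / \<delta> + T0 * D * Cc"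
        using bound'[OF JKi] by simp
      moreover have "m (Sample 1) - m (Sample i) \<le> D / \<delta> + T0 * D * Cc"
        using bound'[OF JKi(2,1)] by simp
      ultimately show ?thesis using 2 m TD(1) by (simp add: normalised_def abs_le_iff)
    next
      \<comment> \<open>At most one of the two multipliers of a label is nonzero, so the bound on
        their difference bounds each.\<close>
      case (3 k)
      show ?thesis
      proof (cases "k \<in> K \<and> m (Upper k) \<noteq> 0")
        case True
        then have "m (Lower k) = 0" using m by (auto simp: normalised_def)
        then show ?thesis using lam[of k] True 3 by simp
      next
        case False
        then show ?thesis using m 3 TD0 by (auto simp: normalised_def)
      qed
    next
      case (4 k)
      show ?thesis
      proof (cases "k \<in> K \<and> m (Lower k) \<noteq> 0")
        case True
        then have "m (Upper k) = 0" using m by (auto simp: normalised_def)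
        then show ?thesis using lam[of k] True 4 by simp
      next
        case False
        then show ?thesis using m 4 TD0 by (auto simp: normalised_def)
      qed
    qed
    then show "\<bar>m r\<bar> \<le> T * (lin m + (\<integral>x. recession m x \<partial>P))" by (simp add: D_def)
  qed
qed

text \<open>Off a small set the loss moves the maximum by at most \<open>n\<close>, which is negligible for large
  multipliers.\<close>

lemma exists_bounded_losses:
  assumes "0 < e"
  obtains n :: nat and B where "B \<in> sets P" "P.prob B \<le> e"
    "\<And>j x. j \<in> JK \<Longrightarrow> x \<notin> B \<Longrightarrow> top_loss x - real n \<le> loss j x"
proof -
  define B where "B n = {x \<in> space P. \<exists>j\<in>JK. loss j x < top_loss x - real n}" for n :: nat
  have Bm: "B n \<in> sets P" for n
  proof -
    have "B n = (\<Union>j\<in>JK. {x \<in> space P. loss j x < top_loss x - real n})" by (auto simp: B_def)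
    moreover have "{x \<in> space P. loss j x < top_loss x - real n} \<in> sets P" for j
      using loss_measurable[of j] borel_measurable_diff[OF top_loss_measurable borel_measurable_const]
      by (rule borel_measurable_less)
    ultimately show ?thesis using JK_fin by (simp add: sets.finite_UN)
  qed
  have dec: "decseq B" unfolding decseq_def
  proof (intro allI impI subsetI)
    fix a b x assume "a \<le> b" "x \<in> B b"
    then obtain j where j: "j \<in> JK" "loss j x < top_loss x - real b" "x \<in> space P" by (auto simp: B_def)
    moreover have "real a \<le> real b" using \<open>a \<le> b\<close> by simp
    ultimately have "loss j x < top_loss x - real a" by linarith
    then show "x \<in> B a" using j by (auto simp: B_def)
  qed
  \<comment> \<open>At a fixed point finitely many real losses have a finite gap to their maximum,
    so large \<open>n\<close> excludes the point.\<close>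
  have "(\<Inter>n. B n) = {}"
  proof (rule ccontr)
    assume "(\<Inter>n. B n) \<noteq> {}"
    then obtain x where x: "\<And>n. x \<in> B n" by auto
    obtain n :: nat where n: "Max ((\<lambda>j. top_loss x - loss j x) ` JK) < real n" using reals_Archimedean2 by blast
    obtain j where j: "j \<in> JK" "loss j x < top_loss x - real n" using x[of n] by (auto simp: B_def)
    have "top_loss x - loss j x \<le> Max ((\<lambda>j. top_loss x - loss j x) ` JK)"
      using JK_fin j by (intro Max_ge) auto
    then show False using n j by linarith
  qed
  moreover have "(\<lambda>n. P.prob (B n)) \<longlonglongrightarrow> P.prob (\<Inter>n. B n)"
    using Bm dec by (intro P.finite_Lim_measure_decseq) auto
  ultimately have "(\<lambda>n. P.prob (B n)) \<longlonglongrightarrow> 0" by simp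
  then have "\<forall>\<^sub>F n in sequentially. P.prob (B n) < e" using assms by (rule order_tendstoD(2))
  then obtain n where n: "P.prob (B n) < e" by (auto simp: eventually_sequentially)
  show ?thesis
  proof (rule that[OF Bm less_imp_le[OF n]])
    fix j x assume "j \<in> JK" "x \<notin> B n"
    then show "top_loss x - real n \<le> loss j x" by (auto simp: B_def space_P not_less)
  qed
qed

text \<open>Off \<open>B\<close> the reduced objective loses at most \<open>n\<close> against the
  recession function. On \<open>B\<close> it may lose \<open>2 * H\<close>, which grows linearly
  with the recession value \<open>D\<close>, but \<open>B\<close> is chosen so small that this costs
  at most half of \<open>D\<close>.\<close>

lemma dual_fun_coercive:
  obtains \<kappa> b where "0 < \<kappa>" "\<And>m r. normalised m \<Longrightarrow> r \<in> constraints \<Longrightarrow> \<bar>m r\<bar> \<le> \<kappa> * (dual_fun m + b)"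
proof -
  obtain T where T: "0 < T" "\<And>m r. normalised m \<Longrightarrow> r \<in> constraints \<Longrightarrow>
    \<bar>m r\<bar> \<le> T * (lin m + (\<integral>x. recession m x \<partial>P))"
    by (rule recession_coercive) (rule that)
  define T' where "T' = Cl * (real (card constraints) * T)"
  have "card constraints > 0" using constraints_fin by (auto simp: card_gt_0_iff constraints_def)
  then have T': "0 < T'" using Cl T by (simp add: T'_def)
  \<comment> \<open>Chosen so that \<open>2 * (T' * D) * e\<close> equals
    \<open>D / 2\<close>.\<close>
  define e where "e = 1 / (4 * T')"
  have e: "0 < e" using T' by (simp add: e_def)
  obtain n B where B: "B \<in> sets P" "P.prob B \<le> e"
    "\<And>j x. j \<in> JK \<Longrightarrow> x \<notin> B \<Longrightarrow> top_loss x - real n \<le> loss j x"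
    by (rule exists_bounded_losses[OF e]) (rule that)
  define b where "b = real n - (\<integral>x. top_loss x \<partial>P)"
  show ?thesis
  proof (rule that[of "2 * T" b])
    fix m r assume m: "normalised m" and r: "r \<in> constraints"
    define D where "D = lin m + (\<integral>x. recession m x \<partial>P)"
    define H where "H = Cl * (\<Sum>r\<in>constraints. \<bar>m r\<bar>)"
    have D: "\<bar>m r\<bar> \<le> T * D" if "r \<in> constraints" for r using T(2)[OF m that] by (simp add: D_def)
    have "0 \<le> T * D" using D[OF r] by linarith
    then have D0: "0 \<le> D" using T by (simp add: zero_le_mult_iff)
    have "(\<Sum>r\<in>constraints. \<bar>m r\<bar>) \<le> real (card constraints) * (T * D)"
      using D by (intro sum_bounded_above)
    then have "H \<le> Cl * (real (card constraints) * (T * D))"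
      unfolding H_def using Cl by (intro mult_left_mono) auto
    then have H: "H \<le> T' * D" by (simp add: T'_def mult_ac)
    have H0: "0 \<le> H" unfolding H_def using Cl by (intro mult_nonneg_nonneg sum_nonneg) auto
    have point: "recession m x - real n - 2 * H * indicator B x \<le> reduced m x - top_loss x" for x
    proof (cases "x \<in> B")
      case True
      then show ?thesis using recession_le[of m x] reduced_top[of m x] by (simp add: H_def abs_le_iff)
    next
      case False
      have "recession m x \<le> reduced m x - top_loss x + real n"
        unfolding recession_def
      proof (rule Max.boundedI)
        fix a assume "a \<in> (\<lambda>j. 0 - penalty m j x) ` JK"
        then obtain j where j: "j \<in> JK" "a = - penalty m j x" by auto
        have "loss j x - penalty m j x \<le> reduced m x"
          unfolding reduced_def using JK_fin j by (intro Max_ge) auto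
        then show "a \<le> reduced m x - top_loss x + real n" using B(3)[OF j(1) False] j(2) by linarith
      qed (use JK_fin JK_ne in auto)
      then show ?thesis using False by simp
    qed
    have iB: "integrable P (\<lambda>x. 2 * H * indicator B x)"
      by (rule integrable_mult_right[OF integrable_real_indicator[OF B(1)]]) (simp add: P.emeasure_finite less_top[symmetric])
    have iL: "integrable P (\<lambda>x. recession m x - real n - 2 * H * indicator B x)"
      by (intro Bochner_Integration.integrable_diff recession_integrable iB P.integrable_const)
    have "(\<integral>x. recession m x - real n - 2 * H * indicator B x \<partial>P) \<le> (\<integral>x. reduced m x - top_loss x \<partial>P)"
      by (rule integral_mono[OF iL reduced_top_integrable point])
    moreover have "(\<integral>x. recession m x - real n - 2 * H * indicator B x \<partial>P) =
        (\<integral>x. recession m x \<partial>P) - real n - 2 * H * P.prob B"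
      using recession_integrable iB B(1) by (simp add: P.prob_space)
    moreover have "2 * H * P.prob B \<le> D / 2"
    proof -
      have "2 * H * P.prob B \<le> 2 * (T' * D) * e"
        using H H0 B(2) by (intro mult_mono) auto
      also have "\<dots> = D / 2" using T' by (simp add: e_def)
      finally show ?thesis .
    qed
    ultimately have "D \<le> 2 * (dual_fun m + b)" by (simp add: dual_fun_def D_def b_def)
    then have "T * D \<le> T * (2 * (dual_fun m + b))" using T(1) by (intro mult_left_mono) auto
    then show "\<bar>m r\<bar> \<le> 2 * T * (dual_fun m + b)" using D[OF r] by linarith
  qed (use T in simp)
qed

end

section \<open>Existence of a minimiser and its transfer to the full dual\<close>

context strictly_feasible
begin

lemma dual_fun_diff_le:
  "\<bar>dual_fun m - dual_fun m'\<bar> \<le> (\<Sum>r\<in>constraints. \<bar>m r - m' r\<bar> * (\<bar>rhs r\<bar> + Cl))"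
proof -
  have "\<bar>lin m - lin m'\<bar> \<le> (\<Sum>r\<in>constraints. \<bar>m r - m' r\<bar> * \<bar>rhs r\<bar>)"
  proof -
    have "lin m - lin m' = (\<Sum>r\<in>constraints. (m r - m' r) * rhs r)"
      by (simp add: lin_def sum_subtractf left_diff_distrib)
    then show ?thesis using sum_abs[of "\<lambda>r. (m r - m' r) * rhs r" constraints] by (simp add: abs_mult)
  qed
  moreover have "\<bar>(\<integral>x. reduced m x - top_loss x \<partial>P) - (\<integral>x. reduced m' x - top_loss x \<partial>P)\<bar> \<le>
    (\<Sum>r\<in>constraints. \<bar>m r - m' r\<bar> * Cl)"
  proof -
    let ?e = "Cl * (\<Sum>r\<in>constraints. \<bar>m r - m' r\<bar>)"
    let ?f = "\<lambda>x. (reduced m x - top_loss x) - (reduced m' x - top_loss x)"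
    have i: "integrable P ?f" by (intro Bochner_Integration.integrable_diff reduced_top_integrable)
    have f: "\<bar>?f x\<bar> \<le> ?e" for x using reduced_diff_le[of m x m'] by simp
    have "\<bar>\<integral>x. ?f x \<partial>P\<bar> \<le> (\<integral>x. \<bar>?f x\<bar> \<partial>P)" by (rule integral_abs_bound)
    also have "\<dots> \<le> (\<integral>x. ?e \<partial>P)" using i f by (intro integral_mono) auto
    also have "\<dots> = (\<Sum>r\<in>constraints. \<bar>m r - m' r\<bar> * Cl)"
      by (simp add: P.prob_space sum_distrib_left mult.commute)
    finally show ?thesis
      unfolding Bochner_Integration.integral_diff[OF reduced_top_integrable reduced_top_integrable] .
  qed
  ultimately show ?thesis
    unfolding dual_fun_def distrib_left sum.distrib by linarith
qed

text \<open>Multipliers carry the product topology; only the finitely many coordinates in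
  \<open>constraints\<close> enter the Lipschitz bound, and each is continuous.\<close>

lemma dual_fun_continuous: "continuous_on UNIV dual_fun"
proof -
  have "(dual_fun \<longlongrightarrow> dual_fun m) (at m)" for m
  proof (rule LIM_zero_cancel, rule Lim_null_comparison)
    show "\<forall>\<^sub>F m' in at m. norm (dual_fun m' - dual_fun m) \<le>
        (\<Sum>r\<in>constraints. \<bar>m' r - m r\<bar> * (\<bar>rhs r\<bar> + Cl))"
      using dual_fun_diff_le[of _ m] by simp
    have coord: "((\<lambda>m'. m' r) \<longlongrightarrow> m r) (at m)" for r :: constraint
      using continuous_on_product_coordinates[of r] unfolding continuous_on_def by blast
    have "((\<lambda>m'. \<Sum>r\<in>constraints. \<bar>m' r - m r\<bar> * (\<bar>rhs r\<bar> + Cl)) \<longlongrightarrow>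
        (\<Sum>r\<in>constraints. \<bar>m r - m r\<bar> * (\<bar>rhs r\<bar> + Cl))) (at m)"
      by (intro tendsto_sum tendsto_mult tendsto_rabs tendsto_diff coord tendsto_const)
    then show "((\<lambda>m'. \<Sum>r\<in>constraints. \<bar>m' r - m r\<bar> * (\<bar>rhs r\<bar> + Cl)) \<longlongrightarrow> 0) (at m)" by simp
  qed
  then show ?thesis by (simp add: continuous_on_def)
qed

text \<open>Normalisation does not increase the objective, and normalised multipliers no worse than
  zero lie in a fixed compact box, on which the continuous objective has a minimum.\<close>

lemma exists_minimiser:
  obtains m where "nonneg_mult m" "\<And>m'. nonneg_mult m' \<Longrightarrow> dual_fun m \<le> dual_fun m'"
proof -
  obtain \<kappa> b where \<kappa>: "0 < \<kappa>"
    "\<And>m r. normalised m \<Longrightarrow> r \<in> constraints \<Longrightarrow> \<bar>m r\<bar> \<le> \<kappa> * (dual_fun m + b)"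
    by (rule dual_fun_coercive) (rule that)
  \<comment> \<open>Coercivity bounds by \<open>\<rho>\<close> every normalised multiplier that does
    at least as well as zero.\<close>
  define \<rho> where "\<rho> = \<kappa> * (dual_fun (\<lambda>_. 0) + b)"
  have "normalised (\<lambda>_. 0)" by (simp add: normalised_def nonneg_mult_def)
  from \<kappa>(2)[OF this, of Cost] have \<rho>0: "0 \<le> \<rho>" by (simp add: \<rho>_def constraints_def)
  \<comment> \<open>Intervals are needed for all indices, since the box lives in the whole function
    space; normalised multipliers vanish outside \<open>constraints\<close> and so lie in it
    too.\<close>
  define I where "I r = (case r of Sample i \<Rightarrow> {-\<rho>..\<rho>} | _ \<Rightarrow> {0..\<rho>})" for r
  define B where "B = (\<Pi>\<^sub>E r\<in>UNIV. I r)"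
  have "compact (I r)" for r by (cases r) (auto simp: I_def)
  then have "compactin (product_topology (\<lambda>_. euclidean) UNIV) B"
    unfolding B_def by (simp add: compactin_PiE)
  then have cB: "compact B" unfolding euclidean_product_topology by simp
  have B0: "(\<lambda>_. 0) \<in> B" using \<rho>0 by (auto simp: B_def I_def split: constraint.split)
  obtain m where m: "m \<in> B" and min: "\<And>m'. m' \<in> B \<Longrightarrow> dual_fun m \<le> dual_fun m'"
    using continuous_attains_inf[OF cB _ continuous_on_subset[OF dual_fun_continuous subset_UNIV]] B0
    by blast
  have mI: "m r \<in> I r" for r using m by (auto simp: B_def PiE_iff)
  have nonneg: "nonneg_mult m"
    using mI[of Cost] mI[of "Upper _"] mI[of "Lower _"] by (simp add: nonneg_mult_def I_def)
  have le: "dual_fun m \<le> dual_fun m'" if m': "nonneg_mult m'" for m'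
  proof -
    obtain n where n: "normalised n" "dual_fun n \<le> dual_fun m'" by (rule exists_normalised[OF m']) (rule that)
    show ?thesis
    proof (cases "dual_fun n \<le> dual_fun (\<lambda>_. 0)")
      case True
      have le: "\<bar>n r\<bar> \<le> \<rho>" for r
      proof (cases "r \<in> constraints")
        case r: True
        have "\<bar>n r\<bar> \<le> \<kappa> * (dual_fun n + b)" by (rule \<kappa>(2)[OF n(1) r])
        also have "\<dots> \<le> \<rho>" unfolding \<rho>_def using True \<kappa>(1) by (intro mult_left_mono) auto
        finally show ?thesis .
      qed (use n(1) \<rho>0 in \<open>simp add: normalised_def\<close>)
      have nn: "0 \<le> n Cost" "0 \<le> n (Upper k)" "0 \<le> n (Lower k)" for k
        using n(1) K_sub by (auto simp: normalised_def nonneg_mult_def) (metis order_refl subsetD)+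
      have "n r \<in> I r" for r
        using le[of r] nn by (cases r) (auto simp: I_def abs_le_iff)
      then have "n \<in> B" by (simp add: B_def PiE_iff)
      then show ?thesis using min n(2) by force
    next
      \<comment> \<open>Here the zero multipliers, which belong to the box, already do
        better.\<close>
      case False
      then show ?thesis using min[OF B0] n(2) by linarith
    qed
  qed
  show ?thesis by (rule that[OF nonneg le])
qed

lemma reduced_le_envelope: "reduced m x \<le> envelope m x"
  unfolding reduced_def envelope_def using JK_sub JK_ne J_fin by (intro Max_mono) auto

text \<open>There are finitely many labels, so the sum of the absolute constants serves all of them
  and the exceptional null sets unite.\<close>

lemma dominated_uniformly:
  obtains C where "0 \<le> C"
    "AE x in P. \<forall>k\<in>{1..NY} - K. \<exists>j\<in>K. L (x, y k) \<le> L (x, y j) + C"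
proof -
  have ex: "\<forall>k\<in>{1..NY} - K. \<exists>C. AE x in P. \<exists>j\<in>K. L (x, y k) \<le> L (x, y j) + C"
  proof
    fix k assume "k \<in> {1..NY} - K"
    then have k: "k \<in> {1..NY}" "phi k = 0" using not_K by auto
    obtain C where "AE x in P. \<exists>j\<in>{1..NY}. 0 < phi j \<and> L (x, y k) \<le> L (x, y j) + C"
      using dominated[OF k] by blast
    then have "AE x in P. \<exists>j\<in>K. L (x, y k) \<le> L (x, y j) + C"
      by eventually_elim (auto simp: K_def)
    then show "\<exists>C. AE x in P. \<exists>j\<in>K. L (x, y k) \<le> L (x, y j) + C" by blast
  qed
  obtain C where C: "\<forall>k\<in>{1..NY} - K. AE x in P. \<exists>j\<in>K. L (x, y k) \<le> L (x, y j) + C k"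
    using bchoice[OF ex] by blast
  define C0 where "C0 = (\<Sum>k\<in>{1..NY} - K. \<bar>C k\<bar>)"
  have le: "C k \<le> C0" if "k \<in> {1..NY} - K" for k
    using member_le_sum[of k "{1..NY} - K" "\<lambda>k. \<bar>C k\<bar>"] that by (simp add: C0_def)
  have "AE x in P. \<forall>k\<in>{1..NY} - K. \<exists>j\<in>K. L (x, y k) \<le> L (x, y j) + C0"
  proof (subst AE_finite_all)
    show "\<forall>k\<in>{1..NY} - K. AE x in P. \<exists>j\<in>K. L (x, y k) \<le> L (x, y j) + C0"
    proof
      fix k assume k: "k \<in> {1..NY} - K"
      show "AE x in P. \<exists>j\<in>K. L (x, y k) \<le> L (x, y j) + C0"
        using bspec[OF C k]
      proof eventually_elim
        case (elim x)
        then obtain j where "j \<in> K" "L (x, y k) \<le> L (x, y j) + C k" by blast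
        then show ?case using le[OF k] by (intro bexI[of _ j]) auto
      qed
    qed
  qed simp
  moreover have "0 \<le> C0" by (simp add: C0_def sum_nonneg)
  ultimately show ?thesis using that by blast
qed

text \<open>Large multipliers for the upper bounds that vanish keep the maximum on the other labels.\<close>

lemma envelope_eq_reduced:
  assumes m: "nonneg_mult m"
  obtains m' where "nonneg_mult m'" "lin m' = lin m"
    "ext_integral P (envelope m') = ext_integral P (reduced m)"
proof -
  obtain C where C: "0 \<le> C" "AE x in P. \<forall>k\<in>{1..NY} - K. \<exists>j\<in>K. L (x, y k) \<le> L (x, y j) + C"
    by (rule dominated_uniformly) (rule that)
  define s where "s = (\<Sum>k=1..NY. \<bar>m (Upper k)\<bar> + \<bar>m (Lower k)\<bar>)"
  \<comment> \<open>Compensates the advantage a dropped label may have over the label dominating it: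
    \<open>C\<close> in the loss, \<open>m Cost * Cc\<close> in the transport cost, \<open>s\<close>
    in the label multipliers.\<close>
  define \<Lambda> where "\<Lambda> = C + m Cost * Cc + s"
  have mC: "0 \<le> m Cost" using m by (simp add: nonneg_mult_def)
  have \<Lambda>0: "0 \<le> \<Lambda>"
    using C(1) mC Cc_nonneg by (auto simp: \<Lambda>_def s_def intro!: add_nonneg_nonneg sum_nonneg)
  define m' where "m' r = (case r of Upper k \<Rightarrow> if k \<in> K then m r else \<Lambda>
     | Lower k \<Rightarrow> if k \<in> K then m r else 0 | _ \<Rightarrow> m r)" for r
  have "nonneg_mult m'" using m \<Lambda>0 by (auto simp: nonneg_mult_def m'_def)
  moreover have "lin m' = lin m"
  proof -
    \<comment> \<open>The multipliers that changed are paired with bounds that are both 0.\<close>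
    have "(\<Sum>k=1..NY. m' (Upper k) * phi k - m' (Lower k) * plo k) =
        (\<Sum>k=1..NY. m (Upper k) * phi k - m (Lower k) * plo k)"
    proof (rule sum.cong[OF refl])
      fix k assume k: "k \<in> {1..NY}"
      show "m' (Upper k) * phi k - m' (Lower k) * plo k = m (Upper k) * phi k - m (Lower k) * plo k"
      proof (cases "k \<in> K")
        case False
        then show ?thesis using not_K[OF k False] by simp
      qed (simp add: m'_def)
    qed
    then show ?thesis unfolding lin_eq by (simp add: m'_def)
  qed
  moreover have "ext_integral P (envelope m') = ext_integral P (reduced m)"
  proof (rule ext_integral_cong_AE)
    have pen: "penalty m' j x = penalty m j x" if "j \<in> JK" for j x
    proof -
      have "j \<in> J" "fst j \<in> K" using that JK_sub by (auto simp: JK_def)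
      then show ?thesis by (simp add: penalty_eq m'_def)
    qed
    have red: "reduced m' x = reduced m x" for x
      unfolding reduced_def by (intro arg_cong[where f=Max] image_cong refl) (simp add: pen)
    show "AE x in P. envelope m' x = reduced m x"
      using C(2)
    proof eventually_elim
      case (elim x)
      have "envelope m' x \<le> reduced m' x"
        unfolding envelope_def
      proof (rule Max.boundedI)
        fix a assume "a \<in> (\<lambda>j. loss j x - penalty m' j x) ` J"
        then obtain j where j: "j \<in> J" "a = loss j x - penalty m' j x" by auto
        have ge: "loss i x - penalty m' i x \<le> reduced m' x" if "i \<in> JK" for i
          unfolding reduced_def using JK_fin that by (intro Max_ge) auto
        show "a \<le> reduced m' x"
        proof (cases "fst j \<in> K")
          case True
          then have "j \<in> JK" using J_snd[OF j(1)] by (simp add: JK_def mem_Times_iff)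
          then show ?thesis using ge j(2) by simp
        next
          case False
          then have "fst j \<in> {1..NY} - K" using J_fst[OF j(1)] by simp
          then obtain k where k: "k \<in> K" "L (x, y (fst j)) \<le> L (x, y k) + C" using elim by blast
          define i where "i = (k, snd j)"
          have i: "i \<in> JK" using k J_snd[OF j(1)] by (simp add: JK_def i_def)
          then have iJ: "i \<in> J" using JK_sub by auto
          have kN: "k \<in> {1..NY}" using k K_sub by auto
          have "\<bar>m (Upper k)\<bar> + \<bar>m (Lower k)\<bar> \<le> s"
            unfolding s_def using kN by (intro member_le_sum) auto
          then have "m (Upper k) - m (Lower k) \<le> s" by linarith
          moreover have "m Cost * cost i x \<le> m Cost * Cc"
            using mC cC by (intro mult_left_mono) (simp_all add: cost_def)
          moreover have "0 \<le> m Cost * cost j x" using mC c0 by (simp add: cost_def)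
          moreover have "penalty m' j x = m Cost * cost j x + m (Sample (snd j)) + \<Lambda>"
            using False by (simp add: penalty_eq[OF j(1)] m'_def)
          moreover have "penalty m' i x = m Cost * cost i x + m (Sample (snd j)) + (m (Upper k) - m (Lower k))"
          proof -
            have "fst i = k" "snd i = snd j" by (simp_all add: i_def)
            then show ?thesis using k(1) by (simp add: penalty_eq[OF iJ] m'_def)
          qed
          moreover have "loss j x \<le> loss i x + C" using k(2) by (simp add: loss_def i_def)
          ultimately have "a \<le> loss i x - penalty m' i x" using j(2) by (simp add: \<Lambda>_def)
          then show ?thesis using ge[OF i] by simp
        qed
      qed (use J_fin J_ne in auto)
      then show ?case using reduced_le_envelope[of m' x] red[of x] by simp
    qed
  qed
  ultimately show ?thesis by (rule that)
qed

text \<open>A minimiser of the reduced problem is extended without changing its value. The reduced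
  integrand lies below the full one, so no feasible multiplier of the full problem can do
  better.\<close>

theorem dual_attained:
  "\<exists>p\<in>dual_feasible NY. dual_objective P NY y plo phi c \<epsilon> Nl z L p = dual_value P NY y plo phi c \<epsilon> Nl z L"
proof -
  let ?d = "dual_objective P NY y plo phi c \<epsilon> Nl z L"
  have "\<exists>m. nonneg_mult m \<and> (\<forall>m'. nonneg_mult m' \<longrightarrow>
      ereal (lin m) + ext_integral P (reduced m) \<le> ereal (lin m') + ext_integral P (reduced m'))"
  proof (cases "ext_integral P top_loss = -\<infinity>")
    \<comment> \<open>Zero multipliers then already give the value -\<infinity>; otherwise
      \<open>top_loss\<close> is integrable and \<open>dual_fun\<close> is the true
      objective.\<close>
    case True
    have "reduced (\<lambda>_. 0) = top_loss" by (simp add: fun_eq_iff reduced_def top_loss_def penalty_def)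
    then show ?thesis using True by (intro exI[of _ "\<lambda>_. 0"]) (simp add: nonneg_mult_def)
  next
    case False
    have i: "integrable P top_loss"
      using False top_loss_le by (intro P.integrable_of_ext_integral[OF top_loss_measurable, of CL]) auto
    obtain m where "nonneg_mult m" "\<And>m'. nonneg_mult m' \<Longrightarrow> dual_fun m \<le> dual_fun m'"
      by (rule exists_minimiser) (rule that)
    then show ?thesis unfolding ext_integral_reduced[OF i] by auto
  qed
  then obtain m where m: "nonneg_mult m" and min: "\<And>m'. nonneg_mult m' \<Longrightarrow>
      ereal (lin m) + ext_integral P (reduced m) \<le> ereal (lin m') + ext_integral P (reduced m')"
    by blast
  obtain n where n: "nonneg_mult n" "lin n = lin m" "ext_integral P (envelope n) = ext_integral P (reduced m)"
    by (rule envelope_eq_reduced[OF m]) (rule that)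
  define p where "p = (n Cost, \<lambda>i. n (Sample i), \<lambda>k. n (Upper k), \<lambda>k. n (Lower k))"
  have p: "p \<in> dual_feasible NY" using n(1) by (auto simp: p_def dual_feasible_def nonneg_mult_def)
  have "?d p \<le> ?d p'" if p': "p' \<in> dual_feasible NY" for p'
  proof -
    obtain \<alpha> \<beta> lhi llo where p'_eq: "p' = (\<alpha>, \<beta>, lhi, llo)" by (cases p')
    define m' where "m' r = (case r of Cost \<Rightarrow> \<alpha> | Sample i \<Rightarrow> \<beta> i | Upper k \<Rightarrow> lhi k | Lower k \<Rightarrow> llo k)" for r
    have m': "nonneg_mult m'" using p' by (auto simp: p'_eq m'_def dual_feasible_def nonneg_mult_def)
    have "?d p = ereal (lin m) + ext_integral P (reduced m)"
      unfolding p_def dual_objective_eq n(3)[symmetric] n(2)[symmetric] by (simp add: lin_def)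
    also have "\<dots> \<le> ereal (lin m') + ext_integral P (reduced m')" by (rule min[OF m'])
    also have "\<dots> \<le> ereal (lin m') + ext_integral P (envelope m')"
      by (intro add_left_mono ext_integral_mono AE_I2 reduced_le_envelope)
    also have "\<dots> = ?d p'"
      using dual_objective_eq[of m'] by (simp add: m'_def p'_eq lin_def)
    finally show ?thesis .
  qed
  then have "?d p = dual_value P NY y plo phi c \<epsilon> Nl z L"
    unfolding dual_value_def by (intro antisym INF_greatest INF_lower p) auto
  with p show ?thesis by blast
qed

end

section \<open>From semicontinuous data on a compact space to bounded measurable data\<close>

lemma upper_semicont_measurable:
  assumes "upper_semicont f"
  shows "f \<in> borel_measurable borel"
  using assms by (intro borel_measurableI_less) (simp add: upper_semicont_def)

text \<open>The open sets below integer heights cover the compact space, and finitely many of them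
  suffice.\<close>

lemma upper_semicont_bounded_above:
  fixes f :: "'a::topological_space \<Rightarrow> real"
  assumes f: "upper_semicont f" and c: "compact (UNIV :: 'a set)"
  obtains C where "\<And>x. f x \<le> C"
proof -
  have "open {x. f x < real n}" for n :: nat using f by (auto simp: upper_semicont_def)
  moreover have "UNIV \<subseteq> (\<Union>n::nat. {x. f x < real n})" using reals_Archimedean2 by auto
  ultimately obtain N :: "nat set" where N: "finite N" "UNIV \<subseteq> (\<Union>n\<in>N. {x. f x < real n})"
    using compactE_image[OF c, of UNIV "\<lambda>n. {x. f x < real n}"] by metis
  have "f x \<le> real (Max N)" for x
  proof -
    obtain n where n: "n \<in> N" "f x < real n" using N(2) by auto
    then have "real n \<le> real (Max N)" using N(1) by simp
    then show ?thesis using n(2) by linarith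
  qed
  then show ?thesis by (rule that)
qed

text \<open>Attainment carries a domination condition on labels with \<open>phi k = 0\<close>. The
  upper multiplier of such a label costs nothing; if its loss exceeds the others by unbounded
  amounts, raising the multiplier can keep lowering the integral, and the infimum is then approached
  only at infinity. The condition lets a finite multiplier remove the label from the
  maximum.\<close>

theorem theorem2:
  fixes P :: "('x::polish_space) measure"
    and y :: "nat \<Rightarrow> 'y::{polish_space, discrete_topology}"
    and z :: "nat \<Rightarrow> 'x \<times> 'y"
    and plo phi :: "nat \<Rightarrow> real"
    and \<epsilon> :: real
    and c :: "('x \<times> 'y) \<times> ('x \<times> 'y) \<Rightarrow> real"
    and \<Theta> :: "(real ^ 'q) set"
    and h :: "real ^ 'q \<Rightarrow> 'x \<Rightarrow> 'y measure"
    and l :: "'y measure \<times> 'y \<Rightarrow> real"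
    and NY Nl :: nat
  defines "S \<equiv> ambiguity_set P NY y plo phi c \<epsilon> (empirical Nl z)"
    and "R \<equiv> ambiguity_relint P NY y plo phi c \<epsilon> (empirical Nl z)"
    and "L \<equiv> \<lambda>\<theta> (x, y). l (h \<theta> x, y)"
  assumes "compact (UNIV :: 'x set)"
    and "bij_betw y {1..NY} (UNIV :: 'y set)"
    and "P \<in> prob_measures"
    and "1 \<le> Nl"
    and "\<And>k. k \<in> {1..NY} \<Longrightarrow> 0 \<le> plo k \<and> plo k \<le> phi k \<and> phi k \<le> 1"
    and "0 \<le> \<epsilon>"
    and "\<And>w. 0 \<le> c w"
    and "lower_semicont c" and "upper_semicont c"
    and "\<And>u v. c (u, v) = 0 \<longleftrightarrow> u = v"
    and "\<And>\<theta> x. \<theta> \<in> \<Theta> \<Longrightarrow> h \<theta> x \<in> prob_measures"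
    and "\<And>\<theta>. \<theta> \<in> \<Theta> \<Longrightarrow> upper_semicont (L \<theta>)"
  shows "(S \<noteq> {} \<longrightarrow>
            (\<forall>\<theta>\<in>\<Theta>. primal_value S (L \<theta>) = dual_value P NY y plo phi c \<epsilon> Nl z (L \<theta>))) \<and>
         (R \<noteq> {} \<longrightarrow>
            (\<forall>\<theta>\<in>\<Theta>.
               (\<forall>k\<in>{1..NY}. phi k = 0 \<longrightarrow>
                  (\<exists>C. AE x in P. \<exists>j\<in>{1..NY}. 0 < phi j \<and> l (h \<theta> x, y k) \<le> l (h \<theta> x, y j) + C)) \<longrightarrow>
               (\<exists>m\<in>dual_feasible NY. dual_objective P NY y plo phi c \<epsilon> Nl z (L \<theta>) m
                    = dual_value P NY y plo phi c \<epsilon> Nl z (L \<theta>))))"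
proof -
  have "finite (UNIV :: 'y set)"
    using bij_betw_finite[OF \<open>bij_betw y {1..NY} UNIV\<close>] by simp
  then have "compact (UNIV :: 'y set)" by (rule finite_imp_compact)
  then have Z: "compact (UNIV :: ('x \<times> 'y) set)"
    using compact_Times[OF \<open>compact (UNIV :: 'x set)\<close>] by (metis UNIV_Times_UNIV)
  then have ZZ: "compact (UNIV :: (('x \<times> 'y) \<times> ('x \<times> 'y)) set)"
    using compact_Times by (metis UNIV_Times_UNIV)
  obtain Cc where Cc: "\<And>w. c w \<le> Cc"
    using upper_semicont_bounded_above[OF \<open>upper_semicont c\<close> ZZ] by blast
  have amb: "\<exists>CL. transport_ambiguity P NY Nl y plo phi c \<epsilon> Cc (L \<theta>) CL" if "\<theta> \<in> \<Theta>" for \<theta>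
  proof -
    have usc: "upper_semicont (L \<theta>)" using assms that by blast
    obtain CL where "\<And>w. L \<theta> w \<le> CL" using upper_semicont_bounded_above[OF usc Z] by blast
    then have "transport_ambiguity P NY Nl y plo phi c \<epsilon> Cc (L \<theta>) CL"
      using assms Cc upper_semicont_measurable[OF usc] upper_semicont_measurable[OF \<open>upper_semicont c\<close>]
      by unfold_locales auto
    then show ?thesis by blast
  qed
  show ?thesis
  proof (intro conjI impI ballI)
    fix \<theta> assume S: "S \<noteq> {}" and \<theta>: "\<theta> \<in> \<Theta>"
    obtain CL where "transport_ambiguity P NY Nl y plo phi c \<epsilon> Cc (L \<theta>) CL" using amb[OF \<theta>] by blast
    then interpret transport_ambiguity P NY Nl y z plo phi c \<epsilon> Cc "L \<theta>" CL .
    show "primal_value S (L \<theta>) = dual_value P NY y plo phi c \<epsilon> Nl z (L \<theta>)"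
      using strong_duality S unfolding S_def .
  next
    fix \<theta> assume "R \<noteq> {}" and \<theta>: "\<theta> \<in> \<Theta>"
      and dom: "\<forall>k\<in>{1..NY}. phi k = 0 \<longrightarrow>
        (\<exists>C. AE x in P. \<exists>j\<in>{1..NY}. 0 < phi j \<and> l (h \<theta> x, y k) \<le> l (h \<theta> x, y j) + C)"
    obtain CL where "transport_ambiguity P NY Nl y plo phi c \<epsilon> Cc (L \<theta>) CL" using amb[OF \<theta>] by blast
    then interpret transport_ambiguity P NY Nl y z plo phi c \<epsilon> Cc "L \<theta>" CL .
    obtain \<mu> where "\<mu> \<in> R" using \<open>R \<noteq> {}\<close> by blast
    then obtain \<pi> where \<mu>: "\<mu> \<in> marginal_set P NY y plo phi"
      and \<pi>: "\<pi> \<in> couplings \<mu> (empirical Nl z)" "transport_cost c \<pi> < ennreal \<epsilon>"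
      and strict: "\<And>k. k \<in> {1..NY} \<Longrightarrow> plo k < phi k \<Longrightarrow>
        ennreal (plo k) < emeasure \<mu> (UNIV \<times> {y k}) \<and> emeasure \<mu> (UNIV \<times> {y k}) < ennreal (phi k)"
      unfolding R_def ambiguity_relint_def ambiguity_set_def by blast
    obtain w where w: "w \<in> W" "transport_cost c \<pi> = ennreal (mean w cost)"
      "\<And>i. i \<in> {1..Nl} \<Longrightarrow> mean w (on_sample i) = 1 / real Nl"
      "\<And>k. k \<in> {1..NY} \<Longrightarrow> emeasure \<mu> (UNIV \<times> {y k}) = ennreal (mean w (on_label k))"
      "\<And>k. k \<in> {1..NY} \<Longrightarrow> plo k \<le> mean w (on_label k) \<and> mean w (on_label k) \<le> phi k"
      by (rule coupling_weights[OF \<mu> \<pi>(1)]) (rule that)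
    interpret strictly_feasible P NY Nl y z plo phi c \<epsilon> Cc "L \<theta>" CL w
    proof
      show "mean w cost < \<epsilon>"
      proof (rule ccontr)
        assume "\<not> mean w cost < \<epsilon>"
        then have "ennreal \<epsilon> \<le> transport_cost c \<pi>" unfolding w(2) by (intro ennreal_leI) simp
        with \<pi>(2) show False by simp
      qed
      fix k assume k: "k \<in> {1..NY}"
      show "plo k < mean w (on_label k) \<and> mean w (on_label k) < phi k" if "plo k < phi k"
      proof -
        have "0 \<le> plo k" "plo k \<le> mean w (on_label k)" using assms k w(5)[OF k] by auto
        \<comment> \<open>Strict inequalities descend from \<open>ennreal\<close> because the
          numbers compared are nonnegative.\<close>
        then show ?thesis using strict[OF k that] unfolding w(4)[OF k] by (simp add: ennreal_less_iff)
      qed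
      show "\<exists>C. AE x in P. \<exists>j\<in>{1..NY}. 0 < phi j \<and> L \<theta> (x, y k) \<le> L \<theta> (x, y j) + C" if "phi k = 0"
        using dom k that by (simp add: L_def)
    qed (use w in auto)
    show "\<exists>m\<in>dual_feasible NY. dual_objective P NY y plo phi c \<epsilon> Nl z (L \<theta>) m
        = dual_value P NY y plo phi c \<epsilon> Nl z (L \<theta>)"
      by (rule dual_attained)
  qed
qed

end
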